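(* Let $\varphi\in\mathcal{S}(\mathbb{D}^2)$ be a Schur function on the bidisc with $\varphi(\mathbf{0})\neq0$, where $\mathbf{0}=(0,0)$. The following assertions are equivalent: (1) There exist $\varphi_1,\varphi_2\in\mathcal{S}(\mathbb{D})$ such that $\varphi(\mathbf{z})=\varphi_1(z_1)\varphi_2(z_2)$ for all $\mathbf{z}=(z_1,z_2)\in\mathbb{D}^2$. (2) There exist Agler kernels $\{K_1,K_2\}$ of $\varphi$ such that $K_1(\mathbf{z},\mathbf{w})$ depends only on $z_1$ and $\bar{w}_1$, and \[ \overline{\varphi(\mathbf{0})}\,K_2(\cdot,(w_1,0))=\overline{\varphi(w_1,0)}\,K_2(\cdot,\mathbf{0})\qquad(w_1\in\mathbb{D}). \] (3) There exist Agler kernels $\{L_1,L_2\}$ of $\varphi$ such that every function in $\mathcal{H}_{L_1}$ depends only on $z_1$, and \[ \varphi(\mathbf{0})f(\cdot,0)=\varphi(\cdot,0)\,f(\mathbf{0})\qquad(f\in\mathcal{H}_{L_2}). \] (4) There exist Hilbert spaces $\mathcal{H}_1,\mathcal{H}_2$ and a co-isometric colligation \[ V=\begin{bmatrix} \varphi(\mathbf{0})&B_1&B_2\\C_1&D_1&D_2\\C_2&0&D_4 \end{bmatrix}\in\mathcal{B}(\mathbb{C}\oplus(\mathcal{H}_1\oplus\mathcal{H}_2)) \] such that $\varphi=\tau_V$ and $\varphi(\mathbf{0})D_2=C_1B_2$.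
   Context: $\mathbb{D}$ is the open unit disc and $\mathbb{D}^2$ the open unit bidisc. For $n\geq 1$, $\mathcal{S}(\mathbb{D}^n)$ is the set of Schur functions: analytic functions $\varphi:\mathbb{D}^n\to\mathbb{C}$ with $\sup|\varphi|\le1$. A function $K:\mathbb{D}^2\times\mathbb{D}^2\to\mathbb{C}$ is a kernel if $\sum_{i,j=1}^mK(\mathbf{z}_i,\mathbf{z}_j)c_j\bar{c}_i\ge0$ for all $m\ge1$, $\mathbf{z}_1,\dots,\mathbf{z}_m\in\mathbb{D}^2$, $c_1,\dots,c_m\in\mathbb{C}$; $\mathcal{H}_K$ denotes the corresponding reproducing kernel Hilbert space of functions on $\mathbb{D}^2$, and $K(\cdot,\mathbf{w})\in\mathcal{H}_K$ denotes the function $\mathbf{z}\mapsto K(\mathbf{z},\mathbf{w})$. A pair of kernels $\{K_1,K_2\}$ on $\mathbb{D}^2$ is called a pair of Agler kernels of $\varphi$ if \[ 1-\varphi(\mathbf{z})\overline{\varphi(\mathbf{w})}=(1-z_1\bar{w}_1)K_1(\mathbf{z},\mathbf{w})+(1-z_2\bar{w}_2)K_2(\mathbf{z},\mathbf{w})\qquad(\mathbf{z},\mathbf{w}\in\mathbb{D}^2). \] A colligation is a block operator $V=\begin{bmatrix} a & B\\ C& D\end{bmatrix}$ on $\mathbb{C}\oplus(\mathcal{H}_1\oplus\mathcal{H}_2)$, with $B=\begin{bmatrix}B_1&B_2\end{bmatrix}$, $C=\begin{bmatrix}C_1\\C_2\end{bmatrix}$ and $D$ the compression of $V$ to $\mathcal{H}_1\oplus\mathcal{H}_2$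 (in (4), $D=\begin{bmatrix}D_1&D_2\\0&D_4\end{bmatrix}$). It is co-isometric if $VV^*=I$. For contractive $V$ its transfer function is \[ \tau_V(\mathbf{z})=a+B\,(I_{\mathcal{H}_1\oplus\mathcal{H}_2}-E(\mathbf{z})D)^{-1}E(\mathbf{z})\,C\qquad(\mathbf{z}\in\mathbb{D}^2), \] where $E(\mathbf{z})=z_1I_{\mathcal{H}_1}\oplus z_2I_{\mathcal{H}_2}$. *)

theory Defs
  imports "HOL-Analysis.Analysis" "HOL-Library.Function_Algebras"
begin

section \<open>Schur functions\<close>

abbreviation disc :: "complex set"
  where "disc \<equiv> ball 0 1"

abbreviation bidisc :: "(complex \<times> complex) set"
  where "bidisc \<equiv> disc \<times> disc"

definition schur_disc :: "(complex \<Rightarrow> complex) \<Rightarrow> bool"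
  where "schur_disc f \<longleftrightarrow> f holomorphic_on disc \<and> (\<forall>z\<in>disc. cmod (f z) \<le> 1)"

text \<open>The library has no holomorphic functions of two variables. As in one variable, analytic means
  complex differentiable at each point: the derivative is a complex linear form.\<close>

definition holomorphic2_on :: "(complex \<times> complex \<Rightarrow> complex) \<Rightarrow> (complex \<times> complex) set \<Rightarrow> bool"
  where "holomorphic2_on f S \<longleftrightarrow>
    (\<forall>z\<in>S. \<exists>a b. (f has_derivative (\<lambda>(h1, h2). a * h1 + b * h2)) (at z within S))"

definition schur_bidisc :: "(complex \<times> complex \<Rightarrow> complex) \<Rightarrow> bool"
  where "schur_bidisc f \<longleftrightarrow> holomorphic2_on f bidisc \<and> (\<forall>z\<in>bidisc. cmod (f z) \<le> 1)"

section \<open>Complex Hilbert spaces\<close>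

class complex_vector = ab_group_add +
  fixes scaleC :: "complex \<Rightarrow> 'a \<Rightarrow> 'a" (infixr "*\<^sub>C" 75)
  assumes scaleC_add_right: "a *\<^sub>C (x + y) = a *\<^sub>C x + a *\<^sub>C y"
    and scaleC_add_left: "(a + b) *\<^sub>C x = a *\<^sub>C x + b *\<^sub>C x"
    and scaleC_scaleC: "a *\<^sub>C b *\<^sub>C x = (a * b) *\<^sub>C x"
    and scaleC_one: "1 *\<^sub>C x = x"

lemma vector_space_scaleC: "vector_space (scaleC :: complex \<Rightarrow> 'a::complex_vector \<Rightarrow> 'a)"
  by unfold_locales (simp_all add: scaleC_add_right scaleC_add_left scaleC_scaleC scaleC_one)

instantiation complex :: complex_vector
begin

definition scaleC_complex :: "complex \<Rightarrow> complex \<Rightarrow> complex"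
  where "scaleC_complex a x = a * x"

instance
  by standard (simp_all add: scaleC_complex_def algebra_simps)

end

instantiation prod :: (complex_vector, complex_vector) complex_vector
begin

definition scaleC_prod :: "complex \<Rightarrow> 'a \<times> 'b \<Rightarrow> 'a \<times> 'b"
  where "scaleC_prod a x = (a *\<^sub>C fst x, a *\<^sub>C snd x)"

instance
  by standard
    (simp_all add: scaleC_prod_def scaleC_add_right scaleC_add_left scaleC_scaleC scaleC_one
      prod_eq_iff)

end

instantiation "fun" :: (type, complex_vector) complex_vector
begin

definition scaleC_fun :: "complex \<Rightarrow> ('a \<Rightarrow> 'b) \<Rightarrow> 'a \<Rightarrow> 'b"
  where "scaleC_fun a f = (\<lambda>x. a *\<^sub>C f x)"

instance
  by standard
    (simp_all add: scaleC_fun_def scaleC_add_right scaleC_add_left scaleC_scaleC scaleC_one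
      plus_fun_def)

end

text \<open>A Hilbert space is carried by a linear subspace of an ambient complex vector space, so that
  spaces of functions can be treated. Only the restriction of \<open>hinner\<close> to the carrier matters.
  The ambient space carries no topology. Inner products are linear in the first argument.\<close>

record 'h hilb =
  hcarrier :: "'h set"
  hinner :: "'h \<Rightarrow> 'h \<Rightarrow> complex"

definition hnorm :: "'h hilb \<Rightarrow> 'h \<Rightarrow> real"
  where "hnorm H x = sqrt (Re (hinner H x x))"

locale hilbert_space =
  fixes H :: "'h::complex_vector hilb"
  assumes subspace: "module.subspace scaleC (hcarrier H)"
    and inner_add: "\<lbrakk>x \<in> hcarrier H; y \<in> hcarrier H; z \<in> hcarrier H\<rbrakk>
      \<Longrightarrow> hinner H (x + y) z = hinner H x z + hinner H y z"
    and inner_scale: "\<lbrakk>x \<in> hcarrier H; y \<in> hcarrier H\<rbrakk> \<Longrightarrow> hinner H (a *\<^sub>C x) y = a * hinner H x y"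
    and inner_commute: "\<lbrakk>x \<in> hcarrier H; y \<in> hcarrier H\<rbrakk> \<Longrightarrow> hinner H y x = cnj (hinner H x y)"
    and inner_nonneg: "x \<in> hcarrier H \<Longrightarrow> hinner H x x \<in> \<real>\<^sub>\<ge>\<^sub>0"
    and inner_definite: "\<lbrakk>x \<in> hcarrier H; hinner H x x = 0\<rbrakk> \<Longrightarrow> x = 0"
    and complete: "\<lbrakk>\<And>n. X n \<in> hcarrier H;
        \<And>e. e > 0 \<Longrightarrow> \<exists>N. \<forall>m\<ge>N. \<forall>n\<ge>N. hnorm H (X m - X n) < e\<rbrakk>
      \<Longrightarrow> \<exists>x\<in>hcarrier H. (\<lambda>n. hnorm H (X n - x)) \<longlonglongrightarrow> 0"

definition complex_hilb :: "complex hilb"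
  where "complex_hilb = \<lparr>hcarrier = UNIV, hinner = (\<lambda>x y. x * cnj y)\<rparr>"

definition hsum :: "'h hilb \<Rightarrow> 'k hilb \<Rightarrow> ('h \<times> 'k) hilb" (infixr "\<oplus>\<^sub>H" 65)
  where "H \<oplus>\<^sub>H K = \<lparr>hcarrier = hcarrier H \<times> hcarrier K,
    hinner = (\<lambda>x y. hinner H (fst x) (fst y) + hinner K (snd x) (snd y))\<rparr>"

text \<open>Operators are compared on the carriers only.\<close>

definition bounded_op ::
    "'h::complex_vector hilb \<Rightarrow> 'k::complex_vector hilb \<Rightarrow> ('h \<Rightarrow> 'k) \<Rightarrow> bool"
  where "bounded_op H K T \<longleftrightarrow>
    T \<in> hcarrier H \<rightarrow> hcarrier K \<and>
    (\<forall>x\<in>hcarrier H. \<forall>y\<in>hcarrier H. T (x + y) = T x + T y) \<and>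
    (\<forall>a. \<forall>x\<in>hcarrier H. T (a *\<^sub>C x) = a *\<^sub>C T x) \<and>
    (\<exists>M. \<forall>x\<in>hcarrier H. hnorm K (T x) \<le> M * hnorm H x)"

definition is_adjoint ::
    "'h::complex_vector hilb \<Rightarrow> 'k::complex_vector hilb \<Rightarrow> ('h \<Rightarrow> 'k) \<Rightarrow> ('k \<Rightarrow> 'h) \<Rightarrow> bool"
  where "is_adjoint H K T T' \<longleftrightarrow> bounded_op K H T' \<and>
    (\<forall>x\<in>hcarrier H. \<forall>y\<in>hcarrier K. hinner K (T x) y = hinner H x (T' y))"

definition coisometric :: "'h::complex_vector hilb \<Rightarrow> ('h \<Rightarrow> 'h) \<Rightarrow> bool"
  where "coisometric H V \<longleftrightarrow> bounded_op H H V \<and>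
    (\<exists>V'. is_adjoint H H V V' \<and> (\<forall>x\<in>hcarrier H. V (V' x) = x))"

section \<open>Kernels on the bidisc\<close>

type_synonym bikernel = "complex \<times> complex \<Rightarrow> complex \<times> complex \<Rightarrow> complex"

definition is_kernel :: "bikernel \<Rightarrow> bool"
  where "is_kernel K \<longleftrightarrow> (\<forall>(m::nat) z c. z \<in> {..<m} \<rightarrow> bidisc \<longrightarrow>
    (\<Sum>i<m. \<Sum>j<m. K (z i) (z j) * c j * cnj (c i)) \<in> \<real>\<^sub>\<ge>\<^sub>0)"

definition agler_kernels :: "(complex \<times> complex \<Rightarrow> complex) \<Rightarrow> bikernel \<Rightarrow> bikernel \<Rightarrow> bool"
  where "agler_kernels \<phi> K1 K2 \<longleftrightarrow> is_kernel K1 \<and> is_kernel K2 \<and>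
    (\<forall>z\<in>bidisc. \<forall>w\<in>bidisc. 1 - \<phi> z * cnj (\<phi> w) =
      (1 - fst z * cnj (fst w)) * K1 z w + (1 - snd z * cnj (snd w)) * K2 z w)"

text \<open>A function on the bidisc is represented by its extension by zero, so that the vector space
  operations are the pointwise ones.\<close>

definition kernel_section :: "bikernel \<Rightarrow> complex \<times> complex \<Rightarrow> complex \<times> complex \<Rightarrow> complex"
  where "kernel_section K w = (\<lambda>z. if z \<in> bidisc then K z w else 0)"

definition is_rkhs :: "bikernel \<Rightarrow> (complex \<times> complex \<Rightarrow> complex) hilb \<Rightarrow> bool"
  where "is_rkhs K H \<longleftrightarrow> hilbert_space H \<and>
    (\<forall>f\<in>hcarrier H. \<forall>z. z \<notin> bidisc \<longrightarrow> f z = 0) \<and>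
    (\<forall>w\<in>bidisc. kernel_section K w \<in> hcarrier H \<and>
      (\<forall>f\<in>hcarrier H. hinner H f (kernel_section K w) = f w))"

section \<open>Colligations and transfer functions\<close>

text \<open>An operator on \<open>\<complex> \<oplus> (H1 \<oplus> H2)\<close> given by its block matrix; an operator out of \<open>\<complex>\<close>
  is a function on the complex numbers.\<close>

definition block_op ::
    "complex \<Rightarrow> ('h \<Rightarrow> complex) \<Rightarrow> ('k \<Rightarrow> complex) \<Rightarrow>
     (complex \<Rightarrow> 'h) \<Rightarrow> ('h \<Rightarrow> 'h) \<Rightarrow> ('k \<Rightarrow> 'h) \<Rightarrow>
     (complex \<Rightarrow> 'k) \<Rightarrow> ('h \<Rightarrow> 'k) \<Rightarrow> ('k \<Rightarrow> 'k) \<Rightarrow>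
     complex \<times> 'h::complex_vector \<times> 'k::complex_vector \<Rightarrow> complex \<times> 'h \<times> 'k"
  where "block_op a B1 B2 C1 D1 D2 C2 D3 D4 = (\<lambda>(c, x, y).
    (a * c + B1 x + B2 y,
     C1 c + D1 x + D2 y,
     C2 c + D3 x + D4 y))"

text \<open>The blocks of \<open>V = [a B; C D]\<close> on \<open>\<complex> \<oplus> H\<close>. The vector \<open>C 1\<close> is written \<open>coll_C V\<close>.\<close>

definition coll_a :: "(complex \<times> 'h::complex_vector \<Rightarrow> complex \<times> 'h) \<Rightarrow> complex"
  where "coll_a V = fst (V (1, 0))"

definition coll_B :: "(complex \<times> 'h::complex_vector \<Rightarrow> complex \<times> 'h) \<Rightarrow> 'h \<Rightarrow> complex"
  where "coll_B V h = fst (V (0, h))"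

definition coll_C :: "(complex \<times> 'h::complex_vector \<Rightarrow> complex \<times> 'h) \<Rightarrow> 'h"
  where "coll_C V = snd (V (1, 0))"

definition coll_D :: "(complex \<times> 'h::complex_vector \<Rightarrow> complex \<times> 'h) \<Rightarrow> 'h \<Rightarrow> 'h"
  where "coll_D V h = snd (V (0, h))"

definition E_op ::
    "complex \<times> complex \<Rightarrow> 'h::complex_vector \<times> 'k::complex_vector \<Rightarrow> 'h \<times> 'k"
  where "E_op z = (\<lambda>(x, y). (fst z *\<^sub>C x, snd z *\<^sub>C y))"

text \<open>For contractive \<open>V\<close> and \<open>z\<close> in the bidisc, \<open>I - E(z) D\<close> is a bijection of the carrier of
  \<open>H1 \<oplus> H2\<close>, so \<open>inv_into\<close> is its inverse there.\<close>

definition transfer_fun ::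
    "'h::complex_vector hilb \<Rightarrow> 'k::complex_vector hilb \<Rightarrow>
     (complex \<times> 'h \<times> 'k \<Rightarrow> complex \<times> 'h \<times> 'k) \<Rightarrow> complex \<times> complex \<Rightarrow> complex"
  where "transfer_fun H1 H2 V z = coll_a V + coll_B V
    (inv_into (hcarrier (H1 \<oplus>\<^sub>H H2)) (\<lambda>h. h - E_op z (coll_D V h)) (E_op z (coll_C V)))"

text \<open>\<open>V\<close> is bounded since \<open>coisometric\<close> includes it. HOL cannot quantify over types, so "there exist
  Hilbert spaces" is rendered twice: over subspaces of the functions of two complex variables
  (which contain, up to unitary equivalence, all Hilbert spaces of dimension at most the continuum,
  by spaces \<open>l\<^sup>2(S)\<close>), and over subspaces of arbitrary types, from which the first version is
  to be recovered.\<close>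

definition factoring_colligation ::
    "(complex \<times> complex \<Rightarrow> complex) \<Rightarrow> 'h::complex_vector hilb \<Rightarrow> 'k::complex_vector hilb \<Rightarrow>
     (complex \<times> 'h \<times> 'k \<Rightarrow> complex \<times> 'h \<times> 'k) \<Rightarrow> bool"
  where "factoring_colligation \<phi> H1 H2 V \<longleftrightarrow>
    (\<exists>B1 B2 C1 D1 D2 C2 D4.
      bounded_op H1 complex_hilb B1 \<and> bounded_op H2 complex_hilb B2 \<and>
      bounded_op complex_hilb H1 C1 \<and> bounded_op H1 H1 D1 \<and> bounded_op H2 H1 D2 \<and>
      bounded_op complex_hilb H2 C2 \<and> bounded_op H2 H2 D4 \<and>
      V = block_op (\<phi> (0, 0)) B1 B2
                   C1         D1 D2
                   C2   (\<lambda>_. 0) D4 \<and>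
      coisometric (complex_hilb \<oplus>\<^sub>H H1 \<oplus>\<^sub>H H2) V \<and>
      (\<forall>z\<in>bidisc. \<phi> z = transfer_fun H1 H2 V z) \<and>
      (\<forall>y\<in>hcarrier H2. \<phi> (0, 0) *\<^sub>C D2 y = C1 (B2 y)))"

end

theory Submission
  imports Defs "HOL-Complex_Analysis.Complex_Analysis"
begin

text \<open>Everything is equivalent to the identity \<open>\<phi> z * \<phi> 0 = \<phi> (z1, 0) * \<phi> (0, z2)\<close>, which yields
  Schur factors once the two slices are rescaled by the supremum of \<open>\<bar>\<phi> (\<cdot>, 0)\<bar>\<close>.

  Kernels as in (2) satisfy \<open>(1 - z1 cnj w1) K1 = 1 - T g(z1) cnj (g w1)\<close> with \<open>g = \<phi> (\<cdot>, 0) / \<phi> 0\<close>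
  and \<open>T = 1 - K1 (0, 0)\<close>, hence \<open>(1 - z2 cnj w2) K2 = T g(z1) cnj (g w1) - \<phi> z cnj (\<phi> w)\<close>;
  positivity at the two points \<open>(z1, z2)\<close> and \<open>(0, z2)\<close> forces \<open>\<phi> (z1, z2) = g(z1) \<phi> (0, z2)\<close>.
  Conversely, the de Branges--Rovnyak kernels of the factors give Agler kernels. Conditions (2) and (3)
  translate into each other by the reproducing property. In (4), the resolvent equation is block
  triangular and \<open>\<phi> 0 D2 = C1 B2\<close> makes its solution split; conversely the product of the amplified
  coisometric de Branges--Rovnyak realizations of the factors is a colligation as required.\<close>

section \<open>Complex Hilbert spaces\<close>

text \<open>The formula for K1 is modelled on the case where \<phi> is the product of \<phi>1 and
  \<phi>2 and K1 is the Pick kernel of \<phi>1: there g = \<phi>1 / \<phi>1 0 and T is the squared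
  modulus of \<phi>1 0, so 1 - T g(z1) cnj (g w1) is the numerator of that kernel. The supremum is
  forced. Since g 0 = 1, a nonconstant g exceeds 1 in modulus somewhere; dividing the slice by its
  supremum is the least rescaling that makes it Schur, and the product identity turns the bound 1 on
  \<phi> into exactly the bound that the other factor then requires. The analytic part is shaped by
  the carriers: a Hilbert space is a subspace of an ambient vector space, and the spaces to be
  produced must consist of functions of two complex variables. Reproducing spaces are therefore
  completed by pointwise limits inside the function space, and an isometry known only on a family of
  vectors is reached through its adjoint, which Riesz representation defines everywhere at once. The
  product identity mentions no space at all; this is what lets it connect colligations over
  arbitrary types with the one built from function spaces.\<close>

interpretation CV: vector_space "scaleC :: complex \<Rightarrow> 'a::complex_vector \<Rightarrow> 'a"
  by (rule vector_space_scaleC)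

lemma scaleC_fun_apply [simp]: "(a *\<^sub>C f) x = a * f x" for f :: "'b \<Rightarrow> complex"
  by (simp add: scaleC_fun_def scaleC_complex_def)

text \<open>What a Hilbert space retains without definiteness and completeness. The estimates are
  needed at this generality for spans of kernel functions and for completions not yet known to be
  definite.\<close>

locale semi_inner =
  fixes H :: "'h::complex_vector hilb"
  assumes subspace_carrier: "CV.subspace (hcarrier H)"
    and add_left: "\<lbrakk>x \<in> hcarrier H; y \<in> hcarrier H; z \<in> hcarrier H\<rbrakk>
      \<Longrightarrow> hinner H (x + y) z = hinner H x z + hinner H y z"
    and scale_left: "\<lbrakk>x \<in> hcarrier H; y \<in> hcarrier H\<rbrakk> \<Longrightarrow> hinner H (a *\<^sub>C x) y = a * hinner H x y"
    and commute: "\<lbrakk>x \<in> hcarrier H; y \<in> hcarrier H\<rbrakk> \<Longrightarrow> hinner H y x = cnj (hinner H x y)"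
    and nonneg: "x \<in> hcarrier H \<Longrightarrow> hinner H x x \<in> \<real>\<^sub>\<ge>\<^sub>0"
begin

lemma zero_mem [simp]: "0 \<in> hcarrier H"
  by (rule CV.subspace_0[OF subspace_carrier])

lemma add_mem [simp]: "\<lbrakk>x \<in> hcarrier H; y \<in> hcarrier H\<rbrakk> \<Longrightarrow> x + y \<in> hcarrier H"
  by (rule CV.subspace_add[OF subspace_carrier])

lemma scale_mem [simp]: "x \<in> hcarrier H \<Longrightarrow> a *\<^sub>C x \<in> hcarrier H"
  by (rule CV.subspace_scale[OF subspace_carrier])

lemma diff_mem [simp]: "\<lbrakk>x \<in> hcarrier H; y \<in> hcarrier H\<rbrakk> \<Longrightarrow> x - y \<in> hcarrier H"
  by (rule CV.subspace_diff[OF subspace_carrier])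

lemma diff_left: "\<lbrakk>x \<in> hcarrier H; y \<in> hcarrier H; z \<in> hcarrier H\<rbrakk>
    \<Longrightarrow> hinner H (x - y) z = hinner H x z - hinner H y z"
  using add_left[of x "(-1) *\<^sub>C y" z] scale_left[of y z "-1"] scale_mem[of y "-1"] by simp

lemma zero_left [simp]: "x \<in> hcarrier H \<Longrightarrow> hinner H 0 x = 0"
  using scale_left[of 0 x 0] by simp

lemma add_right: "\<lbrakk>x \<in> hcarrier H; y \<in> hcarrier H; z \<in> hcarrier H\<rbrakk>
    \<Longrightarrow> hinner H z (x + y) = hinner H z x + hinner H z y"
  by (metis add_left add_mem commute complex_cnj_add)

lemma scale_right: "\<lbrakk>x \<in> hcarrier H; y \<in> hcarrier H\<rbrakk>
    \<Longrightarrow> hinner H y (a *\<^sub>C x) = cnj a * hinner H y x"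
  by (metis scale_left scale_mem commute complex_cnj_mult)

lemma diff_right: "\<lbrakk>x \<in> hcarrier H; y \<in> hcarrier H; z \<in> hcarrier H\<rbrakk>
    \<Longrightarrow> hinner H z (x - y) = hinner H z x - hinner H z y"
  by (metis diff_left diff_mem commute complex_cnj_diff)

lemma zero_right [simp]: "x \<in> hcarrier H \<Longrightarrow> hinner H x 0 = 0"
  using scale_right[of 0 x 0] by simp

lemmas expand = add_left add_right scale_left scale_right diff_left diff_right

lemma hnorm_nonneg [simp]: "x \<in> hcarrier H \<Longrightarrow> 0 \<le> hnorm H x"
  using nonneg[of x] by (auto simp: hnorm_def complex_nonneg_Reals_iff)

lemma inner_self: "x \<in> hcarrier H \<Longrightarrow> hinner H x x = of_real ((hnorm H x)\<^sup>2)"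
  using nonneg[of x] by (auto simp: hnorm_def complex_nonneg_Reals_iff complex_eq_iff)

lemma Re_inner_self: "x \<in> hcarrier H \<Longrightarrow> Re (hinner H x x) = (hnorm H x)\<^sup>2"
  by (simp add: inner_self)

lemma norm_inner_self: "x \<in> hcarrier H \<Longrightarrow> cmod (hinner H x x) = (hnorm H x)\<^sup>2"
  by (simp add: inner_self norm_power)

lemma hnorm_zero [simp]: "hnorm H 0 = 0"
  by (simp add: hnorm_def)

lemma Re_commute: "\<lbrakk>x \<in> hcarrier H; y \<in> hcarrier H\<rbrakk> \<Longrightarrow> Re (hinner H y x) = Re (hinner H x y)"
  by (subst commute[of x y]) simp_all

lemma hnorm_add_sq: "\<lbrakk>x \<in> hcarrier H; y \<in> hcarrier H\<rbrakk>
    \<Longrightarrow> (hnorm H (x + y))\<^sup>2 = (hnorm H x)\<^sup>2 + 2 * Re (hinner H x y) + (hnorm H y)\<^sup>2"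
  by (simp add: Re_inner_self[symmetric] expand Re_commute[of x y])

lemma hnorm_diff_sq: "\<lbrakk>x \<in> hcarrier H; y \<in> hcarrier H\<rbrakk>
    \<Longrightarrow> (hnorm H (x - y))\<^sup>2 = (hnorm H x)\<^sup>2 - 2 * Re (hinner H x y) + (hnorm H y)\<^sup>2"
  by (simp add: Re_inner_self[symmetric] expand Re_commute[of x y])

lemma hnorm_scale [simp]: "x \<in> hcarrier H \<Longrightarrow> hnorm H (a *\<^sub>C x) = cmod a * hnorm H x"
proof (rule power2_eq_imp_eq)
  assume x: "x \<in> hcarrier H"
  have "complex_of_real ((hnorm H (a *\<^sub>C x))\<^sup>2) = complex_of_real ((cmod a * hnorm H x)\<^sup>2)"
    using x by (simp add: inner_self[symmetric] expand power_mult_distrib complex_norm_square mult.commute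
        del: of_real_power)
  then show "(hnorm H (a *\<^sub>C x))\<^sup>2 = (cmod a * hnorm H x)\<^sup>2"
    by (simp only: of_real_eq_iff)
qed auto

lemma hnorm_minus_commute: "\<lbrakk>x \<in> hcarrier H; y \<in> hcarrier H\<rbrakk> \<Longrightarrow> hnorm H (x - y) = hnorm H (y - x)"
  using hnorm_scale[of "y - x" "-1"] by simp

lemma cauchy_schwarz:
  assumes x: "x \<in> hcarrier H" and y: "y \<in> hcarrier H"
  shows "cmod (hinner H x y) \<le> hnorm H x * hnorm H y"
proof -
  define s where "s = cmod (hinner H x y)"
  define X where "X = (hnorm H x)\<^sup>2"
  define Y where "Y = (hnorm H y)\<^sup>2"
  \<comment> \<open>The phase of \<open>a\<close> makes the cross term real, so nonnegativity of the
    squared norm becomes a quadratic inequality in the real \<open>t\<close>. Nothing is divided by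
    \<open>Y\<close>, which may vanish for a nonzero \<open>y\<close>.\<close>
  have key: "0 \<le> X - 2 * t * s\<^sup>2 + t\<^sup>2 * s\<^sup>2 * Y" for t
  proof -
    define a where "a = of_real t * hinner H x y"
    have "0 \<le> (hnorm H (x - a *\<^sub>C y))\<^sup>2"
      by simp
    also have "\<dots> = X - 2 * Re (cnj a * hinner H x y) + (cmod a)\<^sup>2 * Y"
      using x y by (simp add: hnorm_diff_sq expand X_def Y_def power_mult_distrib)
    also have "cnj a * hinner H x y = of_real (t * s\<^sup>2)"
      unfolding a_def s_def of_real_mult complex_norm_square by simp
    also have "(cmod a)\<^sup>2 = t\<^sup>2 * s\<^sup>2"
      by (simp add: a_def norm_mult s_def power_mult_distrib)
    finally show ?thesis
      by (simp add: mult.assoc)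
  qed
  have "s\<^sup>2 \<le> X * Y"
  proof (cases "Y = 0")
    case True
    have "s = 0"
    proof (rule ccontr)
      assume "s \<noteq> 0"
      \<comment> \<open>For \<open>Y = 0\<close> the bound is affine in \<open>t\<close>; this
        \<open>t\<close> is chosen to give it the value -1.\<close>
      then have "X - 2 * ((X + 1) / (2 * s\<^sup>2)) * s\<^sup>2 = -1"
        by (simp add: field_simps)
      with key[of "(X + 1) / (2 * s\<^sup>2)"] True show False by simp
    qed
    with True show ?thesis by simp
  next
    case False
    then have "Y > 0" by (simp add: Y_def)
    with key[of "1 / Y"] have "0 \<le> X - s\<^sup>2 / Y"
      by (simp add: power2_eq_square field_simps)
    with \<open>Y > 0\<close> show ?thesis by (simp add: field_simps)
  qed
  also have "X * Y = (hnorm H x * hnorm H y)\<^sup>2"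
    by (simp add: X_def Y_def power_mult_distrib)
  finally show ?thesis
    unfolding s_def by (rule power2_le_imp_le) (use x y in simp)
qed

lemma hnorm_triangle:
  assumes x: "x \<in> hcarrier H" and y: "y \<in> hcarrier H"
  shows "hnorm H (x + y) \<le> hnorm H x + hnorm H y"
proof (rule power2_le_imp_le)
  have "Re (hinner H x y) \<le> hnorm H x * hnorm H y"
    using cauchy_schwarz[OF x y] complex_Re_le_cmod[of "hinner H x y"] by linarith
  then show "(hnorm H (x + y))\<^sup>2 \<le> (hnorm H x + hnorm H y)\<^sup>2"
    using x y by (simp add: hnorm_add_sq power2_sum)
qed (use x y in simp)

lemma hnorm_triangle_diff:
  "\<lbrakk>x \<in> hcarrier H; y \<in> hcarrier H; z \<in> hcarrier H\<rbrakk>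
    \<Longrightarrow> hnorm H (x - z) \<le> hnorm H (x - y) + hnorm H (y - z)"
  using hnorm_triangle[of "x - y" "y - z"] by simp

lemma hnorm_abs_diff:
  assumes x: "x \<in> hcarrier H" and y: "y \<in> hcarrier H"
  shows "\<bar>hnorm H x - hnorm H y\<bar> \<le> hnorm H (x - y)"
  using hnorm_triangle[of "x - y" y] hnorm_triangle[of "y - x" x] hnorm_minus_commute[OF x y] x y
  by simp

lemma tendsto_inner_left:
  assumes "\<And>n. X n \<in> hcarrier H" "x \<in> hcarrier H" "y \<in> hcarrier H"
    and "(\<lambda>n. hnorm H (X n - x)) \<longlonglongrightarrow> 0"
  shows "(\<lambda>n. hinner H (X n) y) \<longlonglongrightarrow> hinner H x y"
proof -
  have "(\<lambda>n. hinner H (X n) y - hinner H x y) \<longlonglongrightarrow> 0"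
  proof (rule Lim_null_comparison)
    show "\<forall>\<^sub>F n in sequentially. norm (hinner H (X n) y - hinner H x y) \<le> hnorm H (X n - x) * hnorm H y"
      using assms cauchy_schwarz[of "X _ - x" y] by (simp add: diff_left)
    show "(\<lambda>n. hnorm H (X n - x) * hnorm H y) \<longlonglongrightarrow> 0"
      using tendsto_mult_right[OF assms(4), of "hnorm H y"] by simp
  qed
  then show ?thesis by (simp add: LIM_zero_iff)
qed

lemma tendsto_hnorm:
  assumes "\<And>n. X n \<in> hcarrier H" "x \<in> hcarrier H"
    and "(\<lambda>n. hnorm H (X n - x)) \<longlonglongrightarrow> 0"
  shows "(\<lambda>n. hnorm H (X n)) \<longlonglongrightarrow> hnorm H x"
proof -
  have "(\<lambda>n. hnorm H (X n) - hnorm H x) \<longlonglongrightarrow> 0"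
    by (rule Lim_null_comparison[OF _ assms(3)]) (use assms hnorm_abs_diff in auto)
  then show ?thesis by (simp add: LIM_zero_iff)
qed

end

sublocale hilbert_space \<subseteq> semi_inner H
  by unfold_locales (fact subspace inner_add inner_scale inner_commute inner_nonneg)+

lemma (in hilbert_space) hnorm_eq_0: "x \<in> hcarrier H \<Longrightarrow> hnorm H x = 0 \<longleftrightarrow> x = 0"
  using inner_definite[of x] by (auto simp: inner_self)

lemma (in hilbert_space) eqI_inner:
  assumes "x \<in> hcarrier H" "y \<in> hcarrier H" "\<And>z. z \<in> hcarrier H \<Longrightarrow> hinner H z x = hinner H z y"
  shows "x = y"
  using inner_definite[of "x - y"] assms by (simp add: diff_right)

section \<open>The scalar field and orthogonal sums as Hilbert spaces\<close>

lemma complex_hilb_simps [simp]: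
  "hcarrier complex_hilb = UNIV" "hinner complex_hilb x y = x * cnj y"
  "hnorm complex_hilb x = cmod x"
  by (simp_all add: complex_hilb_def hnorm_def cmod_def power2_eq_square)

lemma hilbert_complex: "hilbert_space complex_hilb"
proof
  show "CV.subspace (hcarrier complex_hilb)"
    by (simp add: CV.subspace_def)
  fix X :: "nat \<Rightarrow> complex"
  assume "\<And>e. e > 0 \<Longrightarrow> \<exists>N. \<forall>m\<ge>N. \<forall>n\<ge>N. hnorm complex_hilb (X m - X n) < e"
  then have "Cauchy X"
    by (simp add: Cauchy_def dist_norm)
  then obtain x where "X \<longlonglongrightarrow> x"
    using Cauchy_convergent convergent_def by blast
  then show "\<exists>x\<in>hcarrier complex_hilb. (\<lambda>n. hnorm complex_hilb (X n - x)) \<longlonglongrightarrow> 0"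
    by (auto simp: tendsto_norm_zero_iff LIM_zero_iff)
qed (auto simp: scaleC_complex_def algebra_simps complex_nonneg_Reals_iff)

lemma hsum_simps [simp]:
  "hcarrier (H \<oplus>\<^sub>H K) = hcarrier H \<times> hcarrier K"
  "hinner (H \<oplus>\<^sub>H K) x y = hinner H (fst x) (fst y) + hinner K (snd x) (snd y)"
  by (simp_all add: hsum_def)

lemma scaleC_prod_simps [simp]: "a *\<^sub>C (x, y) = (a *\<^sub>C x, a *\<^sub>C y)"
  "fst (a *\<^sub>C p) = a *\<^sub>C fst p" "snd (a *\<^sub>C p) = a *\<^sub>C snd p"
  by (simp_all add: scaleC_prod_def)

text \<open>Each coordinate norm is dominated by the norm of the sum, so Cauchy sequences are Cauchy
  in both coordinates. The Pythagorean identity is exported because the later coordinate estimates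
  rest on it.\<close>

lemma hilbert_hsum:
  fixes H :: "'h::complex_vector hilb" and K :: "'k::complex_vector hilb"
  assumes "hilbert_space H" "hilbert_space K"
  shows "hilbert_space (H \<oplus>\<^sub>H K)"
    and "x \<in> hcarrier (H \<oplus>\<^sub>H K) \<Longrightarrow>
      (hnorm (H \<oplus>\<^sub>H K) x)\<^sup>2 = (hnorm H (fst x))\<^sup>2 + (hnorm K (snd x))\<^sup>2"
proof -
  interpret H: hilbert_space H by fact
  interpret K: hilbert_space K by fact
  interpret S: semi_inner "H \<oplus>\<^sub>H K"
  proof
    show "CV.subspace (hcarrier (H \<oplus>\<^sub>H K))"
      by (auto simp: CV.subspace_def zero_prod_def)
    show "hinner (H \<oplus>\<^sub>H K) y x = cnj (hinner (H \<oplus>\<^sub>H K) x y)"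
      if "x \<in> hcarrier (H \<oplus>\<^sub>H K)" "y \<in> hcarrier (H \<oplus>\<^sub>H K)" for x y
      using that H.commute[of "fst x" "fst y"] K.commute[of "snd x" "snd y"] by auto
  qed (auto simp: H.expand K.expand algebra_simps H.nonneg K.nonneg)
  have sq: "(hnorm (H \<oplus>\<^sub>H K) x)\<^sup>2 = (hnorm H (fst x))\<^sup>2 + (hnorm K (snd x))\<^sup>2"
    if "x \<in> hcarrier (H \<oplus>\<^sub>H K)" for x
    using that by (auto simp flip: S.Re_inner_self H.Re_inner_self K.Re_inner_self)
  then show "x \<in> hcarrier (H \<oplus>\<^sub>H K) \<Longrightarrow>
      (hnorm (H \<oplus>\<^sub>H K) x)\<^sup>2 = (hnorm H (fst x))\<^sup>2 + (hnorm K (snd x))\<^sup>2" by auto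
  show "hilbert_space (H \<oplus>\<^sub>H K)"
  proof
    show "x = 0" if x: "x \<in> hcarrier (H \<oplus>\<^sub>H K)" and 0: "hinner (H \<oplus>\<^sub>H K) x x = 0" for x
    proof -
      have "(hnorm H (fst x))\<^sup>2 + (hnorm K (snd x))\<^sup>2 = 0"
        using sq[OF x] S.Re_inner_self[OF x] 0 by (metis zero_complex.sel(1))
      then have "hnorm H (fst x) = 0" "hnorm K (snd x) = 0"
        by (simp_all add: sum_power2_eq_zero_iff)
      then show ?thesis
        using x by (auto simp: H.hnorm_eq_0 K.hnorm_eq_0 zero_prod_def)
    qed
    fix X :: "nat \<Rightarrow> 'h \<times> 'k"
    assume X: "\<And>n. X n \<in> hcarrier (H \<oplus>\<^sub>H K)"
      and C: "\<And>e. e > 0 \<Longrightarrow> \<exists>N. \<forall>m\<ge>N. \<forall>n\<ge>N. hnorm (H \<oplus>\<^sub>H K) (X m - X n) < e"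
    have le: "hnorm H (fst x) \<le> hnorm (H \<oplus>\<^sub>H K) x" "hnorm K (snd x) \<le> hnorm (H \<oplus>\<^sub>H K) x"
      if "x \<in> hcarrier (H \<oplus>\<^sub>H K)" for x
      using sq[OF that] S.hnorm_nonneg[OF that] by (auto intro: power2_le_imp_le)
    have X': "fst (X n) \<in> hcarrier H" "snd (X n) \<in> hcarrier K" for n
      using X[of n] by auto
    have d: "hnorm H (fst (X m) - fst (X n)) \<le> hnorm (H \<oplus>\<^sub>H K) (X m - X n)"
      "hnorm K (snd (X m) - snd (X n)) \<le> hnorm (H \<oplus>\<^sub>H K) (X m - X n)" for m n
      using le[of "X m - X n"] S.diff_mem[OF X X, of m n] by simp_all
    have "\<exists>N. \<forall>m\<ge>N. \<forall>n\<ge>N. hnorm H (fst (X m) - fst (X n)) < e" if "e > 0" for e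
      using C[OF that] d(1) le_less_trans by meson
    from H.complete[of "\<lambda>n. fst (X n)", OF X'(1) this]
    obtain x where x: "x \<in> hcarrier H" "(\<lambda>n. hnorm H (fst (X n) - x)) \<longlonglongrightarrow> 0" by auto
    have "\<exists>N. \<forall>m\<ge>N. \<forall>n\<ge>N. hnorm K (snd (X m) - snd (X n)) < e" if "e > 0" for e
      using C[OF that] d(2) le_less_trans by meson
    from K.complete[of "\<lambda>n. snd (X n)", OF X'(2) this]
    obtain y where y: "y \<in> hcarrier K" "(\<lambda>n. hnorm K (snd (X n) - y)) \<longlonglongrightarrow> 0" by auto
    have "(\<lambda>n. sqrt ((hnorm H (fst (X n) - x))\<^sup>2 + (hnorm K (snd (X n) - y))\<^sup>2)) \<longlonglongrightarrow> sqrt (0\<^sup>2 + 0\<^sup>2)"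
      by (intro tendsto_intros x y)
    moreover have "sqrt ((hnorm H (fst (X n) - x))\<^sup>2 + (hnorm K (snd (X n) - y))\<^sup>2)
        = hnorm (H \<oplus>\<^sub>H K) (X n - (x, y))" for n
      using sq[of "X n - (x, y)"] X[of n] x(1) y(1) S.hnorm_nonneg[of "X n - (x, y)"]
      by (intro real_sqrt_unique) auto
    ultimately show "\<exists>x\<in>hcarrier (H \<oplus>\<^sub>H K). (\<lambda>n. hnorm (H \<oplus>\<^sub>H K) (X n - x)) \<longlonglongrightarrow> 0"
      using x(1) y(1) by (intro bexI[of _ "(x, y)"]) auto
  qed (fact S.subspace_carrier S.add_left S.scale_left S.commute S.nonneg)+
qed

section \<open>Riesz representation, lurking isometries and resolvents\<close>

text \<open>The representing vector is the limit of a minimising sequence \<open>T p\<close> of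
  \<open>\<parallel>T p\<parallel>\<^sup>2 - 2 Re (l p)\<close>; the values of \<open>T\<close> need not form a closed subspace.\<close>

lemma (in hilbert_space) riesz_representation:
  fixes P :: "'p::complex_vector set"
  assumes P: "CV.subspace P"
    and T: "T \<in> P \<rightarrow> hcarrier H"
    and T_add: "\<And>p q. \<lbrakk>p \<in> P; q \<in> P\<rbrakk> \<Longrightarrow> T (p + q) = T p + T q"
    and T_scale: "\<And>a p. p \<in> P \<Longrightarrow> T (a *\<^sub>C p) = a *\<^sub>C T p"
    and l_add: "\<And>p q. \<lbrakk>p \<in> P; q \<in> P\<rbrakk> \<Longrightarrow> l (p + q) = l p + l q"
    and l_scale: "\<And>a p. p \<in> P \<Longrightarrow> l (a *\<^sub>C p) = a * l p"
    and bound: "\<And>p. p \<in> P \<Longrightarrow> cmod (l p) \<le> C * hnorm H (T p)"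
    and C: "0 \<le> C"
  obtains g where "g \<in> hcarrier H" "hnorm H g \<le> C" "\<And>p. p \<in> P \<Longrightarrow> hinner H (T p) g = l p"
proof -
  have P0: "0 \<in> P" and Padd: "\<And>p q. \<lbrakk>p \<in> P; q \<in> P\<rbrakk> \<Longrightarrow> p + q \<in> P"
    and Pscale: "\<And>a p. p \<in> P \<Longrightarrow> a *\<^sub>C p \<in> P"
    using P by (auto simp: CV.subspace_def)
  have TH [simp]: "T p \<in> hcarrier H" if "p \<in> P" for p
    using T that by auto
  \<comment> \<open>For a representing vector g this is the squared norm of \<open>T p - g\<close>
    minus that of g, so minimising it drives \<open>T p\<close> towards g.\<close>
  define J where "J p = (hnorm H (T p))\<^sup>2 - 2 * Re (l p)" for p
  have J_lower: "- C\<^sup>2 \<le> J p" if "p \<in> P" for p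
  proof -
    have "Re (l p) \<le> C * hnorm H (T p)"
      using bound[OF that] complex_Re_le_cmod[of "l p"] by linarith
    moreover have "0 \<le> (hnorm H (T p) - C)\<^sup>2" by simp
    ultimately show ?thesis
      by (simp add: J_def power2_diff algebra_simps)
  qed
  define d where "d = (INF p\<in>P. J p)"
  have bdd: "bdd_below (J ` P)"
    using J_lower by (auto simp: bdd_below_def)
  have d_le: "d \<le> J p" if "p \<in> P" for p
    unfolding d_def using bdd that by (rule cINF_lower)
  have "\<exists>p\<in>P. J p < d + 1 / real (Suc n)" for n
    using cINF_less_iff[of P J "d + 1 / real (Suc n)"] P0 bdd unfolding d_def[symmetric] by auto
  then obtain p where p: "\<And>n. p n \<in> P" and Jp: "\<And>n. J (p n) < d + 1 / real (Suc n)"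
    by metis
  \<comment> \<open>Parallelogram law at the midpoint \<open>m\<close>: the linear terms cancel,
    leaving \<open>2 * J x + 2 * J y - 4 * J m\<close>, and \<open>J m\<close> is at least
    \<open>d\<close>.\<close>
  have par: "(hnorm H (T x - T y))\<^sup>2 \<le> 2 * (J x - d) + 2 * (J y - d)"
    if x: "x \<in> P" and y: "y \<in> P" for x y
  proof -
    define m where "m = (1 / 2) *\<^sub>C (x + y)"
    have m: "m \<in> P"
      unfolding m_def using x y Padd Pscale by blast
    have Tm: "T m = (1 / 2) *\<^sub>C (T x + T y)" and lm: "l m = (l x + l y) / 2"
      unfolding m_def using x y Padd by (simp_all add: T_scale T_add l_scale l_add)
    have "4 * (hnorm H (T m))\<^sup>2 = (hnorm H (T x + T y))\<^sup>2"
      unfolding Tm using x y by (simp add: power_divide)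
    then have "4 * J m = (hnorm H (T x + T y))\<^sup>2 - 4 * Re (l x) - 4 * Re (l y)"
      by (simp add: J_def lm algebra_simps)
    then show ?thesis
      using d_le[OF m] x y by (simp add: hnorm_add_sq hnorm_diff_sq J_def)
  qed
  have "\<exists>N. \<forall>m\<ge>N. \<forall>n\<ge>N. hnorm H (T (p m) - T (p n)) < e" if e: "e > 0" for e
  proof -
    obtain N where N: "inverse (real (Suc N)) < e\<^sup>2 / 4"
      using reals_Archimedean[of "e\<^sup>2 / 4"] e by auto
    have small: "J (p n) - d < e\<^sup>2 / 4" if "n \<ge> N" for n
    proof -
      have "1 / real (Suc n) \<le> inverse (real (Suc N))"
        using that by (simp add: field_simps)
      with N Jp[of n] show ?thesis by linarith
    qed
    have "hnorm H (T (p m) - T (p n)) < e" if "m \<ge> N" "n \<ge> N" for m n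
    proof (rule power2_less_imp_less)
      show "(hnorm H (T (p m) - T (p n)))\<^sup>2 < e\<^sup>2"
        using par[OF p[of m] p[of n]] small[OF that(1)] small[OF that(2)] by (simp add: field_simps)
    qed (use e in simp)
    then show ?thesis by blast
  qed
  from complete[of "\<lambda>n. T (p n)", OF TH[OF p] this]
  obtain g where g: "g \<in> hcarrier H" and lim: "(\<lambda>n. hnorm H (T (p n) - g)) \<longlonglongrightarrow> 0" by auto
  have rep: "hinner H (T q) g = l q" if q: "q \<in> P" for q
  proof -
    define \<delta> where "\<delta> = hinner H (T q) g - l q"
    \<comment> \<open>First variation at the infimum: moving \<open>p n\<close> by
      \<open>s *\<^sub>C q\<close> cannot lower \<open>J\<close> by more than its excess over
      \<open>d\<close>, which is below \<open>1 / Suc n\<close>. The limit turns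
      \<open>T (p n)\<close> into \<open>g\<close>.\<close>
    have var: "0 \<le> 2 * Re (s * \<delta>) + (cmod s)\<^sup>2 * (hnorm H (T q))\<^sup>2" for s
    proof -
      define w where "w n = 2 * Re (cnj s * hinner H (T (p n)) (T q)) + (cmod s)\<^sup>2 * (hnorm H (T q))\<^sup>2
          - 2 * Re (s * l q)" for n
      have "- 1 / real (Suc n) \<le> w n" for n
      proof -
        have "d \<le> J (p n + s *\<^sub>C q)"
          using p q Padd Pscale by (intro d_le) blast
        also have "\<dots> = J (p n) + w n"
          using p[of n] q Pscale
          by (simp add: J_def w_def T_add T_scale l_add l_scale hnorm_add_sq expand power_mult_distrib)
        finally show ?thesis using Jp[of n] by simp
      qed
      moreover have "(\<lambda>n. - 1 / real (Suc n)) \<longlonglongrightarrow> 0"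
        using tendsto_minus[OF LIMSEQ_inverse_real_of_nat] by (simp add: inverse_eq_divide)
      moreover have "w \<longlonglongrightarrow> 2 * Re (cnj s * hinner H g (T q)) + (cmod s)\<^sup>2 * (hnorm H (T q))\<^sup>2
          - 2 * Re (s * l q)"
        unfolding w_def using p q g lim by (intro tendsto_intros tendsto_inner_left) auto
      ultimately have "0 \<le> 2 * Re (cnj s * hinner H g (T q)) + (cmod s)\<^sup>2 * (hnorm H (T q))\<^sup>2
          - 2 * Re (s * l q)"
        by (rule_tac LIMSEQ_le) auto
      also have "cnj s * hinner H g (T q) = cnj (s * hinner H (T q) g)"
        using q g commute[of "T q" g] by simp
      finally show ?thesis
        by (simp add: \<delta>_def algebra_simps)
    qed
    define N where "N = (hnorm H (T q))\<^sup>2"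
    \<comment> \<open>A step against the gradient, \<open>s = - t * cnj \<delta>\<close>, gains
      \<open>2 * t\<close> and loses \<open>t * t * N\<close> times the squared modulus of \<delta>;
      this \<open>t\<close> keeps \<open>t * N\<close> below 2.\<close>
    define t where "t = 1 / (N + 1)"
    have N: "N \<ge> 0" by (simp add: N_def)
    have "0 \<le> - 2 * t * (cmod \<delta>)\<^sup>2 + t\<^sup>2 * (cmod \<delta>)\<^sup>2 * N"
    proof -
      have "- of_real t * cnj \<delta> * \<delta> = of_real (- t * (cmod \<delta>)\<^sup>2)"
        unfolding of_real_mult of_real_minus complex_norm_square by simp
      then show ?thesis
        using var[of "- of_real t * cnj \<delta>"]
        by (simp add: norm_mult power_mult_distrib N_def del: of_real_mult)
    qed
    also have "\<dots> = - t * (cmod \<delta>)\<^sup>2 * (2 - t * N)"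
      by (simp add: power2_eq_square algebra_simps)
    finally have "t * (cmod \<delta>)\<^sup>2 * (2 - t * N) \<le> 0" by simp
    moreover have "2 - t * N > 0" "t > 0"
      using N by (auto simp: t_def field_simps)
    ultimately have "(cmod \<delta>)\<^sup>2 \<le> 0"
      by (simp add: mult_le_0_iff not_le zero_less_mult_iff)
    then show ?thesis by (simp add: \<delta>_def)
  qed
  \<comment> \<open>Since \<open>T (p n)\<close> tends to \<open>g\<close>, the bound on
    \<open>l\<close> passes to the limit as a bound of the squared norm of \<open>g\<close> by
    \<open>C\<close> times its norm.\<close>
  have "(\<lambda>n. cmod (l (p n))) \<longlonglongrightarrow> cmod (hinner H g g)"
    unfolding rep[OF p, symmetric] using p g lim by (intro tendsto_norm tendsto_inner_left) auto
  moreover have "(\<lambda>n. C * hnorm H (T (p n))) \<longlonglongrightarrow> C * hnorm H g"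
    using p g lim by (intro tendsto_intros tendsto_hnorm) auto
  ultimately have "cmod (hinner H g g) \<le> C * hnorm H g"
    by (rule LIMSEQ_le) (use bound p in auto)
  then have "hnorm H g * hnorm H g \<le> C * hnorm H g"
    using g by (simp add: norm_inner_self power2_eq_square)
  then have "hnorm H g \<le> C"
    using C hnorm_nonneg[OF g] by (cases "hnorm H g = 0") auto
  with g rep show ?thesis by (blast intro: that)
qed

section \<open>Adjoints and isometries given on a family of vectors\<close>

lemma bounded_opD:
  assumes "bounded_op H K T" "x \<in> hcarrier H"
  shows "T x \<in> hcarrier K"
    and "y \<in> hcarrier H \<Longrightarrow> T (x + y) = T x + T y"
    and "T (a *\<^sub>C x) = a *\<^sub>C T x"
  using assms by (auto simp: bounded_op_def)

lemma bounded_op_diff: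
  assumes "bounded_op H K T" "x \<in> hcarrier H" "y \<in> hcarrier H" "- y \<in> hcarrier H"
  shows "T (x - y) = T x - T y"
  using bounded_opD(2)[OF assms(1,2,4)] bounded_opD(3)[OF assms(1,3), of "-1"] by simp

text \<open>Riesz representation of x \<mapsto> \<open>hinner K (T x) y\<close> for each
  \<open>y\<close>. The vectors are picked one by one; linearity of the choice follows because inner
  products determine a vector.\<close>

lemma ex_adjoint:
  assumes H: "hilbert_space H" and K: "hilbert_space K" and T: "bounded_op H K T"
  obtains T' where "is_adjoint H K T T'"
proof -
  interpret H: hilbert_space H by fact
  interpret K: hilbert_space K by fact
  obtain M0 where M0: "\<And>x. x \<in> hcarrier H \<Longrightarrow> hnorm K (T x) \<le> M0 * hnorm H x"
    using T unfolding bounded_op_def by blast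
  define M where "M = \<bar>M0\<bar>"
  have M: "hnorm K (T x) \<le> M * hnorm H x" if "x \<in> hcarrier H" for x
    using M0[OF that] H.hnorm_nonneg[OF that] unfolding M_def
    by (meson abs_ge_self mult_right_mono order_trans)
  note TD [simp] = bounded_opD[OF T]
  have "\<exists>g. g \<in> hcarrier H \<and> hnorm H g \<le> M * hnorm K y \<and>
      (\<forall>x\<in>hcarrier H. hinner H x g = hinner K (T x) y)" if y: "y \<in> hcarrier K" for y
  proof (rule H.riesz_representation[of "hcarrier H" "\<lambda>x. x" "\<lambda>x. hinner K (T x) y" "M * hnorm K y"])
    show "cmod (hinner K (T x) y) \<le> M * hnorm K y * hnorm H x" if x: "x \<in> hcarrier H" for x
    proof -
      have "cmod (hinner K (T x) y) \<le> hnorm K (T x) * hnorm K y"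
        using x y by (simp add: K.cauchy_schwarz)
      also have "\<dots> \<le> (M * hnorm H x) * hnorm K y"
        using M[OF x] y by (simp add: mult_right_mono)
      finally show ?thesis by (simp add: mult_ac)
    qed
  qed (use y in \<open>auto simp: K.expand M_def H.subspace_carrier\<close>)
  then obtain T' where T': "\<And>y. y \<in> hcarrier K \<Longrightarrow> T' y \<in> hcarrier H"
    and nT': "\<And>y. y \<in> hcarrier K \<Longrightarrow> hnorm H (T' y) \<le> M * hnorm K y"
    and adj: "\<And>x y. \<lbrakk>x \<in> hcarrier H; y \<in> hcarrier K\<rbrakk> \<Longrightarrow> hinner H x (T' y) = hinner K (T x) y"
    by metis
  have "bounded_op K H T'"
    unfolding bounded_op_def
  proof (intro conjI ballI allI exI[of _ M] funcsetI)
    fix x y assume "x \<in> hcarrier K" "y \<in> hcarrier K"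
    then show "T' (x + y) = T' x + T' y"
      by (intro H.eqI_inner) (simp_all add: T' adj H.expand K.expand)
  next
    fix a x assume "x \<in> hcarrier K"
    then show "T' (a *\<^sub>C x) = a *\<^sub>C T' x"
      by (intro H.eqI_inner) (simp_all add: T' adj H.expand K.expand)
  qed (use T' nT' in auto)
  with adj show ?thesis
    by (intro that[of T']) (simp add: is_adjoint_def)
qed

text \<open>The lurking isometry argument: \<open>V\<close> is the adjoint of the isometry \<open>u i \<mapsto> v i\<close>.\<close>

lemma lurking_isometry:
  assumes H: "hilbert_space H"
    and uH: "\<And>i. i \<in> I \<Longrightarrow> u i \<in> hcarrier H" and vH: "\<And>i. i \<in> I \<Longrightarrow> v i \<in> hcarrier H"
    and gram: "\<And>i j. \<lbrakk>i \<in> I; j \<in> I\<rbrakk> \<Longrightarrow> hinner H (u i) (u j) = hinner H (v i) (v j)"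
    and total: "\<And>x. \<lbrakk>x \<in> hcarrier H; \<And>i. i \<in> I \<Longrightarrow> hinner H x (u i) = 0\<rbrakk> \<Longrightarrow> x = 0"
  obtains V where "coisometric H V"
    "\<And>x i. \<lbrakk>x \<in> hcarrier H; i \<in> I\<rbrakk> \<Longrightarrow> hinner H (V x) (u i) = hinner H x (v i)"
proof -
  interpret hilbert_space H by fact
  \<comment> \<open>A linear relation stands in for the isometry, so no well-definedness of its
    value on combinations of the \<open>u i\<close> has to be shown. Riesz representation is applied
    with \<open>T = fst\<close>.\<close>
  define P where "P = CV.span ((\<lambda>i. (u i, v i)) ` I)"
  have P: "CV.subspace P"
    by (simp add: P_def)
  have PH: "fst p \<in> hcarrier H \<and> snd p \<in> hcarrier H" if "p \<in> P" for p
    using that unfolding P_def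
    by (rule CV.span_induct) (auto simp: CV.subspace_def uH vH zero_prod_def)
  note PH [simp] = PH[THEN conjunct1] PH[THEN conjunct2]
  have uvP: "(u i, v i) \<in> P" if "i \<in> I" for i
    unfolding P_def using that by (intro CV.span_base) auto
  have iso1: "hinner H (fst p) (u i) = hinner H (snd p) (v i)" if "p \<in> P" and i: "i \<in> I" for p i
  proof -
    have "p \<in> P \<and> hinner H (fst p) (u i) = hinner H (snd p) (v i)"
      using that(1) unfolding P_def
    proof (rule CV.span_induct)
      show "CV.subspace {p. p \<in> CV.span ((\<lambda>i. (u i, v i)) ` I) \<and>
          hinner H (fst p) (u i) = hinner H (snd p) (v i)}"
        unfolding P_def[symmetric]
        using P i by (auto simp: CV.subspace_def expand uH vH)
    qed (use i in \<open>auto intro: CV.span_base simp: gram\<close>)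
    then show ?thesis by simp
  qed
  have iso: "hinner H (fst p) (fst q) = hinner H (snd p) (snd q)" if p: "p \<in> P" and "q \<in> P" for p q
  proof -
    have "q \<in> P \<and> hinner H (fst p) (fst q) = hinner H (snd p) (snd q)"
      using that(2) unfolding P_def
    proof (rule CV.span_induct)
      show "CV.subspace {q. q \<in> CV.span ((\<lambda>i. (u i, v i)) ` I) \<and>
          hinner H (fst p) (fst q) = hinner H (snd p) (snd q)}"
        unfolding P_def[symmetric]
        using P p by (auto simp: CV.subspace_def expand)
    qed (use p in \<open>auto intro: CV.span_base simp: iso1\<close>)
    then show ?thesis by simp
  qed
  have norm_iso: "hnorm H (snd p) = hnorm H (fst p)" if "p \<in> P" for p
    by (simp add: hnorm_def iso that)
  have "\<exists>y. y \<in> hcarrier H \<and> hnorm H y \<le> hnorm H x \<and>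
      (\<forall>p\<in>P. hinner H (fst p) y = hinner H (snd p) x)" if x: "x \<in> hcarrier H" for x
  proof (rule riesz_representation[of P fst "\<lambda>p. hinner H (snd p) x" "hnorm H x"])
    show "cmod (hinner H (snd p) x) \<le> hnorm H x * hnorm H (fst p)" if "p \<in> P" for p
      using cauchy_schwarz[of "snd p" x] that x by (simp add: norm_iso mult.commute)
  qed (use x P in \<open>auto simp: expand\<close>)
  then obtain V where VH [simp]: "\<And>x. x \<in> hcarrier H \<Longrightarrow> V x \<in> hcarrier H"
    and nV: "\<And>x. x \<in> hcarrier H \<Longrightarrow> hnorm H (V x) \<le> hnorm H x"
    and VP: "\<And>x p. \<lbrakk>x \<in> hcarrier H; p \<in> P\<rbrakk> \<Longrightarrow> hinner H (fst p) (V x) = hinner H (snd p) x"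
    by metis
  have Vu: "hinner H (V x) (u i) = hinner H x (v i)" if "x \<in> hcarrier H" "i \<in> I" for x i
    using VP[OF that(1) uvP[OF that(2)]] that uH vH commute[of "u i" "V x"] commute[of "v i" x] by simp
  \<comment> \<open>Testing against the \<open>u i\<close> suffices by totality. This makes the
    pointwise chosen \<open>V\<close> linear.\<close>
  have eqI: "x = y" if "x \<in> hcarrier H" "y \<in> hcarrier H"
    "\<And>i. i \<in> I \<Longrightarrow> hinner H x (u i) = hinner H y (u i)" for x y
    using total[of "x - y"] that by (simp add: diff_left uH)
  have V: "bounded_op H H V"
    unfolding bounded_op_def
  proof (intro conjI ballI allI exI[of _ 1] funcsetI)
    fix x y assume "x \<in> hcarrier H" "y \<in> hcarrier H"
    then show "V (x + y) = V x + V y"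
      by (intro eqI) (simp_all add: Vu expand uH vH)
  next
    fix a x assume "x \<in> hcarrier H"
    then show "V (a *\<^sub>C x) = a *\<^sub>C V x"
      by (intro eqI) (simp_all add: Vu expand uH vH)
  qed (use nV in auto)
  obtain V' where V': "is_adjoint H H V V'"
    using ex_adjoint[OF H H V] .
  then have V'H [simp]: "x \<in> hcarrier H \<Longrightarrow> V' x \<in> hcarrier H" 
    and adj: "\<lbrakk>x \<in> hcarrier H; y \<in> hcarrier H\<rbrakk> \<Longrightarrow> hinner H x (V' y) = hinner H (V x) y" for x y
    by (auto simp: is_adjoint_def bounded_op_def)
  \<comment> \<open>The adjoint of \<open>V\<close> is the everywhere defined extension of the
    isometry, and \<open>V\<close> undoes it on the \<open>v i\<close>; totality carries this over
    to \<open>V (V' x) = x\<close>.\<close>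
  have V'u: "V' (u i) = v i" if "i \<in> I" for i
    using that by (intro eqI_inner) (simp_all add: uH vH adj Vu)
  have Vv: "V (v i) = u i" if "i \<in> I" for i
    using that by (intro eqI) (simp_all add: uH vH Vu gram)
  have "V (V' x) = x" if x: "x \<in> hcarrier H" for x
  proof (rule eqI)
    fix i assume i: "i \<in> I"
    have "hinner H (V (V' x)) (u i) = hinner H (V' x) (v i)"
      using x i by (simp add: Vu)
    also have "\<dots> = cnj (hinner H (V (v i)) x)"
      using x i by (simp add: adj[symmetric] vH commute[of "v i" "V' x"])
    also have "\<dots> = hinner H x (u i)"
      using x i by (simp add: Vv uH commute[of "u i" x])
    finally show "hinner H (V (V' x)) (u i) = hinner H x (u i)" .
  qed (use x in auto)
  then have "coisometric H V"
    using V V' by (auto simp: coisometric_def)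
  with Vu show ?thesis by (rule that[rotated])
qed

section \<open>Contractions and Neumann series\<close>

text \<open>\<open>V V' = I\<close> makes the adjoint \<open>V'\<close> isometric; Cauchy-Schwarz
  for \<open>x\<close> and \<open>V' y\<close> with \<open>y = V x\<close> gives the bound.\<close>

lemma coisometric_contractive:
  assumes "hilbert_space H" "coisometric H V" "x \<in> hcarrier H"
  shows "hnorm H (V x) \<le> hnorm H x"
proof -
  interpret hilbert_space H by fact
  obtain V' where V: "bounded_op H H V" and V': "is_adjoint H H V V'"
    and VV': "\<And>x. x \<in> hcarrier H \<Longrightarrow> V (V' x) = x"
    using assms by (auto simp: coisometric_def)
  define y where "y = V x"
  have y: "y \<in> hcarrier H" "V' y \<in> hcarrier H"
    using assms(3) V V' by (auto simp: y_def is_adjoint_def bounded_op_def)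
  have adj: "hinner H (V x) y = hinner H x (V' y)" if "x \<in> hcarrier H" for x
    using V' y that by (auto simp: is_adjoint_def)
  have "hnorm H (V' y) = hnorm H y"
    using adj[of "V' y"] y by (simp add: hnorm_def VV')
  then have "cmod (hinner H (V x) y) \<le> hnorm H x * hnorm H y"
    using cauchy_schwarz[of x "V' y"] y assms(3) by (simp add: adj)
  then have "hnorm H y * hnorm H y \<le> hnorm H x * hnorm H y"
    using norm_inner_self[OF y(1)] by (simp add: y_def power2_eq_square)
  then show ?thesis
    using assms(3) hnorm_nonneg[of x] hnorm_nonneg[of y] y
    unfolding y_def[symmetric] by (auto simp: mult_le_cancel_right order_le_less)
qed

text \<open>The solution is the fixed point of x \<mapsto> \<open>y + T x\<close>, a strict
  contraction. The iterates from 0 are the partial sums of the Neumann series.\<close>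

lemma resolvent:
  assumes H: "hilbert_space H"
    and T: "\<And>x. x \<in> hcarrier H \<Longrightarrow> T x \<in> hcarrier H"
    and T_diff: "\<And>x y. \<lbrakk>x \<in> hcarrier H; y \<in> hcarrier H\<rbrakk> \<Longrightarrow> T (x - y) = T x - T y"
    and q: "0 \<le> q" "q < 1" and bound: "\<And>x. x \<in> hcarrier H \<Longrightarrow> hnorm H (T x) \<le> q * hnorm H x"
  shows "y \<in> hcarrier H \<Longrightarrow> \<exists>x\<in>hcarrier H. x - T x = y"
    and "inj_on (\<lambda>x. x - T x) (hcarrier H)"
proof -
  interpret hilbert_space H by fact
  show "inj_on (\<lambda>x. x - T x) (hcarrier H)"
  proof (rule inj_onI)
    fix x x' assume x: "x \<in> hcarrier H" "x' \<in> hcarrier H" and eq: "x - T x = x' - T x'"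
    then have "x - x' = T (x - x')"
      by (simp add: T_diff algebra_simps)
    then have "hnorm H (x - x') \<le> q * hnorm H (x - x')"
      using bound[of "x - x'"] x by simp
    then have "(1 - q) * hnorm H (x - x') \<le> 0"
      by (simp add: algebra_simps)
    then have "hnorm H (x - x') = 0"
      using q hnorm_nonneg[of "x - x'"] x by (intro order_antisym) (simp_all add: mult_le_0_iff)
    then show "x = x'"
      using x by (simp add: hnorm_eq_0)
  qed
  assume y: "y \<in> hcarrier H"
  define X where "X = rec_nat 0 (\<lambda>_ x. y + T x)"
  have X_simps: "X 0 = 0" "X (Suc n) = y + T (X n)" for n
    by (simp_all add: X_def)
  have X [simp]: "X n \<in> hcarrier H" for n
    by (induction n) (simp_all add: X_simps T y)
  \<comment> \<open>The sum of the geometric series, that is, the solution of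
    \<open>c = hnorm H y + q * c\<close>, so the bound reproduces itself along the
    iteration.\<close>
  define c where "c = hnorm H y / (1 - q)"
  have c: "0 \<le> c"
    using q y by (simp add: c_def)
  have step0: "hnorm H (X k) \<le> c" for k
  proof (induction k)
    case (Suc k)
    have "hnorm H (X (Suc k)) \<le> hnorm H y + q * hnorm H (X k)"
      using hnorm_triangle[of y "T (X k)"] bound[of "X k"] y by (simp add: X_simps T)
    also have "\<dots> \<le> hnorm H y + q * c"
      using Suc q by (simp add: mult_left_mono)
    also have "\<dots> = c"
      using q by (simp add: c_def field_simps)
    finally show ?case .
  qed (simp add: X_simps c)
  have diff: "hnorm H (X (n + k) - X n) \<le> q ^ n * c" for n k
  proof (induction n)
    case (Suc n)
    have "X (Suc n + k) - X (Suc n) = T (X (n + k) - X n)"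
      by (simp add: X_simps T_diff)
    also have "hnorm H \<dots> \<le> q * hnorm H (X (n + k) - X n)"
      by (rule bound) simp
    also have "\<dots> \<le> q * (q ^ n * c)"
      using Suc q by (simp add: mult_left_mono)
    finally show ?case by (simp add: mult.assoc)
  qed (simp add: X_simps step0)
  have lim0: "(\<lambda>n. q ^ n * c) \<longlonglongrightarrow> 0"
    using LIMSEQ_realpow_zero[OF q] by (rule tendsto_mult_left_zero)
  have "\<exists>N. \<forall>m\<ge>N. \<forall>n\<ge>N. hnorm H (X m - X n) < e" if e: "e > 0" for e
  proof -
    obtain N where N: "q ^ N * c < e / 2"
      using order_tendstoD(2)[OF lim0, of "e / 2"] e by (auto simp: eventually_sequentially)
    have "hnorm H (X m - X n) < e" if "m \<ge> N" "n \<ge> N" for m n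
    proof -
      have "hnorm H (X m - X N) \<le> q ^ N * c" "hnorm H (X n - X N) \<le> q ^ N * c"
        using diff[of N "m - N"] diff[of N "n - N"] that by simp_all
      then show ?thesis
        using hnorm_triangle_diff[of "X m" "X N" "X n"] hnorm_minus_commute[of "X n" "X N"] N by simp
    qed
    then show ?thesis by blast
  qed
  from complete[of X, OF X this]
  obtain x where x: "x \<in> hcarrier H" and lim: "(\<lambda>n. hnorm H (X n - x)) \<longlonglongrightarrow> 0" by auto
  have "hnorm H (x - (y + T x)) \<le> 0"
  proof (rule LIMSEQ_le_const)
    have "(\<lambda>n. hnorm H (X (Suc n) - x) + q * hnorm H (X n - x)) \<longlonglongrightarrow> 0 + q * 0"
      using lim LIMSEQ_Suc[OF lim] by (intro tendsto_intros)
    then show "(\<lambda>n. hnorm H (X (Suc n) - x) + q * hnorm H (X n - x)) \<longlonglongrightarrow> 0" by simp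
    have "hnorm H (x - (y + T x)) \<le> hnorm H (X (Suc n) - x) + q * hnorm H (X n - x)" for n
    proof -
      have "X (Suc n) - (y + T x) = T (X n - x)"
        using x by (simp add: X_simps T_diff)
      then have "hnorm H (X (Suc n) - (y + T x)) \<le> q * hnorm H (X n - x)"
        using bound[of "X n - x"] x by simp
      then show ?thesis
        using hnorm_triangle_diff[of x "X (Suc n)" "y + T x"] hnorm_minus_commute[of x "X (Suc n)"] x y
        by (simp add: T)
    qed
    then show "\<exists>N. \<forall>n\<ge>N. hnorm H (x - (y + T x)) \<le> hnorm H (X (Suc n) - x) + q * hnorm H (X n - x)"
      by blast
  qed
  then have "hnorm H (x - (y + T x)) = 0"
    using hnorm_nonneg[of "x - (y + T x)"] x y by (intro order_antisym) (simp_all add: T)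
  then have "x - (y + T x) = 0"
    using x y by (simp add: hnorm_eq_0 T)
  then show "\<exists>x\<in>hcarrier H. x - T x = y"
    using x by (intro bexI[of _ x]) (auto simp: algebra_simps)
qed

section \<open>Functional completion\<close>

text \<open>Reproduction makes point evaluations continuous, so Cauchy sequences converge pointwise
  and limits can be taken as functions, not as equivalence classes. The set \<open>S\<close> is
  where the functions live; they vanish off it.\<close>

locale functional_completion = semi_inner H
  for H :: "('a \<Rightarrow> complex) hilb" +
  fixes S :: "'a set" and k :: "'a \<Rightarrow> 'a \<Rightarrow> complex"
  assumes carrier_eq: "hcarrier H = CV.span (k ` S)"
    and reproducing: "\<lbrakk>f \<in> hcarrier H; w \<in> S\<rbrakk> \<Longrightarrow> hinner H f (k w) = f w"
    and outside: "\<lbrakk>f \<in> hcarrier H; x \<notin> S\<rbrakk> \<Longrightarrow> f x = 0"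
begin

lemma k_mem [simp]: "w \<in> S \<Longrightarrow> k w \<in> hcarrier H"
  unfolding carrier_eq by (rule CV.span_base) simp

definition cauchy :: "(nat \<Rightarrow> 'a \<Rightarrow> complex) \<Rightarrow> bool"
  where "cauchy F \<longleftrightarrow> (\<forall>n. F n \<in> hcarrier H) \<and>
    (\<forall>e>0. \<exists>N. \<forall>m\<ge>N. \<forall>n\<ge>N. hnorm H (F m - F n) < e)"

definition reps :: "(nat \<Rightarrow> 'a \<Rightarrow> complex) \<Rightarrow> ('a \<Rightarrow> complex) \<Rightarrow> bool"
  where "reps F f \<longleftrightarrow> cauchy F \<and> (\<forall>x. (\<lambda>n. F n x) \<longlonglongrightarrow> f x)"

lemma cauchyD: "cauchy F \<Longrightarrow> F n \<in> hcarrier H"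
  "cauchy F \<Longrightarrow> e > 0 \<Longrightarrow> \<exists>N. \<forall>m\<ge>N. \<forall>n\<ge>N. hnorm H (F m - F n) < e"
  by (auto simp: cauchy_def)

lemma repsD: "reps F f \<Longrightarrow> F n \<in> hcarrier H" "reps F f \<Longrightarrow> cauchy F"
  "reps F f \<Longrightarrow> (\<lambda>n. F n x) \<longlonglongrightarrow> f x"
  by (auto simp: reps_def cauchy_def)

lemma cauchy_bounded:
  assumes "cauchy F"
  obtains B where "0 < B" "\<And>n. hnorm H (F n) \<le> B"
proof -
  obtain N where N: "\<And>n. n \<ge> N \<Longrightarrow> hnorm H (F n - F N) < 1"
    using cauchyD(2)[OF assms, of 1] by auto
  note [simp] = cauchyD(1)[OF assms]
  define B where "B = (\<Sum>i\<le>N. hnorm H (F i)) + 1"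
  have *: "hnorm H (F i) \<le> B - 1" if "i \<le> N" for i
    using that by (auto simp: B_def intro: member_le_sum)
  have "hnorm H (F n) \<le> B" for n
  proof (cases "n \<le> N")
    case False
    then show ?thesis
      using *[of N] N[of n] hnorm_triangle[of "F n - F N" "F N"] by simp
  qed (use *[of n] in simp)
  moreover have "0 < B"
    unfolding B_def by (intro add_nonneg_pos sum_nonneg) auto
  ultimately show ?thesis by (blast intro: that)
qed

lemma cauchy_add:
  assumes F: "cauchy F" and G: "cauchy G"
  shows "cauchy (\<lambda>n. F n + G n)"
  unfolding cauchy_def
proof (intro conjI allI impI)
  note [simp] = cauchyD(1)[OF F] cauchyD(1)[OF G]
  show "F n + G n \<in> hcarrier H" for n by simp
  fix e :: real assume "e > 0"
  then have "e / 2 > 0" by simp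
  from cauchyD(2)[OF F this] cauchyD(2)[OF G this]
  obtain N M where N: "\<And>m n. m \<ge> N \<Longrightarrow> n \<ge> N \<Longrightarrow> hnorm H (F m - F n) < e / 2"
    and M: "\<And>m n. m \<ge> M \<Longrightarrow> n \<ge> M \<Longrightarrow> hnorm H (G m - G n) < e / 2"
    by metis
  have "hnorm H (F m + G m - (F n + G n)) < e" if "m \<ge> max N M" "n \<ge> max N M" for m n
    using N[of m n] M[of m n] that hnorm_triangle[of "F m - F n" "G m - G n"]
    by (simp add: algebra_simps)
  then show "\<exists>N. \<forall>m\<ge>N. \<forall>n\<ge>N. hnorm H (F m + G m - (F n + G n)) < e" by blast
qed

lemma cauchy_scale:
  assumes F: "cauchy F"
  shows "cauchy (\<lambda>n. a *\<^sub>C F n)"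
  unfolding cauchy_def
proof (intro conjI allI impI)
  note [simp] = cauchyD(1)[OF F]
  show "a *\<^sub>C F n \<in> hcarrier H" for n by simp
  fix e :: real assume "e > 0"
  then obtain N where N: "\<And>m n. m \<ge> N \<Longrightarrow> n \<ge> N \<Longrightarrow> hnorm H (F m - F n) < e / (cmod a + 1)"
    using cauchyD(2)[OF F, of "e / (cmod a + 1)"] by (auto simp: add_nonneg_pos)
  have "hnorm H (a *\<^sub>C F m - a *\<^sub>C F n) < e" if "m \<ge> N" "n \<ge> N" for m n
  proof -
    have "hnorm H (a *\<^sub>C F m - a *\<^sub>C F n) = cmod a * hnorm H (F m - F n)"
      by (simp flip: CV.scale_right_diff_distrib)
    also have "\<dots> \<le> (cmod a + 1) * hnorm H (F m - F n)"
      by (intro mult_right_mono) auto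
    also have "\<dots> < e"
      using N[OF that] by (simp add: pos_less_divide_eq add_nonneg_pos mult.commute)
    finally show ?thesis .
  qed
  then show "\<exists>N. \<forall>m\<ge>N. \<forall>n\<ge>N. hnorm H (a *\<^sub>C F m - a *\<^sub>C F n) < e" by blast
qed

lemma cauchy_const: "f \<in> hcarrier H \<Longrightarrow> cauchy (\<lambda>_. f)"
  by (simp add: cauchy_def)

lemma reps_add: "reps F f \<Longrightarrow> reps G g \<Longrightarrow> reps (\<lambda>n. F n + G n) (f + g)"
  by (auto simp: reps_def plus_fun_def intro!: cauchy_add[unfolded plus_fun_def] tendsto_intros)

lemma reps_scale: "reps F f \<Longrightarrow> reps (\<lambda>n. a *\<^sub>C F n) (a *\<^sub>C f)"
  by (auto simp: reps_def intro!: cauchy_scale tendsto_intros)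

lemma reps_const: "f \<in> hcarrier H \<Longrightarrow> reps (\<lambda>_. f) f"
  by (simp add: reps_def cauchy_const)

lemma reps_diff:
  assumes "reps F f" "reps G g"
  shows "reps (\<lambda>n. F n - G n) (f - g)"
  using reps_add[OF assms(1) reps_scale[OF assms(2), of "-1"]] by simp

text \<open>The functional completion exists because a Cauchy sequence that tends to \<open>0\<close> pointwise tends
  to \<open>0\<close> in norm.\<close>

lemma reps_0:
  assumes F: "reps F 0"
  shows "(\<lambda>n. hnorm H (F n)) \<longlonglongrightarrow> 0"
proof (rule LIMSEQ_I)
  fix e :: real assume e: "e > 0"
  note [simp] = repsD(1)[OF F]
  \<comment> \<open>Pointwise convergence is convergence against each \<open>k w\<close>, hence
    against their span. The squared norm of \<open>F n\<close> is then split into the product with a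
    fixed \<open>F N\<close>, small by this, and the product with \<open>F n - F N\<close>, small by
    the Cauchy property.\<close>
  have weak: "(\<lambda>n. hinner H (F n) g) \<longlonglongrightarrow> 0" if "g \<in> hcarrier H" for g
  proof -
    have "g \<in> hcarrier H \<and> (\<lambda>n. hinner H (F n) g) \<longlonglongrightarrow> 0"
      using that unfolding carrier_eq
    proof (rule CV.span_induct)
      show "CV.subspace {g. g \<in> CV.span (k ` S) \<and> (\<lambda>n. hinner H (F n) g) \<longlonglongrightarrow> 0}"
        unfolding carrier_eq[symmetric] CV.subspace_def
        by (auto simp: expand intro: tendsto_add_zero tendsto_mult_right_zero)
      show "g \<in> CV.span (k ` S) \<and> (\<lambda>n. hinner H (F n) g) \<longlonglongrightarrow> 0" if "g \<in> k ` S" for g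
        using that repsD(3)[OF F] by (auto simp: reproducing intro: CV.span_base)
    qed
    then show ?thesis ..
  qed
  obtain B where B: "0 < B" "\<And>n. hnorm H (F n) \<le> B"
    using cauchy_bounded[OF repsD(2)[OF F]] by metis
  obtain N where N: "\<And>n. n \<ge> N \<Longrightarrow> hnorm H (F n - F N) < e\<^sup>2 / (2 * B)"
    using cauchyD(2)[OF repsD(2)[OF F], of "e\<^sup>2 / (2 * B)"] e B by auto
  obtain M where M: "\<And>n. n \<ge> M \<Longrightarrow> cmod (hinner H (F n) (F N)) < e\<^sup>2 / 2"
    using LIMSEQ_D[OF weak[of "F N"], of "e\<^sup>2 / 2"] e by auto
  show "\<exists>no. \<forall>n\<ge>no. norm (hnorm H (F n) - 0) < e"
  proof (intro exI allI impI)
    fix n assume n: "n \<ge> max N M"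
    have "(hnorm H (F n))\<^sup>2 = cmod (hinner H (F n) (F N) + hinner H (F n) (F n - F N))"
      by (simp add: diff_right norm_inner_self)
    also have "\<dots> \<le> cmod (hinner H (F n) (F N)) + hnorm H (F n) * hnorm H (F n - F N)"
      by (rule norm_triangle_mono) (simp_all add: cauchy_schwarz)
    also have "hnorm H (F n) * hnorm H (F n - F N) \<le> B * (e\<^sup>2 / (2 * B))"
      using B N[of n] n by (intro mult_mono) auto
    also have "B * (e\<^sup>2 / (2 * B)) = e\<^sup>2 / 2"
      using B by simp
    finally have "(hnorm H (F n))\<^sup>2 < e\<^sup>2"
      using M[of n] n by simp
    then have "hnorm H (F n) < e"
      by (rule power2_less_imp_less) (use e in simp)
    then show "norm (hnorm H (F n) - 0) < e" by simp
  qed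
qed

text \<open>\<open>SOME\<close> picks one representing sequence per function;
  \<open>inner_completion\<close> shows that every other choice yields the same limit.\<close>

definition completion :: "('a \<Rightarrow> complex) hilb"
  where "completion = \<lparr>hcarrier = {f. \<exists>F. reps F f},
    hinner = (\<lambda>f g. lim (\<lambda>n. hinner H ((SOME F. reps F f) n) ((SOME G. reps G g) n)))\<rparr>"

lemma carrier_completion: "f \<in> hcarrier completion \<longleftrightarrow> (\<exists>F. reps F f)"
  by (simp add: completion_def)

lemma inner_diff_tendsto_0:
  assumes "cauchy F" "cauchy G" "cauchy F'" "cauchy G'"
    and "(\<lambda>n. hnorm H (F n - F' n)) \<longlonglongrightarrow> 0" "(\<lambda>n. hnorm H (G n - G' n)) \<longlonglongrightarrow> 0"
  shows "(\<lambda>n. hinner H (F n) (G n) - hinner H (F' n) (G' n)) \<longlonglongrightarrow> 0"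
proof -
  note [simp] = assms(1-4)[THEN cauchyD(1)]
  obtain B where B: "0 < B" "\<And>n. hnorm H (F' n) \<le> B"
    using cauchy_bounded[OF assms(3)] by metis
  obtain C where C: "0 < C" "\<And>n. hnorm H (G n) \<le> C"
    using cauchy_bounded[OF assms(2)] by metis
  show ?thesis
  proof (rule Lim_null_comparison[where g = "\<lambda>n. hnorm H (F n - F' n) * C + B * hnorm H (G n - G' n)"])
    have "norm (hinner H (F n) (G n) - hinner H (F' n) (G' n))
        \<le> hnorm H (F n - F' n) * C + B * hnorm H (G n - G' n)" for n
    proof -
      have "hinner H (F n) (G n) - hinner H (F' n) (G' n)
          = hinner H (F n - F' n) (G n) + hinner H (F' n) (G n - G' n)"
        by (simp add: expand)
      also have "norm \<dots> \<le> hnorm H (F n - F' n) * hnorm H (G n) + hnorm H (F' n) * hnorm H (G n - G' n)"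
        by (rule norm_triangle_mono) (simp_all add: cauchy_schwarz)
      also have "\<dots> \<le> hnorm H (F n - F' n) * C + B * hnorm H (G n - G' n)"
        using B C by (intro add_mono mult_left_mono mult_right_mono) auto
      finally show ?thesis .
    qed
    then show "\<forall>\<^sub>F n in sequentially. norm (hinner H (F n) (G n) - hinner H (F' n) (G' n))
        \<le> hnorm H (F n - F' n) * C + B * hnorm H (G n - G' n)" by simp
    show "(\<lambda>n. hnorm H (F n - F' n) * C + B * hnorm H (G n - G' n)) \<longlonglongrightarrow> 0"
      using assms(5,6) by (intro tendsto_add_zero tendsto_mult_left_zero tendsto_mult_right_zero)
  qed
qed

lemma inner_convergent:
  assumes "cauchy F" "cauchy G"
  shows "convergent (\<lambda>n. hinner H (F n) (G n))"
proof (rule Cauchy_convergent, rule metric_CauchyI)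
  fix e :: real assume e: "e > 0"
  note [simp] = assms[THEN cauchyD(1)]
  obtain B where B: "0 < B" "\<And>n. hnorm H (F n) \<le> B"
    using cauchy_bounded[OF assms(1)] by metis
  obtain C where C: "0 < C" "\<And>n. hnorm H (G n) \<le> C"
    using cauchy_bounded[OF assms(2)] by metis
  obtain N where N: "\<And>m n. m \<ge> N \<Longrightarrow> n \<ge> N \<Longrightarrow> hnorm H (F m - F n) < e / (2 * C)"
    using cauchyD(2)[OF assms(1), of "e / (2 * C)"] e C by auto
  obtain M where M: "\<And>m n. m \<ge> M \<Longrightarrow> n \<ge> M \<Longrightarrow> hnorm H (G m - G n) < e / (2 * B)"
    using cauchyD(2)[OF assms(2), of "e / (2 * B)"] e B by auto
  have "dist (hinner H (F m) (G m)) (hinner H (F n) (G n)) < e" if "m \<ge> max N M" "n \<ge> max N M" for m n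
  proof -
    have "hinner H (F m) (G m) - hinner H (F n) (G n)
        = hinner H (F m - F n) (G m) + hinner H (F n) (G m - G n)"
      by (simp add: expand)
    also have "norm \<dots> \<le> hnorm H (F m - F n) * hnorm H (G m) + hnorm H (F n) * hnorm H (G m - G n)"
      by (rule norm_triangle_mono) (simp_all add: cauchy_schwarz)
    also have "\<dots> \<le> hnorm H (F m - F n) * C + B * hnorm H (G m - G n)"
      using B C by (intro add_mono mult_left_mono mult_right_mono) auto
    also have "\<dots> < (e / (2 * C)) * C + B * (e / (2 * B))"
      using B C N[of m n] M[of m n] that
      by (intro add_strict_mono mult_strict_left_mono mult_strict_right_mono) auto
    also have "\<dots> = e"
      using B C by simp
    finally show ?thesis by (simp add: dist_norm)
  qed
  then show "\<exists>N. \<forall>m\<ge>N. \<forall>n\<ge>N. dist (hinner H (F m) (G m)) (hinner H (F n) (G n)) < e" by blast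
qed

text \<open>Two sequences representing the same function differ by one representing 0, which is null
  in norm by \<open>reps_0\<close>; bounded factors make the inner products agree in the
  limit.\<close>

lemma inner_completion:
  assumes F: "reps F f" and G: "reps G g"
  shows "(\<lambda>n. hinner H (F n) (G n)) \<longlonglongrightarrow> hinner completion f g"
proof -
  define F' where "F' = (SOME F. reps F f)"
  define G' where "G' = (SOME G. reps G g)"
  have F': "reps F' f"
    unfolding F'_def by (rule someI[of "\<lambda>F. reps F f", OF F])
  have G': "reps G' g"
    unfolding G'_def by (rule someI[of "\<lambda>G. reps G g", OF G])
  have lim': "(\<lambda>n. hinner H (F' n) (G' n)) \<longlonglongrightarrow> hinner completion f g"
    unfolding completion_def F'_def[symmetric] G'_def[symmetric]
    using inner_convergent[OF F'[THEN repsD(2)] G'[THEN repsD(2)]]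
    by (simp add: F'_def G'_def convergent_LIMSEQ_iff)
  have "(\<lambda>n. hinner H (F n) (G n) - hinner H (F' n) (G' n)) \<longlonglongrightarrow> 0"
    using reps_0[of "\<lambda>n. F n - F' n"] reps_0[of "\<lambda>n. G n - G' n"] reps_diff[OF F F'] reps_diff[OF G G']
      F G F' G'
    by (intro inner_diff_tendsto_0) (auto dest: repsD(2))
  from tendsto_add[OF this lim'] show ?thesis by simp
qed

lemma inner_completion_mem:
  "f \<in> hcarrier H \<Longrightarrow> g \<in> hcarrier H \<Longrightarrow> hinner completion f g = hinner H f g"
  using inner_completion[OF reps_const reps_const, of f g] by (simp add: LIMSEQ_const_iff)

lemma mem_completion: "f \<in> hcarrier H \<Longrightarrow> f \<in> hcarrier completion"
  using reps_const carrier_completion by blast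

lemma hnorm_completion:
  assumes F: "reps F f"
  shows "(\<lambda>n. hnorm H (F n)) \<longlonglongrightarrow> hnorm completion f"
  unfolding hnorm_def by (intro tendsto_intros inner_completion F)

lemma semi_inner_completion: "semi_inner completion"
proof
  show "CV.subspace (hcarrier completion)"
  proof (rule CV.subspaceI)
    show "0 \<in> hcarrier completion"
      unfolding carrier_completion by (rule exI, rule reps_const, rule zero_mem)
    show "f + g \<in> hcarrier completion" if "f \<in> hcarrier completion" "g \<in> hcarrier completion" for f g
      using that unfolding carrier_completion by (elim exE) (rule exI, rule reps_add)
    show "a *\<^sub>C f \<in> hcarrier completion" if "f \<in> hcarrier completion" for a f
      using that unfolding carrier_completion by (elim exE) (rule exI, rule reps_scale)
  qed
next
  fix f g h assume "f \<in> hcarrier completion" "g \<in> hcarrier completion" "h \<in> hcarrier completion"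
  then obtain F G Q where *: "reps F f" "reps G g" "reps Q h"
    by (auto simp: carrier_completion)
  have "(\<lambda>n. hinner H (F n) (Q n) + hinner H (G n) (Q n)) \<longlonglongrightarrow> hinner completion (f + g) h"
    using inner_completion[OF reps_add[OF *(1,2)] *(3)] * by (simp add: add_left repsD(1))
  moreover have "(\<lambda>n. hinner H (F n) (Q n) + hinner H (G n) (Q n))
      \<longlonglongrightarrow> hinner completion f h + hinner completion g h"
    using * by (intro tendsto_intros inner_completion)
  ultimately show "hinner completion (f + g) h = hinner completion f h + hinner completion g h"
    by (rule LIMSEQ_unique)
next
  fix f g a assume "f \<in> hcarrier completion" "g \<in> hcarrier completion"
  then obtain F G where *: "reps F f" "reps G g"
    by (auto simp: carrier_completion)
  have "(\<lambda>n. a * hinner H (F n) (G n)) \<longlonglongrightarrow> hinner completion (a *\<^sub>C f) g"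
    using inner_completion[OF reps_scale[OF *(1)] *(2)] * by (simp add: scale_left repsD(1))
  moreover have "(\<lambda>n. a * hinner H (F n) (G n)) \<longlonglongrightarrow> a * hinner completion f g"
    using * by (intro tendsto_intros inner_completion)
  ultimately show "hinner completion (a *\<^sub>C f) g = a * hinner completion f g"
    by (rule LIMSEQ_unique)
  have "(\<lambda>n. hinner H (G n) (F n)) \<longlonglongrightarrow> cnj (hinner completion f g)"
    using tendsto_cnj[OF inner_completion[OF *]] * by (simp add: commute[symmetric] repsD(1))
  then show "hinner completion g f = cnj (hinner completion f g)"
    using inner_completion[OF *(2,1)] by (rule LIMSEQ_unique[rotated])
next
  fix f assume "f \<in> hcarrier completion"
  then obtain F where *: "reps F f"
    by (auto simp: carrier_completion)
  show "hinner completion f f \<in> \<real>\<^sub>\<ge>\<^sub>0"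
    by (rule closed_sequentially[OF closed_nonneg_Reals_complex _ inner_completion[OF * *]])
      (simp add: nonneg repsD(1)[OF *])
qed

text \<open>Definiteness holds because the norm controls every point value. For completeness,
  \<open>X n\<close> is replaced by an element \<open>p n\<close> of the span within
  \<open>1 / Suc n\<close>; the pointwise limit of the Cauchy sequence \<open>p\<close> is the limit
  of \<open>X\<close>.\<close>

lemma hilbert_completion: "hilbert_space completion"
proof -
  interpret C: semi_inner completion
    by (rule semi_inner_completion)
  show ?thesis
  proof
    fix f assume f: "f \<in> hcarrier completion" and 0: "hinner completion f f = 0"
    then obtain F where F: "reps F f"
      by (auto simp: carrier_completion)
    note [simp] = repsD(1)[OF F]
    have n0: "(\<lambda>n. hnorm H (F n)) \<longlonglongrightarrow> 0"
      using hnorm_completion[OF F] by (simp add: hnorm_def 0)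
    have "f x = 0" for x
    proof (cases "x \<in> S")
      case True
      have "(\<lambda>n. F n x) \<longlonglongrightarrow> 0"
      proof (rule Lim_null_comparison)
        show "\<forall>\<^sub>F n in sequentially. norm (F n x) \<le> hnorm H (F n) * hnorm H (k x)"
          using cauchy_schwarz[of "F _" "k x"] True by (simp add: reproducing)
        show "(\<lambda>n. hnorm H (F n) * hnorm H (k x)) \<longlonglongrightarrow> 0"
          using n0 by (rule tendsto_mult_left_zero)
      qed
      with repsD(3)[OF F, of x] show ?thesis by (rule LIMSEQ_unique)
    next
      case False
      then show ?thesis
        using repsD(3)[OF F, of x] by (simp add: outside LIMSEQ_const_iff)
    qed
    then show "f = 0" by (simp add: fun_eq_iff)
  next
    fix X :: "nat \<Rightarrow> 'a \<Rightarrow> complex"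
    assume X [simp]: "\<And>n. X n \<in> hcarrier completion"
      and C: "\<And>e. e > 0 \<Longrightarrow> \<exists>N. \<forall>m\<ge>N. \<forall>n\<ge>N. hnorm completion (X m - X n) < e"
    have const: "hnorm completion f = hnorm H f" if "f \<in> hcarrier H" for f
      using that by (simp add: hnorm_def inner_completion_mem)
    \<comment> \<open>The norm of \<open>F m - f\<close> is the limit over n of the norms of
      \<open>F m - F n\<close>, which the Cauchy property bounds uniformly.\<close>
    have approx: "(\<lambda>m. hnorm completion (F m - f)) \<longlonglongrightarrow> 0" if F: "reps F f" for F f
    proof (rule LIMSEQ_I)
      fix e :: real assume "e > 0"
      then obtain N where N: "\<And>m n. m \<ge> N \<Longrightarrow> n \<ge> N \<Longrightarrow> hnorm H (F m - F n) < e / 2"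
        using cauchyD(2)[OF repsD(2)[OF F], of "e / 2"] by auto
      have "hnorm completion (F m - f) \<le> e / 2" if "m \<ge> N" for m
      proof (rule LIMSEQ_le_const2)
        show "(\<lambda>n. hnorm H (F m - F n)) \<longlonglongrightarrow> hnorm completion (F m - f)"
          by (intro hnorm_completion reps_diff reps_const F repsD(1)[OF F])
        show "\<exists>M. \<forall>n\<ge>M. hnorm H (F m - F n) \<le> e / 2"
          using N[OF that] by (auto intro: less_imp_le)
      qed
      moreover have "F m - f \<in> hcarrier completion" for m
        using C.diff_mem[OF mem_completion[OF repsD(1)[OF F]], of f] F carrier_completion by blast
      ultimately show "\<exists>N. \<forall>m\<ge>N. norm (hnorm completion (F m - f) - 0) < e"
        using \<open>e > 0\<close> by (intro exI[of _ N]) (fastforce intro: le_less_trans[of _ "e / 2" e])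
    qed
    have "\<exists>p\<in>hcarrier H. hnorm completion (p - X n) < 1 / real (Suc n)" for n
    proof -
      obtain F where F: "reps F (X n)"
        using X carrier_completion by blast
      then have "\<exists>m. hnorm completion (F m - X n) < 1 / real (Suc n)"
        using order_tendstoD(2)[OF approx[OF F], of "1 / real (Suc n)"]
        by (auto simp: eventually_sequentially)
      then show ?thesis using repsD(1)[OF F] by blast
    qed
    then obtain p where p [simp]: "\<And>n. p n \<in> hcarrier H"
      and close: "\<And>n. hnorm completion (p n - X n) < 1 / real (Suc n)" by metis
    have pC [simp]: "p n \<in> hcarrier completion" for n
      by (simp add: mem_completion)
    have "cauchy p"
      unfolding cauchy_def
    proof (intro conjI allI impI)
      fix e :: real assume e: "e > 0"
      obtain N where N: "\<And>m n. m \<ge> N \<Longrightarrow> n \<ge> N \<Longrightarrow> hnorm completion (X m - X n) < e / 3"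
        using C[of "e / 3"] e by auto
      obtain M where M: "inverse (real (Suc M)) < e / 3"
        using reals_Archimedean[of "e / 3"] e by auto
      have small: "hnorm completion (p n - X n) < e / 3" if "n \<ge> M" for n
      proof -
        have "1 / real (Suc n) \<le> inverse (real (Suc M))"
          using that by (simp add: field_simps)
        with M close[of n] show ?thesis by linarith
      qed
      have "hnorm H (p m - p n) < e" if "m \<ge> max N M" "n \<ge> max N M" for m n
      proof -
        have "hnorm completion (p m - p n)
            \<le> hnorm completion (p m - X m) + hnorm completion (X m - X n) + hnorm completion (X n - p n)"
          using C.hnorm_triangle_diff[of "p m" "X m" "p n"] C.hnorm_triangle_diff[of "X m" "X n" "p n"]
          by simp
        also have "\<dots> < e"
          using small[of m] small[of n] N[of m n] that C.hnorm_minus_commute[of "X n" "p n"] by simp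
        finally show ?thesis by (simp add: const)
      qed
      then show "\<exists>N. \<forall>m\<ge>N. \<forall>n\<ge>N. hnorm H (p m - p n) < e" by blast
    qed simp
    have "convergent (\<lambda>n. p n x)" for x
    proof (cases "x \<in> S")
      case True
      then show ?thesis
        using inner_convergent[OF \<open>cauchy p\<close> cauchy_const[of "k x"]] by (simp add: reproducing)
    qed (simp add: outside convergent_const)
    then have P: "reps p (\<lambda>x. lim (\<lambda>n. p n x))"
      using \<open>cauchy p\<close> by (simp add: reps_def convergent_LIMSEQ_iff)
    define f where "f = (\<lambda>x. lim (\<lambda>n. p n x))"
    have f: "f \<in> hcarrier completion"
      using P f_def carrier_completion by blast
    have "(\<lambda>n. hnorm completion (X n - f)) \<longlonglongrightarrow> 0"
    proof (rule Lim_null_comparison)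
      have "hnorm completion (X n - f) \<le> 1 / real (Suc n) + hnorm completion (p n - f)" for n
        using C.hnorm_triangle_diff[of "X n" "p n" f] C.hnorm_minus_commute[of "X n" "p n"] close[of n] f
        by simp
      then show "\<forall>\<^sub>F n in sequentially. norm (hnorm completion (X n - f))
          \<le> 1 / real (Suc n) + hnorm completion (p n - f)"
        using f by simp
      show "(\<lambda>n. 1 / real (Suc n) + hnorm completion (p n - f)) \<longlonglongrightarrow> 0"
        using LIMSEQ_inverse_real_of_nat approx[OF P] unfolding f_def
        by (intro tendsto_add_zero) (simp_all add: inverse_eq_divide)
    qed
    with f show "\<exists>x\<in>hcarrier completion. (\<lambda>n. hnorm completion (X n - x)) \<longlonglongrightarrow> 0" by blast
  qed (fact C.subspace_carrier C.add_left C.scale_left C.commute C.nonneg)+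
qed

lemma completion_reproducing:
  assumes "f \<in> hcarrier completion" "w \<in> S"
  shows "hinner completion f (k w) = f w"
proof -
  obtain F where F: "reps F f"
    using assms by (auto simp: carrier_completion)
  have "(\<lambda>n. F n w) \<longlonglongrightarrow> hinner completion f (k w)"
    using inner_completion[OF F reps_const[of "k w"]] assms(2) by (simp add: reproducing repsD(1)[OF F])
  then show ?thesis
    using repsD(3)[OF F] by (rule LIMSEQ_unique)
qed

lemma completion_outside:
  assumes "f \<in> hcarrier completion" "x \<notin> S"
  shows "f x = 0"
proof -
  obtain F where F: "reps F f"
    using assms by (auto simp: carrier_completion)
  then show ?thesis
    using repsD(3)[OF F, of x] repsD(1)[OF F] assms(2) by (simp add: outside LIMSEQ_const_iff)
qed

end

section \<open>Reproducing kernel Hilbert spaces\<close>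

lemma sum_fun_apply: "sum F A x = (\<Sum>i\<in>A. F i x)" for F :: "'i \<Rightarrow> 'a \<Rightarrow> 'b::comm_monoid_add"
  by (induction A rule: infinite_finite_induct) auto

text \<open>Complex coefficients make symmetry a consequence of positivity: coefficients 1, 1 at two
  points compare the imaginary parts, coefficients 1, \<i> the real parts.\<close>

lemma kernel_hermitian:
  assumes K: "\<And>A c. \<lbrakk>finite A; A \<subseteq> S\<rbrakk> \<Longrightarrow> (\<Sum>z\<in>A. \<Sum>w\<in>A. K z w * c w * cnj (c z)) \<in> \<real>\<^sub>\<ge>\<^sub>0"
    and z: "z \<in> S" and w: "w \<in> S"
  shows "K w z = cnj (K z w)"
proof -
  have real: "Im (K z z) = 0" if "z \<in> S" for z
    using K[of "{z}" "\<lambda>_. 1"] that by (simp add: complex_nonneg_Reals_iff)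
  show ?thesis
  proof (cases "z = w")
    case True
    then show ?thesis
      using real[OF z] by (simp add: complex_eq_iff)
  next
    case False
    have "K z z + K z w + (K w z + K w w) \<in> \<real>\<^sub>\<ge>\<^sub>0"
      using K[of "{z, w}" "\<lambda>_. 1"] z w False by simp
    moreover have "K z z + K z w * \<i> + (- (K w z * \<i>) - K w w * \<i> * \<i>) \<in> \<real>\<^sub>\<ge>\<^sub>0"
      using K[of "{z, w}" "\<lambda>x. if x = w then \<i> else 1"] z w False by simp
    ultimately show ?thesis
      using real[OF z] real[OF w] by (simp add: complex_eq_iff complex_nonneg_Reals_iff)
  qed
qed

text \<open>The inner product of a combination of kernel functions \<open>k w\<close> with g should
  be the same combination of the values \<open>cnj (g w)\<close>. The proof shows that this does not
  depend on the combination, and then completes.\<close>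

lemma moore_aronszajn:
  fixes K :: "'a \<Rightarrow> 'a \<Rightarrow> complex"
  assumes K: "\<And>A c. \<lbrakk>finite A; A \<subseteq> S\<rbrakk> \<Longrightarrow> (\<Sum>z\<in>A. \<Sum>w\<in>A. K z w * c w * cnj (c z)) \<in> \<real>\<^sub>\<ge>\<^sub>0"
  defines "k \<equiv> \<lambda>w z. if z \<in> S then K z w else 0"
  obtains H where "hilbert_space H" "\<And>w. w \<in> S \<Longrightarrow> k w \<in> hcarrier H"
    "\<And>f w. \<lbrakk>f \<in> hcarrier H; w \<in> S\<rbrakk> \<Longrightarrow> hinner H f (k w) = f w"
    "\<And>f z. \<lbrakk>f \<in> hcarrier H; z \<notin> S\<rbrakk> \<Longrightarrow> f z = 0"
proof -
  note herm = kernel_hermitian[of S K, OF K]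
  \<comment> \<open>Each kernel function is paired with the functional it should induce. The span
    \<open>G\<close> is a linear relation between functions and functionals, since a function may
    have several expansions in kernel functions.\<close>
  define E where "E = (\<lambda>w. (k w, \<lambda>f::'a \<Rightarrow> complex. cnj (f w)))"
  define G where "G = CV.span (E ` S)"
  have G: "CV.subspace G"
    by (simp add: G_def)
  have G_add: "(f + g, \<mu> + \<nu>) \<in> G" if "(f, \<mu>) \<in> G" "(g, \<nu>) \<in> G" for f g \<mu> \<nu>
    using CV.subspace_add[OF G that] by simp
  have G_scale: "(a *\<^sub>C f, a *\<^sub>C \<mu>) \<in> G" if "(f, \<mu>) \<in> G" for a f \<mu>
    using CV.subspace_scale[OF G that] by simp
  have E_G: "(k w, \<lambda>f. cnj (f w)) \<in> G" if "w \<in> S" for w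
    unfolding G_def using that by (intro CV.span_base) (auto simp: E_def)
  have antilinear: "(\<forall>f g. snd p (f + g) = snd p f + snd p g) \<and>
      (\<forall>a f. snd p (a *\<^sub>C f) = cnj a * snd p f)" if "p \<in> G" for p
    using that unfolding G_def
    by (rule CV.span_induct)
      (auto simp: CV.subspace_def E_def  algebra_simps)
  have G_k: "snd p (k w) = fst p w" if "p \<in> G" "w \<in> S" for p w
    using that(1) unfolding G_def
    by (rule CV.span_induct)
      (use that(2) in \<open>auto simp: CV.subspace_def E_def  k_def
        intro: herm[symmetric]\<close>)
  \<comment> \<open>On the span of the kernel functions a functional in \<open>G\<close> is thereby
    determined by its partner, so the choice made in \<open>H0\<close> does not affect the inner
    product there.\<close>
  have swap: "snd q (fst p) = cnj (snd p (fst q))" if p: "p \<in> G" and q: "q \<in> G" for p q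
    using q unfolding G_def
  proof (rule CV.span_induct)
    show "CV.subspace {q. snd q (fst p) = cnj (snd p (fst q))}"
      using antilinear[OF p] antilinear[OF p, THEN conjunct1, rule_format, of 0 0]
      by (auto simp: CV.subspace_def)
  qed (use G_k[OF p] in \<open>auto simp: E_def\<close>)
  have pos: "snd p (fst p) \<in> \<real>\<^sub>\<ge>\<^sub>0" if pG: "p \<in> G" for p
  proof -
    obtain t r where t: "finite t" "t \<subseteq> E ` S" and p: "p = (\<Sum>a\<in>t. r a *\<^sub>C a)"
      using pG unfolding G_def CV.span_explicit by auto
    \<comment> \<open>Different points can give the same pair, so one point is kept per pair; the
      sum over \<open>t\<close> becomes a sum over points, to which positivity of \<open>K\<close>
      applies.\<close>
    obtain A where A: "A \<subseteq> S" "finite A" "inj_on E A" "t = E ` A"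
      using t by (metis subset_image_inj finite_imageD)
    define c where "c w = r (E w)" for w
    have p: "p = (\<Sum>w\<in>A. c w *\<^sub>C E w)"
      unfolding p A(4) c_def by (simp add: sum.reindex[OF A(3)])
    have "fst p z = (\<Sum>w\<in>A. K z w * c w)" if "z \<in> A" for z
      using that A(1)
      by (auto simp: p fst_sum sum_fun_apply  E_def k_def intro!: sum.cong)
    moreover have "snd p f = (\<Sum>z\<in>A. c z * cnj (f z))" for f
      by (simp add: p snd_sum sum_fun_apply  E_def)
    ultimately have "snd p (fst p) = (\<Sum>z\<in>A. c z * cnj (\<Sum>w\<in>A. K z w * c w))"
      by (auto intro: sum.cong)
    also have "\<dots> = cnj (\<Sum>z\<in>A. \<Sum>w\<in>A. K z w * c w * cnj (c z))"
      by (simp add: sum_distrib_left mult_ac)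
    also have "\<dots> \<in> \<real>\<^sub>\<ge>\<^sub>0"
      using K[OF A(2,1), of c] by (simp only: complex_nonneg_Reals_iff cnj.simps) simp
    finally show ?thesis .
  qed
  define H0 where "H0 = \<lparr>hcarrier = CV.span (k ` S), hinner = (\<lambda>f g. (SOME \<mu>. (f, \<mu>) \<in> G) g)\<rparr>"
  have ex: "\<exists>\<mu>. (f, \<mu>) \<in> G" if "f \<in> CV.span (k ` S)" for f
    using that
  proof (rule CV.span_induct)
    show "CV.subspace {f. \<exists>\<mu>. (f, \<mu>) \<in> G}"
      using CV.subspace_0[OF G] by (intro CV.subspaceI) (auto simp: zero_prod_def intro: G_add G_scale)
  qed (auto intro: E_G)
  have inner0: "hinner H0 f g = \<mu> g" if f: "(f, \<mu>) \<in> G" and g: "g \<in> CV.span (k ` S)" for f g \<mu>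
  proof -
    define \<nu> where "\<nu> = (SOME \<mu>. (f, \<mu>) \<in> G)"
    have \<nu>: "(f, \<nu>) \<in> G"
      unfolding \<nu>_def by (rule someI[of "\<lambda>\<mu>. (f, \<mu>) \<in> G", OF f])
    obtain \<rho> where "(g, \<rho>) \<in> G"
      using ex[OF g] by blast
    then have "\<nu> g = \<mu> g"
      using swap[of "(g, \<rho>)" "(f, \<nu>)"] swap[of "(g, \<rho>)" "(f, \<mu>)"] \<nu> f by simp
    then show ?thesis
      by (simp add: H0_def \<nu>_def)
  qed
  have c0: "hcarrier H0 = CV.span (k ` S)"
    by (simp add: H0_def)
  interpret S0: semi_inner H0
  proof
    show "CV.subspace (hcarrier H0)"
      by (simp add: c0)
  next
    fix f g h assume "f \<in> hcarrier H0" "g \<in> hcarrier H0" and h: "h \<in> hcarrier H0"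
    then obtain \<mu> \<nu> where \<mu>: "(f, \<mu>) \<in> G" and \<nu>: "(g, \<nu>) \<in> G"
      using ex c0 by metis
    show "hinner H0 (f + g) h = hinner H0 f h + hinner H0 g h"
      using h by (simp add: c0 inner0[OF \<mu>] inner0[OF \<nu>] inner0[OF G_add[OF \<mu> \<nu>]])
  next
    fix f g a assume f: "f \<in> hcarrier H0" and g: "g \<in> hcarrier H0"
    then obtain \<mu> \<nu> where \<mu>: "(f, \<mu>) \<in> G" and \<nu>: "(g, \<nu>) \<in> G"
      using ex c0 by metis
    show "hinner H0 (a *\<^sub>C f) g = a * hinner H0 f g"
      using g by (simp add: c0 inner0[OF \<mu>] inner0[OF G_scale[OF \<mu>]])
    show "hinner H0 g f = cnj (hinner H0 f g)"
      using f g swap[OF \<mu> \<nu>] by (simp add: c0 inner0[OF \<mu>] inner0[OF \<nu>])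
    show "hinner H0 f f \<in> \<real>\<^sub>\<ge>\<^sub>0"
      using f pos[OF \<mu>] by (simp add: c0 inner0[OF \<mu>])
  qed
  interpret F: functional_completion H0 S k
  proof
    fix f w assume f: "f \<in> hcarrier H0" and w: "w \<in> S"
    then obtain \<mu> where \<mu>: "(f, \<mu>) \<in> G"
      using ex c0 by metis
    have "k w \<in> CV.span (k ` S)"
      using w by (intro CV.span_base) auto
    then show "hinner H0 f (k w) = f w"
      using G_k[OF \<mu> w] by (simp add: inner0[OF \<mu>])
  next
    fix f x assume "f \<in> hcarrier H0" and x: "x \<notin> S"
    then have "f \<in> CV.span (k ` S)" by (simp add: c0)
    then show "f x = 0"
      by (rule CV.span_induct)
        (use x in \<open>auto simp: CV.subspace_def  k_def\<close>)
  qed (fact c0)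
  show ?thesis
    by (rule that[of F.completion])
      (fact F.hilbert_completion F.mem_completion[OF F.k_mem] F.completion_reproducing
        F.completion_outside)+
qed

section \<open>Reproducing kernel Hilbert spaces on the bidisc\<close>

text \<open>Positivity is defined for numbered points; the construction above needs it for finite
  sets, with coefficients attached to the points.\<close>

lemma is_kernel_finite:
  assumes K: "is_kernel K" and A: "finite A" "A \<subseteq> bidisc"
  shows "(\<Sum>z\<in>A. \<Sum>w\<in>A. K z w * c w * cnj (c z)) \<in> \<real>\<^sub>\<ge>\<^sub>0"
proof -
  obtain e where e: "bij_betw e {..<card A} A"
    using ex_bij_betw_nat_finite[OF A(1)] by (auto simp: atLeast0LessThan)
  have "e \<in> {..<card A} \<rightarrow> bidisc"
    using A(2) e by (auto simp: bij_betw_def)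
  then have "(\<Sum>i<card A. \<Sum>j<card A. K (e i) (e j) * c (e j) * cnj (c (e i))) \<in> \<real>\<^sub>\<ge>\<^sub>0"
    by (rule K[unfolded is_kernel_def, rule_format])
  also have "(\<Sum>i<card A. \<Sum>j<card A. K (e i) (e j) * c (e j) * cnj (c (e i)))
      = (\<Sum>i<card A. \<Sum>w\<in>A. K (e i) w * c w * cnj (c (e i)))"
    by (intro sum.cong refl sum.reindex_bij_betw[OF e])
  also have "\<dots> = (\<Sum>z\<in>A. \<Sum>w\<in>A. K z w * c w * cnj (c z))"
    by (rule sum.reindex_bij_betw[OF e])
  finally show ?thesis .
qed

lemma is_kernel_hermitian:
  "\<lbrakk>is_kernel K; z \<in> bidisc; w \<in> bidisc\<rbrakk> \<Longrightarrow> K w z = cnj (K z w)"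
  using kernel_hermitian[of bidisc K] is_kernel_finite by blast

lemma ex_rkhs:
  assumes K: "is_kernel K"
  obtains H where "is_rkhs K H"
proof (rule moore_aronszajn[of bidisc K, OF is_kernel_finite[OF K]])
  fix H
  assume "hilbert_space H"
    "\<And>w. w \<in> bidisc \<Longrightarrow> (\<lambda>z. if z \<in> bidisc then K z w else 0) \<in> hcarrier H"
    "\<And>f w. \<lbrakk>f \<in> hcarrier H; w \<in> bidisc\<rbrakk> \<Longrightarrow> hinner H f (\<lambda>z. if z \<in> bidisc then K z w else 0) = f w"
    "\<And>f z. \<lbrakk>f \<in> hcarrier H; z \<notin> bidisc\<rbrakk> \<Longrightarrow> f z = 0"
  then have "is_rkhs K H"
    unfolding is_rkhs_def kernel_section_def by (intro conjI ballI allI impI)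
  then show ?thesis by (rule that)
qed

section \<open>Positivity of the Pick kernel\<close>

text \<open>Reproducing property of the Szego kernel. On the unit circle
  \<open>cnj e = 1 / e\<close>, so the conjugated kernel is \<open>e / (e - w)\<close>; the factor
  \<open>e\<close> is absorbed by the derivative of the path, which leaves the Cauchy
  integral.\<close>

lemma cauchy_circle_mean:
  assumes h: "h holomorphic_on cball 0 1" and w: "w \<in> disc"
  shows "((\<lambda>t. h (circlepath 0 1 t) * cnj (1 / (1 - cnj w * circlepath 0 1 t))) has_integral h w) {0..1}"
proof -
  have "((\<lambda>u. h u / (u - w)) has_contour_integral 2 * of_real pi * \<i> * h w) (circlepath 0 1)"
    using w by (intro Cauchy_integral_circlepath holomorphic_on_imp_continuous_on h
        holomorphic_on_subset[OF h ball_subset_cball]) simp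
  then have "((\<lambda>t. 1 / (2 * of_real pi * \<i>) * (h (circlepath 0 1 t) / (circlepath 0 1 t - w) *
      vector_derivative (circlepath 0 1) (at t within {0..1})))
      has_integral 1 / (2 * of_real pi * \<i>) * (2 * of_real pi * \<i> * h w)) {0..1}"
    unfolding has_contour_integral_def by (rule has_integral_mult_right)
  then have "((\<lambda>t. 1 / (2 * of_real pi * \<i>) * (h (circlepath 0 1 t) / (circlepath 0 1 t - w) *
      vector_derivative (circlepath 0 1) (at t within {0..1})))
      has_integral h w) {0..1}"
    by simp
  then show ?thesis
  proof (rule has_integral_eq[rotated])
    fix t :: real assume t: "t \<in> {0..1}"
    define e where "e = circlepath 0 1 t"
    have norm_e: "cmod e = 1"
      by (simp add: e_def circlepath)
    have ee: "e * cnj e = 1"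
      using complex_norm_square[of e] norm_e by simp
    have "e \<noteq> w" "e \<noteq> 0"
      using w norm_e by auto
    have "cnj (1 - cnj w * e) = (e - w) / e"
      using ee \<open>e \<noteq> 0\<close> by (simp add: field_simps)
    then have eq: "cnj (1 / (1 - cnj w * e)) = e / (e - w)"
      by simp
    have "vector_derivative (circlepath 0 1) (at t within {0..1}) = 2 * of_real pi * \<i> * e"
      using t vector_derivative_circlepath01[of t 0 1] by (simp add: e_def circlepath)
    then show "1 / (2 * of_real pi * \<i>) * (h (circlepath 0 1 t) / (circlepath 0 1 t - w) *
      vector_derivative (circlepath 0 1) (at t within {0..1}))
      = h (circlepath 0 1 t) * cnj (1 / (1 - cnj w * circlepath 0 1 t))"
      unfolding e_def[symmetric] eq using \<open>e \<noteq> w\<close> by (simp add: field_simps)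
  qed
qed

lemma has_integral_nonneg_complex:
  fixes u :: "real \<Rightarrow> complex"
  assumes u: "(u has_integral I) A" and nn: "\<And>t. t \<in> A \<Longrightarrow> u t \<in> \<real>\<^sub>\<ge>\<^sub>0"
  shows "I \<in> \<real>\<^sub>\<ge>\<^sub>0"
proof -
  have "((Re \<circ> u) has_integral Re I) A" "((Im \<circ> u) has_integral Im I) A"
    using has_integral_linear[OF u bounded_linear_Re] has_integral_linear[OF u bounded_linear_Im] .
  moreover have "0 \<le> (Re \<circ> u) t" "(Im \<circ> u) t = 0" if "t \<in> A" for t
    using nn[OF that] by (simp_all add: complex_nonneg_Reals_iff)
  ultimately show ?thesis
    unfolding complex_nonneg_Reals_iff
    by (metis has_integral_is_0 has_integral_nonneg has_integral_unique)
qed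

text \<open>The reproducing kernel of the de Branges--Rovnyak space of a Schur function.\<close>

definition pick :: "(complex \<Rightarrow> complex) \<Rightarrow> complex \<Rightarrow> complex \<Rightarrow> complex"
  where "pick \<phi> z w = (1 - \<phi> z * cnj (\<phi> w)) / (1 - z * cnj w)"

lemma one_minus_cnj_neq_0:
  assumes "z \<in> disc" "w \<in> disc"
  shows "1 - z * cnj w \<noteq> 0"
proof
  assume "1 - z * cnj w = 0"
  then have "cmod (z * cnj w) = 1" by simp
  moreover have "cmod (z * cnj w) < 1"
    using assms mult_strict_mono'[of "cmod z" 1 "cmod w" 1] by (simp add: norm_mult)
  ultimately show False by simp
qed

text \<open>With \<open>f\<close> and \<open>g\<close> the combinations of Szego kernels with coefficients \<open>c i\<close> and
  \<open>c i * cnj (F (z i))\<close>, the sum is \<open>\<parallel>f\<parallel>\<^sup>2 - 2 Re \<langle>F g, f\<rangle> + \<parallel>g\<parallel>\<^sup>2 \<ge> \<parallel>f - F g\<parallel>\<^sup>2\<close> on the unit circle.\<close>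

lemma pick_nonneg_closed_disc:
  assumes F: "F holomorphic_on cball 0 1" and bound: "\<And>z. cmod z = 1 \<Longrightarrow> cmod (F z) \<le> 1"
    and z: "\<And>i::nat. i < m \<Longrightarrow> z i \<in> disc"
  shows "(\<Sum>i<m. \<Sum>j<m. pick F (z i) (z j) * c j * cnj (c i)) \<in> \<real>\<^sub>\<ge>\<^sub>0"
proof -
  define k where "k i e = 1 / (1 - cnj (z i) * e)" for i e
  define f where "f e = (\<Sum>j<m. c j * k j e)" for e
  define g where "g e = (\<Sum>j<m. c j * cnj (F (z j)) * k j e)" for e
  have nz: "1 - cnj (z i) * e \<noteq> 0" if "i < m" "e \<in> cball 0 1" for i e
  proof
    assume "1 - cnj (z i) * e = 0"
    then have "cmod (z i) * cmod e = 1"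
      by (metis complex_mod_cnj eq_iff_diff_eq_0 norm_mult norm_one)
    moreover have "cmod (z i) * cmod e \<le> cmod (z i) * 1"
      using that by (intro mult_left_mono) auto
    ultimately show False
      using z[OF that(1)] by simp
  qed
  have k: "k i holomorphic_on cball 0 1" if "i < m" for i
    unfolding k_def using nz[OF that] by (intro holomorphic_intros) auto
  have f: "f holomorphic_on cball 0 1" and g: "g holomorphic_on cball 0 1"
    unfolding f_def g_def by (intro holomorphic_intros k; simp)+
  define \<gamma> where "\<gamma> = circlepath 0 1"
  have int_k: "((\<lambda>t. h (\<gamma> t) * cnj (k i (\<gamma> t))) has_integral h (z i)) {0..1}"
    if "h holomorphic_on cball 0 1" "i < m" for h i
    unfolding k_def \<gamma>_def using cauchy_circle_mean[OF that(1) z[OF that(2)]] by simp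
  have int_sum: "((\<lambda>t. h (\<gamma> t) * cnj (\<Sum>i<m. a i * k i (\<gamma> t)))
      has_integral (\<Sum>i<m. cnj (a i) * h (z i))) {0..1}"
    if h: "h holomorphic_on cball 0 1" for h a
  proof -
    have "((\<lambda>t. \<Sum>i<m. cnj (a i) * (h (\<gamma> t) * cnj (k i (\<gamma> t))))
        has_integral (\<Sum>i<m. cnj (a i) * h (z i))) {0..1}"
      by (intro has_integral_sum has_integral_mult_right int_k h) auto
    then show ?thesis
      by (simp add: sum_distrib_left mult_ac)
  qed
  define A where "A = (\<Sum>i<m. cnj (c i) * f (z i))"
  define B where "B = (\<Sum>i<m. cnj (c i) * (F (z i) * g (z i)))"
  have ff: "((\<lambda>t. f (\<gamma> t) * cnj (f (\<gamma> t))) has_integral A) {0..1}"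
    using int_sum[OF f, of c] by (simp add: A_def f_def)
  have Fg: "(\<lambda>e. F e * g e) holomorphic_on cball 0 1"
    by (intro holomorphic_intros F g)
  have Fgf: "((\<lambda>t. F (\<gamma> t) * g (\<gamma> t) * cnj (f (\<gamma> t))) has_integral B) {0..1}"
    using int_sum[OF Fg, of c] by (simp add: B_def f_def)
  \<comment> \<open>The value is again \<open>B\<close>: \<open>g\<close> is what the adjoint of
    multiplication by \<open>F\<close> makes of \<open>f\<close>, because that adjoint scales the
    Szego kernel at \<open>z i\<close> by \<open>cnj (F (z i))\<close>.\<close>
  have gg: "((\<lambda>t. g (\<gamma> t) * cnj (g (\<gamma> t))) has_integral B) {0..1}"
    using int_sum[OF g, of "\<lambda>j. c j * cnj (F (z j))"] by (simp add: B_def g_def mult.assoc)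
  have cnj_int: "((\<lambda>t. cnj (u t)) has_integral cnj I) {0..1}" if "(u has_integral I) {0..1}"
    for u :: "real \<Rightarrow> complex" and I
    using has_integral_linear[OF that bounded_linear_cnj] by (simp add: o_def)
  \<comment> \<open>\<open>cnj B\<close> is both subtracted and added, so the total is
    \<open>A - B\<close> while the integrand becomes a squared modulus plus a nonnegative defect at
    each point of the circle.\<close>
  have "((\<lambda>t. f (\<gamma> t) * cnj (f (\<gamma> t)) - F (\<gamma> t) * g (\<gamma> t) * cnj (f (\<gamma> t))
      - cnj (F (\<gamma> t) * g (\<gamma> t) * cnj (f (\<gamma> t))) + cnj (g (\<gamma> t) * cnj (g (\<gamma> t))))
      has_integral A - B - cnj B + cnj B) {0..1}"
    by (intro has_integral_add has_integral_diff cnj_int ff Fgf gg)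
  moreover have "a * cnj a - F e * b * cnj a - cnj (F e * b * cnj a) + cnj (b * cnj b) \<in> \<real>\<^sub>\<ge>\<^sub>0"
    if "cmod e = 1" for a b e
  proof -
    have "a * cnj a - F e * b * cnj a - cnj (F e * b * cnj a) + cnj (b * cnj b)
        = (a - F e * b) * cnj (a - F e * b) + (b * cnj b - (F e * b) * cnj (F e * b))"
      by (simp add: algebra_simps)
    also have "\<dots> = of_real ((cmod (a - F e * b))\<^sup>2 + ((cmod b)\<^sup>2 - (cmod (F e * b))\<^sup>2))"
      unfolding of_real_add of_real_diff complex_norm_square by simp
    also have "\<dots> \<in> \<real>\<^sub>\<ge>\<^sub>0"
    proof -
      have "cmod (F e * b) \<le> cmod b"
        using bound[OF that] by (simp add: norm_mult mult_left_le_one_le)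
      then have "(cmod (F e * b))\<^sup>2 \<le> (cmod b)\<^sup>2"
        by (rule power_mono) simp
      then show ?thesis
        by (subst nonneg_Reals_of_real_iff) simp
    qed
    finally show ?thesis .
  qed
  ultimately have "A - B - cnj B + cnj B \<in> \<real>\<^sub>\<ge>\<^sub>0"
    by (rule has_integral_nonneg_complex) (simp add: \<gamma>_def circlepath)
  also have "A - B - cnj B + cnj B = (\<Sum>i<m. \<Sum>j<m. pick F (z i) (z j) * c j * cnj (c i))"
  proof -
    have "A - B = (\<Sum>i<m. \<Sum>j<m. cnj (c i) * (c j * k j (z i)) -
        cnj (c i) * (F (z i) * (c j * cnj (F (z j)) * k j (z i))))"
      unfolding A_def B_def f_def g_def by (simp only: sum_distrib_left sum_subtractf)
    also have "\<dots> = (\<Sum>i<m. \<Sum>j<m. pick F (z i) (z j) * c j * cnj (c i))"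
      by (intro sum.cong refl) (simp add: pick_def k_def diff_divide_distrib algebra_simps)
    finally show ?thesis by simp
  qed
  finally show ?thesis .
qed

text \<open>A Schur function need not extend to the closed disc. Its dilations by \<open>r n\<close>
  do, and their Pick sums converge to the one wanted.\<close>

lemma pick_nonneg:
  assumes \<phi>: "schur_disc \<phi>" and z: "\<And>i::nat. i < m \<Longrightarrow> z i \<in> disc"
  shows "(\<Sum>i<m. \<Sum>j<m. pick \<phi> (z i) (z j) * c j * cnj (c i)) \<in> \<real>\<^sub>\<ge>\<^sub>0"
proof -
  have hol: "\<phi> holomorphic_on disc" and bound: "\<And>z. z \<in> disc \<Longrightarrow> cmod (\<phi> z) \<le> 1"
    using \<phi> by (auto simp: schur_disc_def)
  define r where "r n = 1 - 1 / real (Suc (Suc n))" for n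
  have r: "0 < r n" "r n < 1" for n
    by (auto simp: r_def)
  have mem: "of_real (r n) * w \<in> disc" if "cmod w \<le> 1" for n w
  proof -
    have "r n * cmod w \<le> r n * 1"
      using that r(1)[of n] by (intro mult_left_mono) auto
    also have "\<dots> < 1"
      using r(2)[of n] by simp
    finally show ?thesis
      using r(1)[of n] by (simp add: norm_mult)
  qed
  have r_lim: "r \<longlonglongrightarrow> 1"
    using tendsto_diff[OF tendsto_const[of 1] LIMSEQ_Suc[OF LIMSEQ_inverse_real_of_nat]]
    by (simp add: r_def[abs_def] inverse_eq_divide)
  have lim: "(\<lambda>n. \<phi> (of_real (r n) * w)) \<longlonglongrightarrow> \<phi> w" if "w \<in> disc" for w
  proof -
    have "isCont \<phi> w"
      using hol that holomorphic_on_imp_continuous_on continuous_on_eq_continuous_at[OF open_ball] by blast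
    moreover have "(\<lambda>n. of_real (r n) * w) \<longlonglongrightarrow> of_real 1 * w"
      by (intro tendsto_intros r_lim)
    ultimately show ?thesis
      using isCont_tendsto_compose[of w \<phi>] by simp
  qed
  have "(\<Sum>i<m. \<Sum>j<m. pick (\<lambda>w. \<phi> (of_real (r n) * w)) (z i) (z j) * c j * cnj (c i)) \<in> \<real>\<^sub>\<ge>\<^sub>0" for n
  proof (rule pick_nonneg_closed_disc)
    have "\<phi> \<circ> (\<lambda>w. of_real (r n) * w) holomorphic_on cball 0 1"
      using mem by (intro holomorphic_on_compose_gen[OF _ hol] holomorphic_intros) auto
    then show "(\<lambda>w. \<phi> (of_real (r n) * w)) holomorphic_on cball 0 1"
      by (simp add: o_def)
  qed (use z bound mem in auto)
  moreover have "(\<lambda>n. \<Sum>i<m. \<Sum>j<m. pick (\<lambda>w. \<phi> (of_real (r n) * w)) (z i) (z j) * c j * cnj (c i))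
      \<longlonglongrightarrow> (\<Sum>i<m. \<Sum>j<m. pick \<phi> (z i) (z j) * c j * cnj (c i))"
    unfolding pick_def using z one_minus_cnj_neq_0 by (intro tendsto_intros lim) auto
  ultimately show ?thesis
    by (rule closed_sequentially[OF closed_nonneg_Reals_complex])
qed

text \<open>The weights \<open>a\<close> are absorbed into the coefficients. The map
  \<open>p\<close> selects the coordinate on which the kernel depends.\<close>

lemma is_kernel_pick:
  assumes \<phi>: "schur_disc \<phi>" and p: "\<And>z. z \<in> bidisc \<Longrightarrow> p z \<in> disc"
  shows "is_kernel (\<lambda>z w. a z * cnj (a w) * pick \<phi> (p z) (p w))"
  unfolding is_kernel_def
proof (intro allI impI)
  fix m :: nat and z c assume z: "z \<in> {..<m} \<rightarrow> bidisc"
  have "p (z i) \<in> disc" if "i < m" for i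
    using z that by (intro p) blast
  then have "(\<Sum>i<m. \<Sum>j<m. pick \<phi> (p (z i)) (p (z j)) * (cnj (a (z j)) * c j) * cnj (cnj (a (z i)) * c i)) \<in> \<real>\<^sub>\<ge>\<^sub>0"
    by (rule pick_nonneg[OF \<phi>])
  then show "(\<Sum>i<m. \<Sum>j<m. a (z i) * cnj (a (z j)) * pick \<phi> (p (z i)) (p (z j)) * c j * cnj (c i)) \<in> \<real>\<^sub>\<ge>\<^sub>0"
    by (simp add: mult_ac)
qed

section \<open>Agler kernels of a product\<close>

lemma product_identity_of_kernels:
  assumes ak: "agler_kernels \<phi> K1 K2"
    and dep: "\<And>z w. \<lbrakk>z \<in> bidisc; w \<in> bidisc\<rbrakk> \<Longrightarrow> K1 z w = k (fst z) (cnj (fst w))"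
    and cond: "\<And>w1 z. \<lbrakk>w1 \<in> disc; z \<in> bidisc\<rbrakk>
      \<Longrightarrow> cnj (\<phi> (0, 0)) * K2 z (w1, 0) = cnj (\<phi> (w1, 0)) * K2 z (0, 0)"
    and nz: "\<phi> (0, 0) \<noteq> 0" and z: "z \<in> bidisc"
  shows "\<phi> z * \<phi> (0, 0) = \<phi> (fst z, 0) * \<phi> (0, snd z)"
proof -
  have K1: "is_kernel K1" and K2: "is_kernel K2"
    and agler: "\<And>z w. \<lbrakk>z \<in> bidisc; w \<in> bidisc\<rbrakk> \<Longrightarrow> 1 - \<phi> z * cnj (\<phi> w) =
      (1 - fst z * cnj (fst w)) * K1 z w + (1 - snd z * cnj (snd w)) * K2 z w"
    using ak unfolding agler_kernels_def by blast+
  have in0: "(0, 0) \<in> bidisc" by simp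
  define g where "g s = \<phi> (s, 0) / \<phi> (0, 0)" for s
  define T where "T = 1 - k 0 0"
  have cnj_k: "cnj (k s (cnj t)) = k t (cnj s)" if "s \<in> disc" "t \<in> disc" for s t
    using is_kernel_hermitian[OF K1, of "(s, 0)" "(t, 0)"] that by (simp add: dep)
  \<comment> \<open>The hypothesis concerns the second argument; Hermitian symmetry moves it to the
    first.\<close>
  have K2_0: "K2 (s, 0) w = g s * K2 (0, 0) w" if s: "s \<in> disc" and w: "w \<in> bidisc" for s w
  proof -
    have "\<phi> (0, 0) * K2 (s, 0) w = \<phi> (s, 0) * K2 (0, 0) w"
      using arg_cong[OF cond[OF s w], of cnj] is_kernel_hermitian[OF K2 w in0]
        is_kernel_hermitian[OF K2 w, of "(s, 0)"] s
      by simp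
    then show ?thesis
      using nz by (simp add: g_def field_simps)
  qed
  \<comment> \<open>With both second coordinates 0 the Agler identity contains
    \<open>K2 (s, 0) (t, 0)\<close>, which is \<open>g s\<close> times its value at
    \<open>s = 0\<close>; the identity at the origin gives that value, and the products of values of
    \<phi> cancel.\<close>
  have k_eq: "(1 - s * cnj t) * k s (cnj t) = 1 - g s * (1 - k 0 (cnj t))"
    if s: "s \<in> disc" and t: "t \<in> disc" for s t
  proof -
    have "1 - \<phi> (s, 0) * cnj (\<phi> (t, 0)) = (1 - s * cnj t) * k s (cnj t) + K2 (s, 0) (t, 0)"
      using agler[of "(s, 0)" "(t, 0)"] s t by (simp add: dep)
    moreover have "K2 (0, 0) (t, 0) = 1 - \<phi> (0, 0) * cnj (\<phi> (t, 0)) - k 0 (cnj t)"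
      using agler[of "(0, 0)" "(t, 0)"] t by (simp add: dep)
    then have "K2 (s, 0) (t, 0) = g s * (1 - \<phi> (0, 0) * cnj (\<phi> (t, 0)) - k 0 (cnj t))"
      using K2_0[OF s, of "(t, 0)"] t by simp
    ultimately have "(1 - s * cnj t) * k s (cnj t) = 1 - \<phi> (s, 0) * cnj (\<phi> (t, 0))
        - g s * (1 - \<phi> (0, 0) * cnj (\<phi> (t, 0)) - k 0 (cnj t))"
      by (simp add: algebra_simps)
    also have "\<dots> = 1 - g s * (1 - k 0 (cnj t))"
      using nz by (simp add: g_def field_simps)
    finally show ?thesis .
  qed
  have "cnj T = T"
    using cnj_k[of 0 0] by (simp add: T_def)
  have "k t 0 = 1 - g t * T" if "t \<in> disc" for t
    using k_eq[OF that, of 0] by (simp add: T_def)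
  \<comment> \<open>Setting \<open>t = 0\<close> in \<open>k_eq\<close> gives \<open>k t 0\<close>;
    conjugation gives the values needed on the other axis.\<close>
  then have k0: "1 - k 0 (cnj t) = T * cnj (g t)" if "t \<in> disc" for t
    using cnj_k[of t 0] that \<open>cnj T = T\<close> by (metis (no_types, lifting) centre_in_ball
        complex_cnj_diff complex_cnj_mult complex_cnj_one complex_cnj_zero diff_diff_eq2
        add_diff_cancel_left' mult.commute zero_less_one)
  have K2_eq: "(1 - snd z * cnj (snd w)) * K2 z w = T * g (fst z) * cnj (g (fst w)) - \<phi> z * cnj (\<phi> w)"
    if "z \<in> bidisc" "w \<in> bidisc" for z w
  proof -
    have "fst z \<in> disc" "fst w \<in> disc"
      using that by auto
    then have "(1 - fst z * cnj (fst w)) * K1 z w = 1 - g (fst z) * (T * cnj (g (fst w)))"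
      using that by (simp add: dep k_eq k0)
    from agler[OF that, unfolded this] show ?thesis
      by (simp add: algebra_simps)
  qed
  obtain z1 z2 where zz: "z = (z1, z2)" "z1 \<in> disc" "z2 \<in> disc"
    using z by auto
  \<comment> \<open>Both points have second coordinate \<open>z2\<close>, so all four values of
    \<open>K2\<close> carry the same positive factor \<open>d\<close>.\<close>
  define w where "w = (0 :: complex, z2)"
  have w: "w \<in> bidisc"
    using zz by (simp add: w_def)
  define d where "d = 1 - (cmod z2)\<^sup>2"
  have d: "0 < d" and d_eq: "1 - z2 * cnj z2 = of_real d"
    using zz(3) by (simp_all add: d_def power_less_one_iff complex_norm_square[symmetric])
  define \<delta> where "\<delta> = \<phi> z - g z1 * \<phi> w"
  define y where "y = (\<lambda>i::nat. if i = 0 then z else w)"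
  \<comment> \<open>Chosen to annihilate the rank-one part \<open>T * g * cnj g\<close>, as
    \<open>g\<close> takes the values \<open>g z1\<close> and 1 at the two points. What remains is
    minus the squared modulus of \<delta>.\<close>
  define c where "c = (\<lambda>i::nat. if i = 0 then 1 else - cnj (g z1))"
  have "y \<in> {..<2} \<rightarrow> bidisc"
    using z w by (simp add: y_def)
  then have "(\<Sum>i<2. \<Sum>j<2. K2 (y i) (y j) * c j * cnj (c i)) \<in> \<real>\<^sub>\<ge>\<^sub>0"
    by (rule K2[unfolded is_kernel_def, rule_format])
  also have "(\<Sum>i<2. \<Sum>j<2. K2 (y i) (y j) * c j * cnj (c i))
      = K2 z z - K2 z w * cnj (g z1) - K2 w z * g z1 + K2 w w * cnj (g z1) * g z1"
    by (simp add: numeral_2_eq_2 y_def c_def algebra_simps)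
  finally have "of_real d * (K2 z z - K2 z w * cnj (g z1) - K2 w z * g z1 + K2 w w * cnj (g z1) * g z1)
      \<in> \<real>\<^sub>\<ge>\<^sub>0"
    using d by (intro nonneg_Reals_mult_I) auto
  also have "of_real d * (K2 z z - K2 z w * cnj (g z1) - K2 w z * g z1 + K2 w w * cnj (g z1) * g z1)
      = of_real d * K2 z z - (of_real d * K2 z w) * cnj (g z1) - (of_real d * K2 w z) * g z1
        + (of_real d * K2 w w) * cnj (g z1) * g z1"
    by (simp add: algebra_simps)
  also have "\<dots> = - (\<delta> * cnj \<delta>)"
  proof -
    have "g 0 = 1"
      using nz by (simp add: g_def)
    then have "of_real d * K2 z z = T * g z1 * cnj (g z1) - \<phi> z * cnj (\<phi> z)"
      "of_real d * K2 z w = T * g z1 - \<phi> z * cnj (\<phi> w)"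
      "of_real d * K2 w z = T * cnj (g z1) - \<phi> w * cnj (\<phi> z)"
      "of_real d * K2 w w = T - \<phi> w * cnj (\<phi> w)"
      using K2_eq[OF z z] K2_eq[OF z w] K2_eq[OF w z] K2_eq[OF w w]
      by (simp_all add: zz w_def d_eq)
    note * = this
    show ?thesis
      unfolding * by (simp add: \<delta>_def algebra_simps)
  qed
  finally have "0 \<le> - ((cmod \<delta>)\<^sup>2)"
    by (simp add: complex_norm_square[symmetric] complex_nonneg_Reals_iff)
  then have "\<delta> = 0" by simp
  then show ?thesis
    using nz by (simp add: \<delta>_def zz w_def g_def)
qed

section \<open>Schur factors from the product identity, and kernels from the factors\<close>

lemma schur_slices:
  assumes \<phi>: "schur_bidisc \<phi>"
  shows "(\<lambda>s. \<phi> (s, 0)) holomorphic_on disc" "(\<lambda>s. \<phi> (0, s)) holomorphic_on disc"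
proof -
  have hol: "holomorphic2_on \<phi> bidisc"
    using \<phi> by (simp add: schur_bidisc_def)
  have "\<exists>a. ((\<lambda>s. \<phi> (s, 0)) has_field_derivative a) (at s within disc)" if s: "s \<in> disc" for s
  proof -
    obtain a b where d: "(\<phi> has_derivative (\<lambda>(h1, h2). a * h1 + b * h2)) (at (s, 0) within bidisc)"
      using hol s unfolding holomorphic2_on_def by (metis centre_in_ball mem_Sigma_iff zero_less_one)
    have "((\<lambda>s. \<phi> (s, 0)) has_derivative (\<lambda>h. case (h, 0) of (h1, h2) \<Rightarrow> a * h1 + b * h2)) (at s within disc)"
      by (rule has_derivative_in_compose[where f = "\<lambda>s. (s, 0)" and g = \<phi>])
        (auto intro!: derivative_eq_intros has_derivative_subset[OF d])
    then show ?thesis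
      unfolding has_field_derivative_def by (auto intro: exI[of _ a])
  qed
  then show "(\<lambda>s. \<phi> (s, 0)) holomorphic_on disc"
    by (simp add: holomorphic_on_def field_differentiable_def)
  have "\<exists>b. ((\<lambda>s. \<phi> (0, s)) has_field_derivative b) (at s within disc)" if s: "s \<in> disc" for s
  proof -
    obtain a b where d: "(\<phi> has_derivative (\<lambda>(h1, h2). a * h1 + b * h2)) (at (0, s) within bidisc)"
      using hol s unfolding holomorphic2_on_def by (metis centre_in_ball mem_Sigma_iff zero_less_one)
    have "((\<lambda>s. \<phi> (0, s)) has_derivative (\<lambda>h. case (0, h) of (h1, h2) \<Rightarrow> a * h1 + b * h2)) (at s within disc)"
      by (rule has_derivative_in_compose[where f = "\<lambda>s. (0, s)" and g = \<phi>])
        (auto intro!: derivative_eq_intros has_derivative_subset[OF d])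
    then show ?thesis
      unfolding has_field_derivative_def by (auto intro: exI[of _ b])
  qed
  then show "(\<lambda>s. \<phi> (0, s)) holomorphic_on disc"
    by (simp add: holomorphic_on_def field_differentiable_def)
qed

lemma schur_factorization:
  assumes \<phi>: "schur_bidisc \<phi>" and nz: "\<phi> (0, 0) \<noteq> 0"
    and prod: "\<And>z. z \<in> bidisc \<Longrightarrow> \<phi> z * \<phi> (0, 0) = \<phi> (fst z, 0) * \<phi> (0, snd z)"
  obtains \<phi>1 \<phi>2 where "schur_disc \<phi>1" "schur_disc \<phi>2"
    "\<And>z1 z2. \<lbrakk>z1 \<in> disc; z2 \<in> disc\<rbrakk> \<Longrightarrow> \<phi> (z1, z2) = \<phi>1 z1 * \<phi>2 z2"
proof -
  have bound: "cmod (\<phi> z) \<le> 1" if "z \<in> bidisc" for z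
    using \<phi> that unfolding schur_bidisc_def by blast
  define s where "s = (SUP z1\<in>disc. cmod (\<phi> (z1, 0)))"
  have le_s: "cmod (\<phi> (z1, 0)) \<le> s" if "z1 \<in> disc" for z1
    unfolding s_def using that bound by (intro cSUP_upper bdd_aboveI2[where M = 1]) auto
  have s: "0 < s"
    using le_s[of 0] nz by (simp add: less_le_trans[of 0 "cmod (\<phi> (0, 0))"])
  have "schur_disc (\<lambda>z1. \<phi> (z1, 0) / of_real s)"
    unfolding schur_disc_def
  proof (intro conjI ballI)
    show "(\<lambda>z1. \<phi> (z1, 0) / of_real s) holomorphic_on disc"
      using s by (intro holomorphic_intros schur_slices \<phi>) auto
  qed (use s le_s in \<open>auto simp: norm_divide\<close>)
  moreover have "schur_disc (\<lambda>z2. of_real s * \<phi> (0, z2) / \<phi> (0, 0))"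
    unfolding schur_disc_def
  proof (intro conjI ballI)
    show "(\<lambda>z2. of_real s * \<phi> (0, z2) / \<phi> (0, 0)) holomorphic_on disc"
      using nz by (intro holomorphic_intros schur_slices \<phi>) auto
    fix z2 assume z2: "z2 \<in> disc"
    \<comment> \<open>For each \<open>z1\<close> the product identity bounds
      \<open>\<phi> (z1, 0) * \<phi> (0, z2)\<close> by the modulus of \<open>\<phi> (0, 0)\<close>;
      the supremum over \<open>z1\<close> gives the claim.\<close>
    have "s * cmod (\<phi> (0, z2)) \<le> cmod (\<phi> (0, 0))"
    proof (cases "\<phi> (0, z2) = 0")
      case False
      have "s \<le> cmod (\<phi> (0, 0)) / cmod (\<phi> (0, z2))"
        unfolding s_def
      proof (rule cSUP_least)
        fix z1 assume z1: "z1 \<in> disc"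
        have "cmod (\<phi> (z1, 0)) * cmod (\<phi> (0, z2)) = cmod (\<phi> (z1, z2)) * cmod (\<phi> (0, 0))"
          using prod[of "(z1, z2)"] z1 z2 by (simp flip: norm_mult)
        also have "\<dots> \<le> cmod (\<phi> (0, 0))"
          using bound[of "(z1, z2)"] z1 z2 by (simp add: mult_left_le_one_le)
        finally show "cmod (\<phi> (z1, 0)) \<le> cmod (\<phi> (0, 0)) / cmod (\<phi> (0, z2))"
          using False by (simp add: pos_le_divide_eq)
      qed auto
      then show ?thesis
        using False by (simp add: pos_le_divide_eq)
    qed simp
    then show "cmod (of_real s * \<phi> (0, z2) / \<phi> (0, 0)) \<le> 1"
      using s nz by (simp add: norm_mult norm_divide)
  qed
  moreover have "\<phi> (z1, z2) = \<phi> (z1, 0) / of_real s * (of_real s * \<phi> (0, z2) / \<phi> (0, 0))"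
    if "z1 \<in> disc" "z2 \<in> disc" for z1 z2
    using prod[of "(z1, z2)"] that s nz by (simp add: field_simps)
  ultimately show ?thesis by (rule that)
qed

text \<open>Telescoping: with a, b the values of \<phi>1 and c, d those of \<phi>2, one has 1 - a c
  cnj (b d) = (1 - a cnj b) + a cnj b (1 - c cnj d). The brackets are numerators of Pick
  kernels.\<close>

lemma agler_kernels_of_product:
  assumes \<phi>1: "schur_disc \<phi>1" and \<phi>2: "schur_disc \<phi>2"
    and \<phi>: "\<And>z1 z2. \<lbrakk>z1 \<in> disc; z2 \<in> disc\<rbrakk> \<Longrightarrow> \<phi> (z1, z2) = \<phi>1 z1 * \<phi>2 z2"
  defines "K1 \<equiv> \<lambda>z w. pick \<phi>1 (fst z) (fst w)"
    and "K2 \<equiv> \<lambda>z w. \<phi>1 (fst z) * cnj (\<phi>1 (fst w)) * pick \<phi>2 (snd z) (snd w)"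
  shows "agler_kernels \<phi> K1 K2"
    and "\<And>w1 z. \<lbrakk>w1 \<in> disc; z \<in> bidisc\<rbrakk>
      \<Longrightarrow> cnj (\<phi> (0, 0)) * K2 z (w1, 0) = cnj (\<phi> (w1, 0)) * K2 z (0, 0)"
proof -
  show "agler_kernels \<phi> K1 K2"
    unfolding agler_kernels_def
  proof (intro conjI ballI)
    show "is_kernel K1"
      using is_kernel_pick[OF \<phi>1, of fst "\<lambda>_. 1"] by (auto simp: K1_def)
    show "is_kernel K2"
      unfolding K2_def by (rule is_kernel_pick[OF \<phi>2, of snd "\<lambda>z. \<phi>1 (fst z)"]) auto
    fix z w assume zw: "z \<in> bidisc" "w \<in> bidisc"
    obtain z1 z2 w1 w2 where *: "z = (z1, z2)" "w = (w1, w2)" by fastforce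
    then have mem: "z1 \<in> disc" "z2 \<in> disc" "w1 \<in> disc" "w2 \<in> disc"
      using zw by auto
    have "(1 - z1 * cnj w1) * pick \<phi>1 z1 w1 = 1 - \<phi>1 z1 * cnj (\<phi>1 w1)"
      "(1 - z2 * cnj w2) * pick \<phi>2 z2 w2 = 1 - \<phi>2 z2 * cnj (\<phi>2 w2)"
      using mem one_minus_cnj_neq_0 by (simp_all add: pick_def)
    then show "1 - \<phi> z * cnj (\<phi> w) =
        (1 - fst z * cnj (fst w)) * K1 z w + (1 - snd z * cnj (snd w)) * K2 z w"
      using mem unfolding * by (simp add: K1_def K2_def \<phi> algebra_simps) algebra
  qed
  show "cnj (\<phi> (0, 0)) * K2 z (w1, 0) = cnj (\<phi> (w1, 0)) * K2 z (0, 0)"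
    if "w1 \<in> disc" "z \<in> bidisc" for w1 z
    using that by (simp add: K2_def \<phi>)
qed

section \<open>Kernel conditions and conditions on the function spaces\<close>

text \<open>Values of f are inner products with kernel sections, so relations between sections
  become relations between values. The conjugates in the kernel condition disappear because the
  second slot is antilinear.\<close>

lemma rkhs_of_kernels:
  assumes ak: "agler_kernels \<phi> K1 K2"
    and dep: "\<And>z w. \<lbrakk>z \<in> bidisc; w \<in> bidisc\<rbrakk> \<Longrightarrow> K1 z w = k (fst z) (cnj (fst w))"
    and cond: "\<And>w1 z. \<lbrakk>w1 \<in> disc; z \<in> bidisc\<rbrakk>
      \<Longrightarrow> cnj (\<phi> (0, 0)) * K2 z (w1, 0) = cnj (\<phi> (w1, 0)) * K2 z (0, 0)"
  obtains H1 H2 where "is_rkhs K1 H1" "is_rkhs K2 H2"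
    "\<And>f. f \<in> hcarrier H1 \<Longrightarrow> \<exists>g. \<forall>z\<in>bidisc. f z = g (fst z)"
    "\<And>f z1. \<lbrakk>f \<in> hcarrier H2; z1 \<in> disc\<rbrakk> \<Longrightarrow> \<phi> (0, 0) * f (z1, 0) = \<phi> (z1, 0) * f (0, 0)"
proof -
  obtain H1 where H1: "is_rkhs K1 H1"
    using ak ex_rkhs unfolding agler_kernels_def by blast
  obtain H2 where H2: "is_rkhs K2 H2"
    using ak ex_rkhs unfolding agler_kernels_def by blast
  show ?thesis
  proof (rule that[OF H1 H2])
    fix f assume f: "f \<in> hcarrier H1"
    have "f z = f (fst z, 0)" if z: "z \<in> bidisc" for z
    proof -
      have z0: "(fst z, 0) \<in> bidisc"
        using z by auto
      have "kernel_section K1 z = kernel_section K1 (fst z, 0)"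
        using z z0 by (auto simp: kernel_section_def dep)
      then show ?thesis
        using H1 f z z0 unfolding is_rkhs_def by metis
    qed
    then show "\<exists>g. \<forall>z\<in>bidisc. f z = g (fst z)"
      by (intro exI[of _ "\<lambda>s. f (s, 0)"]) auto
  next
    fix f z1 assume f: "f \<in> hcarrier H2" and z1: "z1 \<in> disc"
    interpret hilbert_space H2
      using H2 by (simp add: is_rkhs_def)
    have mem: "(z1, 0) \<in> bidisc" "(0, 0) \<in> bidisc"
      using z1 by auto
    have k [simp]: "kernel_section K2 w \<in> hcarrier H2" "hinner H2 f (kernel_section K2 w) = f w"
      if "w \<in> bidisc" for w
      using H2 f that unfolding is_rkhs_def by auto
    have "cnj (\<phi> (0, 0)) *\<^sub>C kernel_section K2 (z1, 0) = cnj (\<phi> (z1, 0)) *\<^sub>C kernel_section K2 (0, 0)"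
      using cond[OF z1] by (auto simp: kernel_section_def fun_eq_iff)
    from arg_cong[OF this, of "hinner H2 f"]
    show "\<phi> (0, 0) * f (z1, 0) = \<phi> (z1, 0) * f (0, 0)"
      using f k[OF mem(1)] k[OF mem(2)] by (simp only: scale_right complex_cnj_cnj)
  qed
qed

text \<open>Kernel sections are themselves members of the spaces, so the conditions on functions
  apply to them; symmetry transfers the result to the other argument.\<close>

lemma kernels_of_rkhs:
  assumes ak: "agler_kernels \<phi> K1 K2" and H1: "is_rkhs K1 H1" and H2: "is_rkhs K2 H2"
    and dep: "\<And>f. f \<in> hcarrier H1 \<Longrightarrow> \<exists>g. \<forall>z\<in>bidisc. f z = g (fst z)"
    and cond: "\<And>f z1. \<lbrakk>f \<in> hcarrier H2; z1 \<in> disc\<rbrakk>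
      \<Longrightarrow> \<phi> (0, 0) * f (z1, 0) = \<phi> (z1, 0) * f (0, 0)"
  shows "\<exists>k. \<forall>z\<in>bidisc. \<forall>w\<in>bidisc. K1 z w = k (fst z) (cnj (fst w))"
    and "\<And>w1 z. \<lbrakk>w1 \<in> disc; z \<in> bidisc\<rbrakk>
      \<Longrightarrow> cnj (\<phi> (0, 0)) * K2 z (w1, 0) = cnj (\<phi> (w1, 0)) * K2 z (0, 0)"
proof -
  have K1: "is_kernel K1" and K2: "is_kernel K2"
    using ak by (auto simp: agler_kernels_def)
  have dep1: "K1 z w = K1 (fst z, 0) w" if z: "z \<in> bidisc" and w: "w \<in> bidisc" for z w
  proof -
    have "kernel_section K1 w \<in> hcarrier H1"
      using H1 w unfolding is_rkhs_def by blast
    from dep[OF this] obtain g where g: "\<And>z. z \<in> bidisc \<Longrightarrow> kernel_section K1 w z = g (fst z)"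
      by blast
    have "(fst z, 0) \<in> bidisc"
      using z by auto
    then show ?thesis
      using g[OF z] g[of "(fst z, 0)"] z by (simp add: kernel_section_def)
  qed
  \<comment> \<open>The double conjugate matches the witness below, which takes the conjugate of
    \<open>fst w\<close> as its argument.\<close>
  have "K1 z w = K1 (fst z, 0) (cnj (cnj (fst w)), 0)" if z: "z \<in> bidisc" and w: "w \<in> bidisc" for z w
  proof -
    have z0: "(fst z, 0) \<in> bidisc" and w0: "(fst w, 0) \<in> bidisc"
      using z w by auto
    have "K1 (fst z, 0) w = cnj (K1 (fst w, 0) (fst z, 0))"
      using is_kernel_hermitian[OF K1 w z0] dep1[OF w z0] by simp
    then show ?thesis
      using dep1[OF z w] is_kernel_hermitian[OF K1 w0 z0] by simp
  qed
  then show "\<exists>k. \<forall>z\<in>bidisc. \<forall>w\<in>bidisc. K1 z w = k (fst z) (cnj (fst w))"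
    by (intro exI[of _ "\<lambda>s t. K1 (s, 0) (cnj t, 0)"]) blast
  show "cnj (\<phi> (0, 0)) * K2 z (w1, 0) = cnj (\<phi> (w1, 0)) * K2 z (0, 0)"
    if w1: "w1 \<in> disc" and z: "z \<in> bidisc" for w1 z
  proof -
    have mem: "(w1, 0) \<in> bidisc" "(0, 0) \<in> bidisc"
      using w1 by auto
    have "kernel_section K2 z \<in> hcarrier H2"
      using H2 z unfolding is_rkhs_def by blast
    from arg_cong[OF cond[OF this w1], of cnj]
    show ?thesis
      using mem is_kernel_hermitian[OF K2 _ z] by (simp add: kernel_section_def)
  qed
qed

section \<open>Colligations\<close>

text \<open>The constant in \<open>bounded_op\<close> may be negative, which the trivial space
  allows; its absolute value serves as well.\<close>

lemma bounded_opE: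
  assumes H: "hilbert_space H" and T: "bounded_op H K T"
  obtains M where "0 \<le> M" "\<And>x. x \<in> hcarrier H \<Longrightarrow> hnorm K (T x) \<le> M * hnorm H x"
proof -
  interpret hilbert_space H by fact
  obtain M where M: "\<And>x. x \<in> hcarrier H \<Longrightarrow> hnorm K (T x) \<le> M * hnorm H x"
    using T unfolding bounded_op_def by blast
  have "hnorm K (T x) \<le> \<bar>M\<bar> * hnorm H x" if "x \<in> hcarrier H" for x
    using M[OF that] mult_right_mono[OF abs_ge_self[of M] hnorm_nonneg[OF that]] by linarith
  then show ?thesis by (rule that[OF abs_ge_zero])
qed

lemma bounded_op_zero: "hilbert_space H \<Longrightarrow> bounded_op H K T \<Longrightarrow> T 0 = 0"
proof -
  assume "hilbert_space H" and T: "bounded_op H K T"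
  then interpret hilbert_space H by simp
  show "T 0 = 0"
    using bounded_opD(3)[OF T zero_mem, of 0] by simp
qed

lemma bounded_opI:
  assumes "\<And>x. x \<in> hcarrier H \<Longrightarrow> T x \<in> hcarrier K"
    and "\<And>x y. \<lbrakk>x \<in> hcarrier H; y \<in> hcarrier H\<rbrakk> \<Longrightarrow> T (x + y) = T x + T y"
    and "\<And>a x. x \<in> hcarrier H \<Longrightarrow> T (a *\<^sub>C x) = a *\<^sub>C T x"
    and "\<And>x. x \<in> hcarrier H \<Longrightarrow> hnorm K (T x) \<le> M * hnorm H x"
  shows "bounded_op H K T"
  using assms unfolding bounded_op_def by blast

lemma bounded_op_comp:
  assumes "hilbert_space H" "hilbert_space K" and S: "bounded_op H K S" and T: "bounded_op K L T"
  shows "bounded_op H L (\<lambda>x. T (S x))"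
proof -
  obtain M where M: "0 \<le> M" "\<And>x. x \<in> hcarrier K \<Longrightarrow> hnorm L (T x) \<le> M * hnorm K x"
    using bounded_opE[OF assms(2) T] by blast
  obtain N where N: "\<And>x. x \<in> hcarrier H \<Longrightarrow> hnorm K (S x) \<le> N * hnorm H x"
    using bounded_opE[OF assms(1) S] by blast
  show ?thesis
  proof (rule bounded_opI)
    show "hnorm L (T (S x)) \<le> M * N * hnorm H x" if "x \<in> hcarrier H" for x
      using M(2)[of "S x"] mult_left_mono[OF N[OF that] M(1)] bounded_opD(1)[OF S that] by simp
  qed (use bounded_opD[OF S] bounded_opD[OF T] in auto)
qed

lemma hnorm_hsum:
  assumes "hilbert_space H" "hilbert_space K" "x \<in> hcarrier H" "y \<in> hcarrier K"
  shows "hnorm H x \<le> hnorm (H \<oplus>\<^sub>H K) (x, y)" "hnorm K y \<le> hnorm (H \<oplus>\<^sub>H K) (x, y)"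
    and "hnorm (H \<oplus>\<^sub>H K) (x, y) \<le> hnorm H x + hnorm K y"
proof -
  interpret H: hilbert_space H by fact
  interpret K: hilbert_space K by fact
  interpret HK: hilbert_space "H \<oplus>\<^sub>H K" by (rule hilbert_hsum(1)) fact+
  have sq: "(hnorm (H \<oplus>\<^sub>H K) (x, y))\<^sup>2 = (hnorm H x)\<^sup>2 + (hnorm K y)\<^sup>2"
    using hilbert_hsum(2)[OF assms(1,2), of "(x, y)"] assms(3,4) by simp
  have mem: "(x, y) \<in> hcarrier (H \<oplus>\<^sub>H K)"
    using assms(3,4) by simp
  show "hnorm H x \<le> hnorm (H \<oplus>\<^sub>H K) (x, y)"
    by (rule power2_le_imp_le) (use sq HK.hnorm_nonneg[OF mem] in auto)
  show "hnorm K y \<le> hnorm (H \<oplus>\<^sub>H K) (x, y)"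
    by (rule power2_le_imp_le) (use sq HK.hnorm_nonneg[OF mem] in auto)
  show "hnorm (H \<oplus>\<^sub>H K) (x, y) \<le> hnorm H x + hnorm K y"
    by (rule power2_le_imp_le) (use sq assms(3,4) in \<open>simp_all add: power2_sum\<close>)
qed

lemma bounded_op_pair:
  assumes "hilbert_space H" "hilbert_space K" "hilbert_space L"
    and S: "bounded_op H K S" and T: "bounded_op H L T"
  shows "bounded_op H (K \<oplus>\<^sub>H L) (\<lambda>x. (S x, T x))"
proof -
  obtain M where M: "\<And>x. x \<in> hcarrier H \<Longrightarrow> hnorm K (S x) \<le> M * hnorm H x"
    using bounded_opE[OF assms(1) S] by blast
  obtain N where N: "\<And>x. x \<in> hcarrier H \<Longrightarrow> hnorm L (T x) \<le> N * hnorm H x"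
    using bounded_opE[OF assms(1) T] by blast
  show ?thesis
  proof (rule bounded_opI)
    fix x assume x: "x \<in> hcarrier H"
    have "hnorm (K \<oplus>\<^sub>H L) (S x, T x) \<le> hnorm K (S x) + hnorm L (T x)"
      using bounded_opD(1)[OF S x] bounded_opD(1)[OF T x] assms(2,3) by (intro hnorm_hsum)
    then show "hnorm (K \<oplus>\<^sub>H L) (S x, T x) \<le> (M + N) * hnorm H x"
      using M[OF x] N[OF x] by (simp add: distrib_right)
  qed (use bounded_opD[OF S] bounded_opD[OF T] in auto)
qed

lemma bounded_op_fst:
  assumes "hilbert_space H" "hilbert_space K"
  shows "bounded_op (H \<oplus>\<^sub>H K) H fst"
  by (rule bounded_opI[where M = 1]) (use hnorm_hsum[OF assms] in auto)

lemma bounded_op_snd: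
  assumes "hilbert_space H" "hilbert_space K"
  shows "bounded_op (H \<oplus>\<^sub>H K) K snd"
  by (rule bounded_opI[where M = 1]) (use hnorm_hsum[OF assms] in auto)

lemma bounded_op_mult: "bounded_op complex_hilb complex_hilb ((*) a)"
  by (rule bounded_opI[where M = "cmod a"]) (auto simp: scaleC_complex_def algebra_simps norm_mult)

lemma bounded_op_cong:
  assumes T: "bounded_op H K T" and H: "hilbert_space H"
    and eq: "\<And>x. x \<in> hcarrier H \<Longrightarrow> T' x = T x"
  shows "bounded_op H K T'"
proof -
  interpret hilbert_space H by fact
  obtain M where "\<And>x. x \<in> hcarrier H \<Longrightarrow> hnorm K (T x) \<le> M * hnorm H x"
    using T unfolding bounded_op_def by blast
  then show ?thesis
    using bounded_opD[OF T] by (intro bounded_opI[where M = M]) (simp_all add: eq)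
qed

lemma coisometric_comp:
  assumes H: "hilbert_space H" and S: "coisometric H S" and T: "coisometric H T"
    and V: "\<And>x. x \<in> hcarrier H \<Longrightarrow> V x = S (T x)"
  shows "coisometric H V"
proof -
  obtain S' where S': "is_adjoint H H S S'" "\<And>x. x \<in> hcarrier H \<Longrightarrow> S (S' x) = x"
    and bS: "bounded_op H H S"
    using S by (auto simp: coisometric_def)
  obtain T' where T': "is_adjoint H H T T'" "\<And>x. x \<in> hcarrier H \<Longrightarrow> T (T' x) = x"
    and bT: "bounded_op H H T"
    using T by (auto simp: coisometric_def)
  have mem: "S' x \<in> hcarrier H" "T' x \<in> hcarrier H" "T x \<in> hcarrier H" if "x \<in> hcarrier H" for x
    using S' T' bT bounded_opD(1) that unfolding is_adjoint_def by metis+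
  have "bounded_op H H V"
    by (rule bounded_op_cong[OF bounded_op_comp[OF H H bT bS] H V])
  moreover have "is_adjoint H H V (\<lambda>x. T' (S' x))"
    using S'(1) T'(1) bounded_op_comp[OF H H, of S' H T'] mem V unfolding is_adjoint_def by simp
  moreover have "V (T' (S' x)) = x" if "x \<in> hcarrier H" for x
    using mem that by (simp add: V S' T')
  ultimately show ?thesis
    unfolding coisometric_def by blast
qed

text \<open>Acting as the identity on the extra summand preserves \<open>V V' = I\<close>. The two
  positions of the summand let colligations with state spaces H1 and H2 be composed on one common
  space.\<close>

lemma coisometric_amplification:
  assumes G: "hilbert_space G" and H: "hilbert_space H" and K: "hilbert_space K"
    and V: "coisometric (G \<oplus>\<^sub>H H) V"
  shows "coisometric (G \<oplus>\<^sub>H H \<oplus>\<^sub>H K) (\<lambda>(c, x, y). (fst (V (c, x)), snd (V (c, x)), y))"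
    and "coisometric (G \<oplus>\<^sub>H K \<oplus>\<^sub>H H) (\<lambda>(c, y, x). (fst (V (c, x)), y, snd (V (c, x))))"
proof -
  have hs: "hilbert_space G" "hilbert_space H" "hilbert_space K" "hilbert_space (G \<oplus>\<^sub>H H)"
    "hilbert_space (H \<oplus>\<^sub>H K)" "hilbert_space (G \<oplus>\<^sub>H H \<oplus>\<^sub>H K)"
    "hilbert_space (K \<oplus>\<^sub>H H)" "hilbert_space (G \<oplus>\<^sub>H K \<oplus>\<^sub>H H)"
    by (intro hilbert_hsum(1) G H K)+
  obtain V' where V': "is_adjoint (G \<oplus>\<^sub>H H) (G \<oplus>\<^sub>H H) V V'"
    and VV': "\<And>x. x \<in> hcarrier (G \<oplus>\<^sub>H H) \<Longrightarrow> V (V' x) = x"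
    and bV: "bounded_op (G \<oplus>\<^sub>H H) (G \<oplus>\<^sub>H H) V"
    using V by (auto simp: coisometric_def)
  then have bV': "bounded_op (G \<oplus>\<^sub>H H) (G \<oplus>\<^sub>H H) V'"
    and adj: "\<And>p q. \<lbrakk>p \<in> hcarrier (G \<oplus>\<^sub>H H); q \<in> hcarrier (G \<oplus>\<^sub>H H)\<rbrakk> \<Longrightarrow>
      hinner (G \<oplus>\<^sub>H H) (V p) q = hinner (G \<oplus>\<^sub>H H) p (V' q)"
    by (auto simp: is_adjoint_def)
  have b1: "bounded_op (G \<oplus>\<^sub>H H \<oplus>\<^sub>H K) (G \<oplus>\<^sub>H H \<oplus>\<^sub>H K) (\<lambda>(c, x, y). (fst (T (c, x)), snd (T (c, x)), y))"
    if T: "bounded_op (G \<oplus>\<^sub>H H) (G \<oplus>\<^sub>H H) T" for T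
  proof -
    have "bounded_op (G \<oplus>\<^sub>H H \<oplus>\<^sub>H K) (G \<oplus>\<^sub>H H) (\<lambda>p. T (fst p, fst (snd p)))"
      by (rule bounded_op_comp[OF _ _ bounded_op_pair[OF _ _ _ bounded_op_fst
              bounded_op_comp[OF _ _ bounded_op_snd bounded_op_fst]] T]) (intro hs)+
    from bounded_op_pair[OF _ _ _ bounded_op_comp[OF _ _ this bounded_op_fst]
        bounded_op_pair[OF _ _ _ bounded_op_comp[OF _ _ this bounded_op_snd]
          bounded_op_comp[OF _ _ bounded_op_snd bounded_op_snd]]]
    show ?thesis
      using hs by (simp add: case_prod_unfold)
  qed
  have b2: "bounded_op (G \<oplus>\<^sub>H K \<oplus>\<^sub>H H) (G \<oplus>\<^sub>H K \<oplus>\<^sub>H H) (\<lambda>(c, y, x). (fst (T (c, x)), y, snd (T (c, x))))"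
    if T: "bounded_op (G \<oplus>\<^sub>H H) (G \<oplus>\<^sub>H H) T" for T
  proof -
    have "bounded_op (G \<oplus>\<^sub>H K \<oplus>\<^sub>H H) (G \<oplus>\<^sub>H H) (\<lambda>p. T (fst p, snd (snd p)))"
      by (rule bounded_op_comp[OF _ _ bounded_op_pair[OF _ _ _ bounded_op_fst
              bounded_op_comp[OF _ _ bounded_op_snd bounded_op_snd]] T]) (intro hs)+
    from bounded_op_pair[OF _ _ _ bounded_op_comp[OF _ _ this bounded_op_fst]
        bounded_op_pair[OF _ _ _ bounded_op_comp[OF _ _ bounded_op_snd bounded_op_fst]
          bounded_op_comp[OF _ _ this bounded_op_snd]]]
    show ?thesis
      using hs by (simp add: case_prod_unfold)
  qed
  have mem: "V p \<in> hcarrier G \<times> hcarrier H" "V' p \<in> hcarrier G \<times> hcarrier H"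
    if "p \<in> hcarrier G \<times> hcarrier H" for p
    using bounded_opD(1)[OF bV, of p] bounded_opD(1)[OF bV', of p] that by simp_all
  have adj': "hinner G (fst (V (a, b))) c + hinner H (snd (V (a, b))) d
      = hinner G a (fst (V' (c, d))) + hinner H b (snd (V' (c, d)))"
    if "a \<in> hcarrier G" "b \<in> hcarrier H" "c \<in> hcarrier G" "d \<in> hcarrier H" for a b c d
    using adj[of "(a, b)" "(c, d)"] that by simp
  show "coisometric (G \<oplus>\<^sub>H H \<oplus>\<^sub>H K) (\<lambda>(c, x, y). (fst (V (c, x)), snd (V (c, x)), y))"
    unfolding coisometric_def
  proof (intro conjI exI[of _ "\<lambda>(c, x, y). (fst (V' (c, x)), snd (V' (c, x)), y)"])
    show "is_adjoint (G \<oplus>\<^sub>H H \<oplus>\<^sub>H K) (G \<oplus>\<^sub>H H \<oplus>\<^sub>H K) (\<lambda>(c, x, y). (fst (V (c, x)), snd (V (c, x)), y))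
        (\<lambda>(c, x, y). (fst (V' (c, x)), snd (V' (c, x)), y))"
      unfolding is_adjoint_def using b1[OF bV'] adj' by (auto simp flip: add.assoc)
  qed (use b1[OF bV] VV' in auto)
  show "coisometric (G \<oplus>\<^sub>H K \<oplus>\<^sub>H H) (\<lambda>(c, y, x). (fst (V (c, x)), y, snd (V (c, x))))"
    unfolding coisometric_def
  proof (intro conjI exI[of _ "\<lambda>(c, y, x). (fst (V' (c, x)), y, snd (V' (c, x)))"])
    show "is_adjoint (G \<oplus>\<^sub>H K \<oplus>\<^sub>H H) (G \<oplus>\<^sub>H K \<oplus>\<^sub>H H) (\<lambda>(c, y, x). (fst (V (c, x)), y, snd (V (c, x))))
        (\<lambda>(c, y, x). (fst (V' (c, x)), y, snd (V' (c, x))))"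
      unfolding is_adjoint_def using b2[OF bV'] adj' by (auto simp: add.left_commute)
  qed (use b2[OF bV] VV' in auto)
qed

section \<open>Transfer functions through the resolvent equation\<close>

lemma coll_D_contractive:
  assumes H: "hilbert_space H" and V: "coisometric (complex_hilb \<oplus>\<^sub>H H) V"
  shows "bounded_op H H (coll_D V)"
    and "x \<in> hcarrier H \<Longrightarrow> hnorm H (coll_D V x) \<le> hnorm H x"
    and "coll_C V \<in> hcarrier H"
proof -
  interpret H: hilbert_space H by fact
  note CH = hilbert_hsum(1)[OF hilbert_complex H]
  have bV: "bounded_op (complex_hilb \<oplus>\<^sub>H H) (complex_hilb \<oplus>\<^sub>H H) V"
    using V by (simp add: coisometric_def)
  have VH: "V (c, x) \<in> UNIV \<times> hcarrier H" if "x \<in> hcarrier H" for c x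
    using bounded_opD(1)[OF bV, of "(c, x)"] that by simp
  have contr: "hnorm H (coll_D V x) \<le> hnorm H x" if x: "x \<in> hcarrier H" for x
  proof -
    have "hnorm H (snd (V (0, x))) \<le> hnorm (complex_hilb \<oplus>\<^sub>H H) (fst (V (0, x)), snd (V (0, x)))"
      using VH[OF x, of 0] by (intro hnorm_hsum hilbert_complex H) auto
    also have "\<dots> \<le> hnorm (complex_hilb \<oplus>\<^sub>H H) (0, x)"
      using coisometric_contractive[OF CH V, of "(0, x)"] x by simp
    also have "\<dots> \<le> hnorm H x"
      using hnorm_hsum(3)[OF hilbert_complex H, of 0 x] x by simp
    finally show ?thesis by (simp add: coll_D_def)
  qed
  then show "hnorm H (coll_D V x) \<le> hnorm H x" if "x \<in> hcarrier H"
    using that .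
  have VH2: "snd (V (c, x)) \<in> hcarrier H" if "x \<in> hcarrier H" for c x
    using VH[OF that, of c] by auto
  then show "coll_C V \<in> hcarrier H"
    by (simp add: coll_C_def)
  show "bounded_op H H (coll_D V)"
  proof (rule bounded_opI[where M = 1])
    show "coll_D V (x + y) = coll_D V x + coll_D V y" if "x \<in> hcarrier H" "y \<in> hcarrier H" for x y
      using bounded_opD(2)[OF bV, of "(0, x)" "(0, y)"] that by (simp add: coll_D_def)
    show "coll_D V (a *\<^sub>C x) = a *\<^sub>C coll_D V x" if "x \<in> hcarrier H" for a x
      using bounded_opD(3)[OF bV, of "(0, x)" a] that by (simp add: coll_D_def scaleC_complex_def)
  qed (use VH2 contr in \<open>auto simp: coll_D_def\<close>)
qed

text \<open>By injectivity of I - E(z) D, the inverse in \<open>transfer_fun\<close> can be replaced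
  by any exhibited solution of the resolvent equation. The contraction constant of E(z) D is the
  larger of the two coordinate moduli.\<close>

lemma transfer_fun_resolvent:
  fixes H1 :: "'h::complex_vector hilb" and H2 :: "'k::complex_vector hilb"
  assumes H1: "hilbert_space H1" and H2: "hilbert_space H2"
    and V: "coisometric (complex_hilb \<oplus>\<^sub>H H1 \<oplus>\<^sub>H H2) V" and z: "z \<in> bidisc"
  shows "\<exists>h\<in>hcarrier (H1 \<oplus>\<^sub>H H2). h - E_op z (coll_D V h) = E_op z (coll_C V)"
    and "\<lbrakk>h \<in> hcarrier (H1 \<oplus>\<^sub>H H2); h - E_op z (coll_D V h) = E_op z (coll_C V)\<rbrakk>
      \<Longrightarrow> transfer_fun H1 H2 V z = coll_a V + coll_B V h"
proof -
  interpret H1: hilbert_space H1 by fact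
  interpret H2: hilbert_space H2 by fact
  note H = hilbert_hsum(1)[OF H1 H2]
  interpret H: hilbert_space "H1 \<oplus>\<^sub>H H2" by (rule H)
  note D = coll_D_contractive[OF H V]
  define q where "q = max (cmod (fst z)) (cmod (snd z))"
  have q: "0 \<le> q" "q < 1"
    using z by (auto simp: q_def le_max_iff_disj)
  have EH: "E_op z h \<in> hcarrier (H1 \<oplus>\<^sub>H H2)" if "h \<in> hcarrier (H1 \<oplus>\<^sub>H H2)" for h
    using that by (auto simp: E_op_def)
  have E_bound: "hnorm (H1 \<oplus>\<^sub>H H2) (E_op z h) \<le> q * hnorm (H1 \<oplus>\<^sub>H H2) h"
    if h: "h \<in> hcarrier (H1 \<oplus>\<^sub>H H2)" for h
  proof (rule power2_le_imp_le)
    have "(hnorm (H1 \<oplus>\<^sub>H H2) (E_op z h))\<^sup>2 =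
        (cmod (fst z))\<^sup>2 * (hnorm H1 (fst h))\<^sup>2 + (cmod (snd z))\<^sup>2 * (hnorm H2 (snd h))\<^sup>2"
      using hilbert_hsum(2)[OF H1 H2 EH[OF h]] h by (auto simp: E_op_def power_mult_distrib)
    also have "\<dots> \<le> q\<^sup>2 * (hnorm H1 (fst h))\<^sup>2 + q\<^sup>2 * (hnorm H2 (snd h))\<^sup>2"
      by (intro add_mono mult_right_mono power_mono) (auto simp: q_def)
    also have "\<dots> = (q * hnorm (H1 \<oplus>\<^sub>H H2) h)\<^sup>2"
      by (simp add: power_mult_distrib hilbert_hsum(2)[OF H1 H2 h] distrib_left)
    finally show "(hnorm (H1 \<oplus>\<^sub>H H2) (E_op z h))\<^sup>2 \<le> (q * hnorm (H1 \<oplus>\<^sub>H H2) h)\<^sup>2" .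
  qed (use q h in simp)
  define T where "T h = E_op z (coll_D V h)" for h
  have T: "T h \<in> hcarrier (H1 \<oplus>\<^sub>H H2)" if "h \<in> hcarrier (H1 \<oplus>\<^sub>H H2)" for h
    unfolding T_def by (intro EH bounded_opD(1)[OF D(1)] that)
  have T_diff: "T (x - y) = T x - T y"
    if x: "x \<in> hcarrier (H1 \<oplus>\<^sub>H H2)" and y: "y \<in> hcarrier (H1 \<oplus>\<^sub>H H2)" for x y
  proof -
    have "- y \<in> hcarrier (H1 \<oplus>\<^sub>H H2)"
      using H.scale_mem[OF y, of "-1"] by simp
    then have "coll_D V (x - y) = coll_D V x - coll_D V y"
      by (rule bounded_op_diff[OF D(1) x y])
    then show ?thesis
      by (simp add: T_def E_op_def case_prod_unfold CV.scale_right_diff_distrib)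
  qed
  have T_bound: "hnorm (H1 \<oplus>\<^sub>H H2) (T h) \<le> q * hnorm (H1 \<oplus>\<^sub>H H2) h"
    if h: "h \<in> hcarrier (H1 \<oplus>\<^sub>H H2)" for h
    using E_bound[OF bounded_opD(1)[OF D(1) h]] mult_left_mono[OF D(2)[OF h] q(1)]
    by (simp add: T_def)
  have inj: "inj_on (\<lambda>h. h - T h) (hcarrier (H1 \<oplus>\<^sub>H H2))"
    by (rule resolvent(2)[OF H, where q = q]) (fact T T_diff q T_bound)+
  have "\<exists>h\<in>hcarrier (H1 \<oplus>\<^sub>H H2). h - T h = E_op z (coll_C V)"
    by (rule resolvent(1)[OF H, where q = q]) (fact T T_diff q T_bound EH[OF D(3)])+
  then show "\<exists>h\<in>hcarrier (H1 \<oplus>\<^sub>H H2). h - E_op z (coll_D V h) = E_op z (coll_C V)"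
    by (simp add: T_def)
  assume h: "h \<in> hcarrier (H1 \<oplus>\<^sub>H H2)" and eq: "h - E_op z (coll_D V h) = E_op z (coll_C V)"
  have "inv_into (hcarrier (H1 \<oplus>\<^sub>H H2)) (\<lambda>h. h - E_op z (coll_D V h)) (E_op z (coll_C V)) = h"
    using inv_into_f_f[OF inj h] eq by (simp add: T_def)
  then show "transfer_fun H1 H2 V z = coll_a V + coll_B V h"
    by (simp add: transfer_fun_def)
qed

lemma coll_block_op:
  fixes H1 :: "'h::complex_vector hilb" and H2 :: "'k::complex_vector hilb"
  assumes H1: "hilbert_space H1" and H2: "hilbert_space H2"
    and B1: "bounded_op H1 complex_hilb B1" and B2: "bounded_op H2 complex_hilb B2"
    and C1: "bounded_op complex_hilb H1 C1" and D1: "bounded_op H1 H1 D1"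
    and D2: "bounded_op H2 H1 D2" and C2: "bounded_op complex_hilb H2 C2"
    and D4: "bounded_op H2 H2 D4"
    and V: "V = block_op a B1 B2 C1 D1 D2 C2 (\<lambda>_. 0) D4"
  shows "coll_a V = a" "coll_B V (x, y) = B1 x + B2 y" "coll_C V = (C1 1, C2 1)"
    "coll_D V (x, y) = (D1 x + D2 y, D4 y)"
proof -
  note zero [simp] = bounded_op_zero[OF H1 B1] bounded_op_zero[OF H2 B2] bounded_op_zero[OF H1 D1]
    bounded_op_zero[OF H2 D2] bounded_op_zero[OF H2 D4]
    bounded_op_zero[OF hilbert_complex C1] bounded_op_zero[OF hilbert_complex C2]
  show "coll_a V = a" "coll_B V (x, y) = B1 x + B2 y" "coll_C V = (C1 1, C2 1)"
    "coll_D V (x, y) = (D1 x + D2 y, D4 y)"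
    by (simp_all add: coll_a_def coll_B_def coll_C_def coll_D_def V block_op_def zero_prod_def)
qed

text \<open>The second row determines y from \<open>z2\<close> alone. As
  \<open>\<phi> (0, 0) *\<^sub>C D2 y\<close> is a multiple of \<open>C1 1\<close>, the first row
  differs from the one with \<open>z2 = 0\<close> only by a scalar on its right-hand side, so x
  merely gets rescaled.\<close>

lemma product_identity_of_colligation:
  fixes H1 :: "'h::complex_vector hilb" and H2 :: "'k::complex_vector hilb"
  assumes H1: "hilbert_space H1" and H2: "hilbert_space H2"
    and fc: "factoring_colligation \<phi> H1 H2 V"
    and nz: "\<phi> (0, 0) \<noteq> 0" and z: "z \<in> bidisc"
  shows "\<phi> z * \<phi> (0, 0) = \<phi> (fst z, 0) * \<phi> (0, snd z)"
proof -
  interpret H1: hilbert_space H1 by fact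
  interpret H2: hilbert_space H2 by fact
  obtain B1 B2 C1 D1 D2 C2 D4 where
    B1: "bounded_op H1 complex_hilb B1" and B2: "bounded_op H2 complex_hilb B2"
    and C1: "bounded_op complex_hilb H1 C1" and D1: "bounded_op H1 H1 D1"
    and D2: "bounded_op H2 H1 D2" and C2: "bounded_op complex_hilb H2 C2"
    and D4: "bounded_op H2 H2 D4"
    and V_def: "V = block_op (\<phi> (0, 0)) B1 B2 C1 D1 D2 C2 (\<lambda>_. 0) D4"
    and V: "coisometric (complex_hilb \<oplus>\<^sub>H H1 \<oplus>\<^sub>H H2) V"
    and tf: "\<And>z. z \<in> bidisc \<Longrightarrow> \<phi> z = transfer_fun H1 H2 V z"
    and fact: "\<And>y. y \<in> hcarrier H2 \<Longrightarrow> \<phi> (0, 0) *\<^sub>C D2 y = C1 (B2 y)"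
    using fc unfolding factoring_colligation_def by blast
  note coll = coll_block_op[OF H1 H2 B1 B2 C1 D1 D2 C2 D4 V_def]
  note [simp] = bounded_op_zero[OF H1 B1] bounded_op_zero[OF H2 B2] bounded_op_zero[OF H2 D2]
  have solve: "\<exists>x\<in>hcarrier H1. \<exists>y\<in>hcarrier H2. x - s *\<^sub>C (D1 x + D2 y) = s *\<^sub>C C1 1 \<and>
      y - t *\<^sub>C D4 y = t *\<^sub>C C2 1 \<and> \<phi> (s, t) = \<phi> (0, 0) + B1 x + B2 y"
    if st: "(s, t) \<in> bidisc" for s t
  proof -
    obtain x y where *: "(x, y) \<in> hcarrier (H1 \<oplus>\<^sub>H H2)"
      "(x, y) - E_op (s, t) (coll_D V (x, y)) = E_op (s, t) (coll_C V)"
      using transfer_fun_resolvent(1)[OF H1 H2 V st] by (metis surj_pair)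
    have "\<phi> (s, t) = \<phi> (0, 0) + B1 x + B2 y"
      using transfer_fun_resolvent(2)[OF H1 H2 V st *] tf[OF st] by (simp add: coll)
    moreover have "x - s *\<^sub>C (D1 x + D2 y) = s *\<^sub>C C1 1" "y - t *\<^sub>C D4 y = t *\<^sub>C C2 1"
      using *(2) by (simp_all add: coll E_op_def)
    ultimately show ?thesis
      using *(1) by auto
  qed
  obtain z1 z2 where zz: "z = (z1, z2)" "z1 \<in> disc" "z2 \<in> disc"
    using z by auto
  \<comment> \<open>For second coordinate 0 the second row forces \<open>y = 0\<close>, so neither
    \<open>D2\<close> nor \<open>B2\<close> contributes.\<close>
  obtain x where x: "x \<in> hcarrier H1" "x - z1 *\<^sub>C D1 x = z1 *\<^sub>C C1 1"
    and \<phi>x: "\<phi> (z1, 0) = \<phi> (0, 0) + B1 x"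
    using solve[of z1 0] zz by auto
  obtain y where y: "y \<in> hcarrier H2" "y - z2 *\<^sub>C D4 y = z2 *\<^sub>C C2 1"
    and \<phi>y: "\<phi> (0, z2) = \<phi> (0, 0) + B2 y"
    using solve[of 0 z2] zz by auto
  \<comment> \<open>This is \<open>\<phi> (0, z2) / \<phi> (0, 0)\<close>, the factor by which the
    state in \<open>H1\<close> grows when \<open>z2\<close> is switched on.\<close>
  define \<beta> where "\<beta> = 1 + B2 y / \<phi> (0, 0)"
  have C1_scale: "C1 s = s *\<^sub>C C1 1" for s
    using bounded_opD(3)[OF C1, of 1 s] by (simp add: scaleC_complex_def)
  have "D2 y = (1 / \<phi> (0, 0)) *\<^sub>C (\<phi> (0, 0) *\<^sub>C D2 y)"
    using nz by simp
  also have "\<dots> = (\<beta> - 1) *\<^sub>C C1 1"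
    unfolding fact[OF y(1)] C1_scale[of "B2 y"] by (simp add: \<beta>_def)
  finally have D2y: "D2 y = (\<beta> - 1) *\<^sub>C C1 1" .
  have "\<beta> *\<^sub>C x - z1 *\<^sub>C (D1 (\<beta> *\<^sub>C x) + D2 y)
      = \<beta> *\<^sub>C (x - z1 *\<^sub>C D1 x) - (z1 * (\<beta> - 1)) *\<^sub>C C1 1"
    using bounded_opD(3)[OF D1 x(1)]
    by (simp add: D2y CV.scale_right_distrib CV.scale_right_diff_distrib mult.commute)
  also have "\<dots> = (\<beta> * z1 - z1 * (\<beta> - 1)) *\<^sub>C C1 1"
    by (simp add: x(2) CV.scale_left_diff_distrib)
  also have "\<beta> * z1 - z1 * (\<beta> - 1) = z1"
    by (simp add: algebra_simps)
  finally have "(\<beta> *\<^sub>C x, y) - E_op z (coll_D V (\<beta> *\<^sub>C x, y)) = E_op z (coll_C V)"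
    using y(2) by (simp add: coll E_op_def zz(1))
  then have "\<phi> z = \<phi> (0, 0) + coll_B V (\<beta> *\<^sub>C x, y)"
    using transfer_fun_resolvent(2)[OF H1 H2 V z, of "(\<beta> *\<^sub>C x, y)"] x(1) y(1) tf[OF z] by (simp add: coll)
  then have "\<phi> z = \<phi> (0, 0) + \<beta> * B1 x + B2 y"
    using bounded_opD(3)[OF B1 x(1)] by (simp add: coll scaleC_complex_def)
  then show ?thesis
    using nz by (simp add: zz \<phi>x \<phi>y \<beta>_def field_simps)
qed

section \<open>Factorization\<close>

text \<open>The de Branges--Rovnyak model of \<open>\<psi>\<close>, on the bidisc so that its functions depend on the first
  variable only. \<open>V\<close> is the adjoint of the isometry
  \<open>(1, cnj w1 *\<^sub>C K(\<cdot>, w)) \<mapsto> (cnj (\<psi> w1), K(\<cdot>, w))\<close>.\<close>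

lemma coisometric_realization:
  assumes \<psi>: "schur_disc \<psi>"
  obtains H :: "(complex \<times> complex \<Rightarrow> complex) hilb" and V where
    "hilbert_space H" "coisometric (complex_hilb \<oplus>\<^sub>H H) V" "coll_a V = \<psi> 0"
    "\<And>z. z \<in> disc \<Longrightarrow> \<exists>x\<in>hcarrier H. x - z *\<^sub>C coll_D V x = z *\<^sub>C coll_C V \<and> \<psi> z = \<psi> 0 + coll_B V x"
proof -
  define K where "K = (\<lambda>(z :: complex \<times> complex) (w :: complex \<times> complex). pick \<psi> (fst z) (fst w))"
  have "is_kernel K"
    using is_kernel_pick[OF \<psi>, of fst "\<lambda>_. 1"] by (auto simp: K_def)
  then obtain H where "is_rkhs K H"
    by (rule ex_rkhs)
  then have H: "hilbert_space H"
    and k_mem: "\<And>w. w \<in> bidisc \<Longrightarrow> kernel_section K w \<in> hcarrier H"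
    and rep: "\<And>f w. \<lbrakk>f \<in> hcarrier H; w \<in> bidisc\<rbrakk> \<Longrightarrow> hinner H f (kernel_section K w) = f w"
    and outside: "\<And>f z. \<lbrakk>f \<in> hcarrier H; z \<notin> bidisc\<rbrakk> \<Longrightarrow> f z = 0"
    unfolding is_rkhs_def by blast+
  interpret hilbert_space H by fact
  define k where "k = kernel_section K"
  have k [simp]: "k w \<in> hcarrier H" if "w \<in> bidisc" for w
    using k_mem that by (simp add: k_def)
  have rep [simp]: "hinner H f (k w) = f w" if "f \<in> hcarrier H" "w \<in> bidisc" for f w
    using rep that by (simp add: k_def)
  have kk [simp]: "k w z = pick \<psi> (fst z) (fst w)" if "z \<in> bidisc" for w z
    using that by (auto simp: k_def kernel_section_def K_def)
  define u where "u w = (1 :: complex, cnj (fst w) *\<^sub>C k w)" for w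
  define v where "v w = (cnj (\<psi> (fst w)), k w)" for w
  have "\<exists>V. coisometric (complex_hilb \<oplus>\<^sub>H H) V \<and> (\<forall>x w. x \<in> hcarrier (complex_hilb \<oplus>\<^sub>H H) \<longrightarrow> w \<in> bidisc \<longrightarrow>
      hinner (complex_hilb \<oplus>\<^sub>H H) (V x) (u w) = hinner (complex_hilb \<oplus>\<^sub>H H) x (v w))"
  proof (rule lurking_isometry[of "complex_hilb \<oplus>\<^sub>H H" bidisc u v])
    show "hilbert_space (complex_hilb \<oplus>\<^sub>H H)"
      by (intro hilbert_hsum(1) hilbert_complex H)
    show "u w \<in> hcarrier (complex_hilb \<oplus>\<^sub>H H)" if "w \<in> bidisc" for w
      using that k[OF that] scale_mem by (simp add: u_def)
    show "v w \<in> hcarrier (complex_hilb \<oplus>\<^sub>H H)" if "w \<in> bidisc" for w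
      using k[OF that] by (simp add: v_def)
    show "hinner (complex_hilb \<oplus>\<^sub>H H) (u w) (u w') = hinner (complex_hilb \<oplus>\<^sub>H H) (v w) (v w')"
      if w: "w \<in> bidisc" "w' \<in> bidisc" for w w'
    proof -
      have "(1 - fst w' * cnj (fst w)) * pick \<psi> (fst w') (fst w) = 1 - \<psi> (fst w') * cnj (\<psi> (fst w))"
        using one_minus_cnj_neq_0[of "fst w'" "fst w"] w by (auto simp: pick_def)
      then show ?thesis
        using k[OF w(1)] k[OF w(2)] w
        by (simp add: u_def v_def expand kk[OF w(2)] rep[OF k[OF w(1)] w(2)] algebra_simps)
    qed
    fix p assume p: "p \<in> hcarrier (complex_hilb \<oplus>\<^sub>H H)"
      and orth: "\<And>w. w \<in> bidisc \<Longrightarrow> hinner (complex_hilb \<oplus>\<^sub>H H) p (u w) = 0"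
    obtain a g where ag: "p = (a, g)" and g: "g \<in> hcarrier H"
      using p by auto
    have *: "a + fst w * g w = 0" if "w \<in> bidisc" for w
      using orth[OF that] k[OF that] rep[OF g that] g by (simp add: ag u_def scale_right)
    have "a = 0"
      using *[of "(0, 0)"] by simp
    then have g_off: "g w = 0" if "w \<in> bidisc" "fst w \<noteq> 0" for w
      using *[OF that(1)] that(2) by simp
    \<comment> \<open>Orthogonality says that \<open>fst w * g w\<close> vanishes, which is silent
      on the axis \<open>fst w = 0\<close>. Continuity of \<psi> makes the kernel functions at
      \<open>(t n, s)\<close> converge in norm to the one at \<open>(0, s)\<close>, so zeros off the
      axis propagate onto it.\<close>
    have g_0: "g (0, s) = 0" if s: "s \<in> disc" for s
    proof -
      define t where "t n = complex_of_real (inverse (real (Suc (Suc n))))" for n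
      have "t \<longlonglongrightarrow> of_real 0"
        unfolding t_def[abs_def]
        by (intro tendsto_of_real LIMSEQ_Suc[OF LIMSEQ_inverse_real_of_nat])
      then have t_lim: "t \<longlonglongrightarrow> 0"
        by (simp only: of_real_0)
      have t: "t n \<in> disc" "t n \<noteq> 0" for n
        by (simp_all add: t_def norm_inverse inverse_less_1_iff del: of_nat_Suc)
      have "isCont \<psi> 0"
        using \<psi> holomorphic_on_imp_continuous_on continuous_on_eq_continuous_at[OF open_ball]
        unfolding schur_disc_def by (metis centre_in_ball zero_less_one)
      then have \<psi>_lim: "(\<lambda>n. \<psi> (t n)) \<longlonglongrightarrow> \<psi> 0"
        using t_lim by (rule isCont_tendsto_compose)
      have mem: "(0, s) \<in> bidisc" "(t n, s) \<in> bidisc" for n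
        using s t by auto
      define e where "e n = k (0, s) - k (t n, s)" for n
      have e [simp]: "e n \<in> hcarrier H" for n
        using k[OF mem(1)] k[OF mem(2)] by (simp add: e_def)
      have "(hnorm H (e n))\<^sup>2 = Re (pick \<psi> 0 0) - 2 * Re (pick \<psi> (t n) 0) + Re (pick \<psi> (t n) (t n))" for n
        unfolding e_def hnorm_diff_sq[OF k[OF mem(1)] k[OF mem(2)]]
        using k[OF mem(1)] k[OF mem(2), of n] mem
        by (simp add: Re_inner_self[symmetric] kk[OF mem(1)] kk[OF mem(2)])
      then have "hnorm H (e n) = sqrt (Re (pick \<psi> 0 0) - 2 * Re (pick \<psi> (t n) 0) + Re (pick \<psi> (t n) (t n)))" for n
        by (metis e hnorm_nonneg real_sqrt_unique)
      moreover have "(\<lambda>n. sqrt (Re (pick \<psi> 0 0) - 2 * Re (pick \<psi> (t n) 0) + Re (pick \<psi> (t n) (t n))))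
          \<longlonglongrightarrow> sqrt (Re (pick \<psi> 0 0) - 2 * Re (pick \<psi> 0 0) + Re (pick \<psi> 0 0))"
        unfolding pick_def by (intro tendsto_intros \<psi>_lim t_lim) auto
      ultimately have "(\<lambda>n. hnorm H g * hnorm H (e n)) \<longlonglongrightarrow> 0"
        by (intro tendsto_mult_right_zero) simp
      moreover have "cmod (g (0, s)) \<le> hnorm H g * hnorm H (e n)" for n
      proof -
        have "g (0, s) = hinner H g (e n)"
          unfolding e_def using k[OF mem(1)] k[OF mem(2), of n] rep[OF g mem(1)] rep[OF g mem(2), of n]
            g_off[OF mem(2), of n] t(2)[of n] g
          by (simp add: diff_right)
        then show ?thesis
          using cauchy_schwarz[OF g e] by simp
      qed
      ultimately have "cmod (g (0, s)) \<le> 0"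
        by (intro LIMSEQ_le_const) auto
      then show ?thesis by simp
    qed
    have "g w = 0" for w
      using g_off[of w] g_0[of "snd w"] outside[OF g, of w] by (cases w) fastforce
    then show "p = 0"
      using \<open>a = 0\<close> by (simp add: ag zero_prod_def fun_eq_iff)
  qed blast
  then obtain V where V: "coisometric (complex_hilb \<oplus>\<^sub>H H) V"
    and Vu: "\<And>x w. \<lbrakk>x \<in> hcarrier (complex_hilb \<oplus>\<^sub>H H); w \<in> bidisc\<rbrakk> \<Longrightarrow>
      hinner (complex_hilb \<oplus>\<^sub>H H) (V x) (u w) = hinner (complex_hilb \<oplus>\<^sub>H H) x (v w)"
    by blast
  have V_mem: "snd (V (c, f)) \<in> hcarrier H" if "f \<in> hcarrier H" for c f
    using V bounded_opD(1)[of "complex_hilb \<oplus>\<^sub>H H" "complex_hilb \<oplus>\<^sub>H H" V "(c, f)"] that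
    by (auto simp: coisometric_def)
  \<comment> \<open>This determines the model: B evaluates at first coordinate 0, D is the backward
    shift in that coordinate, and C 1 is the difference quotient of \<psi> at 0.\<close>
  have V_eq: "fst (V (c, f)) + fst w * snd (V (c, f)) w = c * \<psi> (fst w) + f w"
    if f: "f \<in> hcarrier H" and w: "w \<in> bidisc" for c f w
    using Vu[of "(c, f)" w] f w V_mem[OF f, of c] k[OF w]
    by (simp add: u_def v_def scale_right rep[OF _ w])
  have "coll_a V = \<psi> 0"
    using V_eq[of 0 "(0, 0)" 1] by (simp add: coll_a_def)
  moreover have "\<exists>x\<in>hcarrier H. x - z *\<^sub>C coll_D V x = z *\<^sub>C coll_C V \<and> \<psi> z = \<psi> 0 + coll_B V x"
    if z: "z \<in> disc" for z
  proof -
    note D = coll_D_contractive[OF H V]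
    have "\<exists>x\<in>hcarrier H. x - z *\<^sub>C coll_D V x = z *\<^sub>C coll_C V"
    proof (rule resolvent(1)[OF H, where q = "cmod z"])
      show "z *\<^sub>C coll_D V (x - y) = z *\<^sub>C coll_D V x - z *\<^sub>C coll_D V y"
        if "x \<in> hcarrier H" "y \<in> hcarrier H" for x y
        using bounded_op_diff[OF D(1) that] scale_mem[OF that(2), of "-1"]
        by (simp add: CV.scale_right_diff_distrib)
    qed (use z in \<open>auto simp: bounded_opD(1)[OF D(1)] D(3) intro: mult_left_mono D(2,3)\<close>)
    then obtain x where x: "x \<in> hcarrier H" and eq: "x - z *\<^sub>C coll_D V x = z *\<^sub>C coll_C V" by blast
    have z0: "(z, 0) \<in> bidisc" "(0, 0) \<in> bidisc"
      using z by auto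
    have "x (z, 0) - z * coll_D V x (z, 0) = z * coll_C V (z, 0)"
      using fun_cong[OF eq, of "(z, 0)"] by simp
    \<comment> \<open>Evaluated at the point \<open>(z, 0)\<close> itself, the resolvent equation
      equates \<open>coll_B V x\<close> with \<open>z * coll_C V (z, 0)\<close>, that is, with
      \<open>\<psi> z - \<psi> 0\<close>.\<close>
    moreover have "coll_B V x + z * coll_D V x (z, 0) = x (z, 0)"
      using V_eq[OF x z0(1), of 0] by (simp add: coll_B_def coll_D_def)
    moreover have "\<psi> 0 + z * coll_C V (z, 0) = \<psi> z"
      using V_eq[OF zero_mem z0(1), of 1] \<open>coll_a V = \<psi> 0\<close> by (simp add: coll_a_def coll_C_def)
    ultimately have "\<psi> z = \<psi> 0 + coll_B V x"
      by algebra
    with x eq show ?thesis by blast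
  qed
  ultimately show ?thesis
    using that[OF H V] by blast
qed

text \<open>The colligation is the product of the amplified colligations of the two factors.\<close>

lemma factoring_colligation_of_product:
  assumes \<phi>1: "schur_disc \<phi>1" and \<phi>2: "schur_disc \<phi>2"
    and \<phi>: "\<And>z1 z2. \<lbrakk>z1 \<in> disc; z2 \<in> disc\<rbrakk> \<Longrightarrow> \<phi> (z1, z2) = \<phi>1 z1 * \<phi>2 z2"
  obtains H1 H2 :: "(complex \<times> complex \<Rightarrow> complex) hilb" and V
  where "hilbert_space H1" "hilbert_space H2" "factoring_colligation \<phi> H1 H2 V"
proof -
  obtain H1 :: "(complex \<times> complex \<Rightarrow> complex) hilb" and V1 where
    H1: "hilbert_space H1" and V1: "coisometric (complex_hilb \<oplus>\<^sub>H H1) V1" and a1: "coll_a V1 = \<phi>1 0"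
    and res1: "\<And>z. z \<in> disc \<Longrightarrow> \<exists>x\<in>hcarrier H1. x - z *\<^sub>C coll_D V1 x = z *\<^sub>C coll_C V1 \<and>
      \<phi>1 z = \<phi>1 0 + coll_B V1 x"
    using coisometric_realization[OF \<phi>1] by blast
  obtain H2 :: "(complex \<times> complex \<Rightarrow> complex) hilb" and V2 where
    H2: "hilbert_space H2" and V2: "coisometric (complex_hilb \<oplus>\<^sub>H H2) V2" and a2: "coll_a V2 = \<phi>2 0"
    and res2: "\<And>z. z \<in> disc \<Longrightarrow> \<exists>x\<in>hcarrier H2. x - z *\<^sub>C coll_D V2 x = z *\<^sub>C coll_C V2 \<and>
      \<phi>2 z = \<phi>2 0 + coll_B V2 x"
    using coisometric_realization[OF \<phi>2] by blast
  interpret H1: hilbert_space H1 by fact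
  interpret H2: hilbert_space H2 by fact
  have bV: "bounded_op (complex_hilb \<oplus>\<^sub>H H1) (complex_hilb \<oplus>\<^sub>H H1) V1"
    "bounded_op (complex_hilb \<oplus>\<^sub>H H2) (complex_hilb \<oplus>\<^sub>H H2) V2"
    using V1 V2 by (simp_all add: coisometric_def)
  have B: "bounded_op H complex_hilb (coll_B V)"
    if "hilbert_space H" "bounded_op (complex_hilb \<oplus>\<^sub>H H) (complex_hilb \<oplus>\<^sub>H H) V"
    for H :: "(complex \<times> complex \<Rightarrow> complex) hilb" and V
  proof -
    note CH = hilbert_hsum(1)[OF hilbert_complex that(1)]
    have "bounded_op H (complex_hilb \<oplus>\<^sub>H H) (\<lambda>x. (0, x))"
      by (rule bounded_opI[where M = 1])
        (use hnorm_hsum(3)[OF hilbert_complex that(1), of 0] in \<open>auto simp: scaleC_complex_def\<close>)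
    from bounded_op_comp[OF that(1) CH bounded_op_comp[OF that(1) CH this that(2)]
        bounded_op_fst[OF hilbert_complex that(1)]]
    show ?thesis by (simp add: coll_B_def[abs_def])
  qed
  have C: "bounded_op complex_hilb H (\<lambda>c. c *\<^sub>C coll_C V)"
    if "hilbert_space H" "coisometric (complex_hilb \<oplus>\<^sub>H H) V"
    for H :: "(complex \<times> complex \<Rightarrow> complex) hilb" and V
  proof -
    interpret hilbert_space H by fact
    show ?thesis
      by (rule bounded_opI[where M = "hnorm H (coll_C V)"])
        (use coll_D_contractive(3)[OF that] in
          \<open>auto simp: CV.scale_left_distrib scaleC_complex_def mult.commute\<close>)
  qed
  note B1 = B[OF H1 bV(1)] and B2 = B[OF H2 bV(2)]
  note C1 = C[OF H1 V1] and C2 = C[OF H2 V2]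
  note D1 = coll_D_contractive[OF H1 V1] and D2 = coll_D_contractive[OF H2 V2]
  have split: "V (c, x) = (c * coll_a V + coll_B V x, c *\<^sub>C coll_C V + coll_D V x)"
    if V: "bounded_op (complex_hilb \<oplus>\<^sub>H H) (complex_hilb \<oplus>\<^sub>H H) V" and H: "hilbert_space H"
      and x: "x \<in> hcarrier H"
    for H :: "(complex \<times> complex \<Rightarrow> complex) hilb" and V c x
  proof -
    interpret hilbert_space H by fact
    have "V (c, x) = V (c *\<^sub>C (1, 0) + (0, x))"
      by (simp add: scaleC_complex_def)
    also have "\<dots> = c *\<^sub>C V (1, 0) + V (0, x)"
      using bounded_opD(2)[OF V, of "c *\<^sub>C (1, 0)" "(0, x)"] bounded_opD(3)[OF V, of "(1, 0)" c] x
      by simp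
    finally show ?thesis
      by (simp add: prod_eq_iff coll_a_def coll_B_def coll_C_def coll_D_def scaleC_complex_def)
  qed
  have \<phi>0: "\<phi> (0, 0) = \<phi>1 0 * \<phi>2 0"
    by (simp add: \<phi>)
  \<comment> \<open>The primed blocks arise when \<open>V2\<close> acts on the scalar and
    \<open>H2\<close>, and its scalar output is fed into \<open>V1\<close>. The output of
    \<open>V1\<close> never enters \<open>H2\<close>, which accounts for the zero block.\<close>
  define B2' where "B2' y = \<phi>1 0 * coll_B V2 y" for y
  define C1' where "C1' c = (c * \<phi>2 0) *\<^sub>C coll_C V1" for c
  define D2' where "D2' y = coll_B V2 y *\<^sub>C coll_C V1" for y
  define V where "V = block_op (\<phi> (0, 0)) (coll_B V1) B2' C1' (coll_D V1) D2'
    (\<lambda>c. c *\<^sub>C coll_C V2) (\<lambda>_. 0) (coll_D V2)"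
  have coV: "coisometric (complex_hilb \<oplus>\<^sub>H H1 \<oplus>\<^sub>H H2) V"
  proof (rule coisometric_comp)
    show "hilbert_space (complex_hilb \<oplus>\<^sub>H H1 \<oplus>\<^sub>H H2)"
      by (intro hilbert_hsum(1) hilbert_complex H1 H2)
    show "coisometric (complex_hilb \<oplus>\<^sub>H H1 \<oplus>\<^sub>H H2) (\<lambda>(c, x, y). (fst (V1 (c, x)), snd (V1 (c, x)), y))"
      by (rule coisometric_amplification(1)[OF hilbert_complex H1 H2 V1])
    show "coisometric (complex_hilb \<oplus>\<^sub>H H1 \<oplus>\<^sub>H H2) (\<lambda>(c, x, y). (fst (V2 (c, y)), x, snd (V2 (c, y))))"
      by (rule coisometric_amplification(2)[OF hilbert_complex H2 H1 V2])
    show "V p = (case case p of (c, x, y) \<Rightarrow> (fst (V2 (c, y)), x, snd (V2 (c, y))) of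
        (c, x, y) \<Rightarrow> (fst (V1 (c, x)), snd (V1 (c, x)), y))"
      if "p \<in> hcarrier (complex_hilb \<oplus>\<^sub>H H1 \<oplus>\<^sub>H H2)" for p
      using that
      by (auto simp: V_def block_op_def split[OF bV(1) H1] split[OF bV(2) H2] a1 a2 \<phi>0 B2'_def C1'_def
          D2'_def algebra_simps CV.scale_left_distrib)
  qed
  have B2': "bounded_op H2 complex_hilb B2'"
    unfolding B2'_def[abs_def] by (rule bounded_op_comp[OF H2 hilbert_complex B2 bounded_op_mult])
  have C1': "bounded_op complex_hilb H1 C1'"
    using bounded_op_comp[OF hilbert_complex hilbert_complex bounded_op_mult[of "\<phi>2 0"] C1]
    by (simp add: C1'_def[abs_def] mult.commute)
  have D2': "bounded_op H2 H1 D2'"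
    unfolding D2'_def[abs_def] by (rule bounded_op_comp[OF H2 hilbert_complex B2 C1])
  note coll = coll_block_op[OF H1 H2 B1 B2' C1' D1(1) D2' C2 D2(1) V_def]
  have "\<phi> z = transfer_fun H1 H2 V z" if z: "z \<in> bidisc" for z
  proof -
    obtain z1 z2 where zz: "z = (z1, z2)" "z1 \<in> disc" "z2 \<in> disc"
      using z by auto
    obtain x where x: "x \<in> hcarrier H1" "x - z1 *\<^sub>C coll_D V1 x = z1 *\<^sub>C coll_C V1"
      and \<phi>x: "\<phi>1 z1 = \<phi>1 0 + coll_B V1 x"
      using res1[OF zz(2)] by blast
    obtain y where y: "y \<in> hcarrier H2" "y - z2 *\<^sub>C coll_D V2 y = z2 *\<^sub>C coll_C V2"
      and \<phi>y: "\<phi>2 z2 = \<phi>2 0 + coll_B V2 y"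
      using res2[OF zz(3)] by blast
    \<comment> \<open>The scalar reaching \<open>V1\<close> is
      \<open>\<phi>2 0 + coll_B V2 y\<close>, the value of the second factor, so the state of
      \<open>V1\<close> is scaled by it.\<close>
    define \<beta> where "\<beta> = \<phi>2 z2"
    have "\<beta> *\<^sub>C x - z1 *\<^sub>C (coll_D V1 (\<beta> *\<^sub>C x) + D2' y)
        = \<beta> *\<^sub>C (x - z1 *\<^sub>C coll_D V1 x) - (z1 * coll_B V2 y) *\<^sub>C coll_C V1"
      using bounded_opD(3)[OF D1(1) x(1)]
      by (simp add: D2'_def CV.scale_right_distrib CV.scale_right_diff_distrib mult.commute)
    also have "\<dots> = (\<beta> * z1 - z1 * coll_B V2 y) *\<^sub>C coll_C V1"
      by (simp add: x(2) CV.scale_left_diff_distrib)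
    also have "\<beta> * z1 - z1 * coll_B V2 y = z1 * \<phi>2 0"
      by (simp add: \<beta>_def \<phi>y algebra_simps)
    finally have eq: "\<beta> *\<^sub>C x - z1 *\<^sub>C (coll_D V1 (\<beta> *\<^sub>C x) + D2' y) = (z1 * \<phi>2 0) *\<^sub>C coll_C V1" .
    have "(\<beta> *\<^sub>C x, y) - E_op z (coll_D V (\<beta> *\<^sub>C x, y))
        = (\<beta> *\<^sub>C x - z1 *\<^sub>C (coll_D V1 (\<beta> *\<^sub>C x) + D2' y), y - z2 *\<^sub>C coll_D V2 y)"
      by (simp add: coll E_op_def zz(1))
    also have "\<dots> = E_op z (coll_C V)"
      unfolding eq y(2) by (simp add: coll E_op_def zz(1) C1'_def)
    finally have "transfer_fun H1 H2 V z = \<phi> (0, 0) + coll_B V (\<beta> *\<^sub>C x, y)"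
      using transfer_fun_resolvent(2)[OF H1 H2 coV z, of "(\<beta> *\<^sub>C x, y)"] x(1) y(1) by (simp add: coll)
    also have "\<dots> = \<phi>1 0 * \<phi>2 0 + \<beta> * coll_B V1 x + \<phi>1 0 * coll_B V2 y"
      using bounded_opD(3)[OF B1 x(1)] by (simp add: coll \<phi>0 scaleC_complex_def B2'_def)
    also have "\<dots> = \<phi> z"
      unfolding zz(1) \<phi>[OF zz(2,3)] by (simp add: \<beta>_def \<phi>x \<phi>y algebra_simps)
    finally show ?thesis ..
  qed
  moreover have "\<phi> (0, 0) *\<^sub>C D2' y = C1' (B2' y)" for y
    by (simp add: \<phi>0 B2'_def C1'_def D2'_def mult_ac)
  ultimately have "factoring_colligation \<phi> H1 H2 V"
    unfolding factoring_colligation_def using B1 B2' C1' D1(1) D2' C2 D2(1) V_def coV by blast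
  then show ?thesis
    by (rule that[OF H1 H2])
qed

theorem theorem4p1:
  fixes \<phi> :: "complex \<times> complex \<Rightarrow> complex"
  assumes "schur_bidisc \<phi>" and "\<phi> (0, 0) \<noteq> 0"
  shows "
    ((\<exists>\<phi>1 \<phi>2. schur_disc \<phi>1 \<and> schur_disc \<phi>2 \<and>
        (\<forall>z1\<in>disc. \<forall>z2\<in>disc. \<phi> (z1, z2) = \<phi>1 z1 * \<phi>2 z2))
     \<longleftrightarrow>
     (\<exists>K1 K2. agler_kernels \<phi> K1 K2 \<and>
        (\<exists>k. \<forall>z\<in>bidisc. \<forall>w\<in>bidisc. K1 z w = k (fst z) (cnj (fst w))) \<and>
        (\<forall>w1\<in>disc. \<forall>z\<in>bidisc.
           cnj (\<phi> (0, 0)) * K2 z (w1, 0) = cnj (\<phi> (w1, 0)) * K2 z (0, 0))))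
    \<and>
    ((\<exists>K1 K2. agler_kernels \<phi> K1 K2 \<and>
        (\<exists>k. \<forall>z\<in>bidisc. \<forall>w\<in>bidisc. K1 z w = k (fst z) (cnj (fst w))) \<and>
        (\<forall>w1\<in>disc. \<forall>z\<in>bidisc.
           cnj (\<phi> (0, 0)) * K2 z (w1, 0) = cnj (\<phi> (w1, 0)) * K2 z (0, 0)))
     \<longleftrightarrow>
     (\<exists>L1 L2 HL1 HL2. agler_kernels \<phi> L1 L2 \<and> is_rkhs L1 HL1 \<and> is_rkhs L2 HL2 \<and>
        (\<forall>f\<in>hcarrier HL1. \<exists>g. \<forall>z\<in>bidisc. f z = g (fst z)) \<and>
        (\<forall>f\<in>hcarrier HL2. \<forall>z1\<in>disc. \<phi> (0, 0) * f (z1, 0) = \<phi> (z1, 0) * f (0, 0))))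
    \<and>
    ((\<exists>L1 L2 HL1 HL2. agler_kernels \<phi> L1 L2 \<and> is_rkhs L1 HL1 \<and> is_rkhs L2 HL2 \<and>
        (\<forall>f\<in>hcarrier HL1. \<exists>g. \<forall>z\<in>bidisc. f z = g (fst z)) \<and>
        (\<forall>f\<in>hcarrier HL2. \<forall>z1\<in>disc. \<phi> (0, 0) * f (z1, 0) = \<phi> (z1, 0) * f (0, 0)))
     \<longleftrightarrow>
     (\<exists>(H1 :: (complex \<times> complex \<Rightarrow> complex) hilb) (H2 :: (complex \<times> complex \<Rightarrow> complex) hilb) V.
        hilbert_space H1 \<and> hilbert_space H2 \<and> factoring_colligation \<phi> H1 H2 V))
    \<and>
    ((\<exists>(H1 :: 'h::complex_vector hilb) (H2 :: 'k::complex_vector hilb) V.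
        hilbert_space H1 \<and> hilbert_space H2 \<and> factoring_colligation \<phi> H1 H2 V)
     \<longrightarrow>
     (\<exists>(H1 :: (complex \<times> complex \<Rightarrow> complex) hilb) (H2 :: (complex \<times> complex \<Rightarrow> complex) hilb) V.
        hilbert_space H1 \<and> hilbert_space H2 \<and> factoring_colligation \<phi> H1 H2 V))"
  (is "(?P1 \<longleftrightarrow> ?P2) \<and> (?P2 \<longleftrightarrow> ?P3) \<and> (?P3 \<longleftrightarrow> ?P4) \<and> (?P4' \<longrightarrow> ?P4)")
proof -
  have 1: ?P1 if prod: "\<And>z. z \<in> bidisc \<Longrightarrow> \<phi> z * \<phi> (0, 0) = \<phi> (fst z, 0) * \<phi> (0, snd z)"
    using schur_factorization[OF assms prod] by metis
  have 12: ?P2 if ?P1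
  proof -
    obtain \<phi>1 \<phi>2 where f: "schur_disc \<phi>1" "schur_disc \<phi>2"
      and prod: "\<And>z1 z2. \<lbrakk>z1 \<in> disc; z2 \<in> disc\<rbrakk> \<Longrightarrow> \<phi> (z1, z2) = \<phi>1 z1 * \<phi>2 z2"
      using \<open>?P1\<close> by blast
    let ?K1 = "\<lambda>z w. pick \<phi>1 (fst z) (fst w)"
    let ?K2 = "\<lambda>z w. \<phi>1 (fst z) * cnj (\<phi>1 (fst w)) * pick \<phi>2 (snd z) (snd w)"
    have "agler_kernels \<phi> ?K1 ?K2"
      by (rule agler_kernels_of_product(1)[OF f prod])
    moreover have "\<exists>k. \<forall>z\<in>bidisc. \<forall>w\<in>bidisc. ?K1 z w = k (fst z) (cnj (fst w))"
      by (rule exI[of _ "\<lambda>s t. pick \<phi>1 s (cnj t)"]) simp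
    moreover have "\<forall>w1\<in>disc. \<forall>z\<in>bidisc.
        cnj (\<phi> (0, 0)) * ?K2 z (w1, 0) = cnj (\<phi> (w1, 0)) * ?K2 z (0, 0)"
      by (intro ballI agler_kernels_of_product(2)[OF f prod])
    ultimately show ?thesis by blast
  qed
  have 21: ?P1 if ?P2
  proof -
    obtain K1 K2 k where "agler_kernels \<phi> K1 K2"
      and "\<And>z w. \<lbrakk>z \<in> bidisc; w \<in> bidisc\<rbrakk> \<Longrightarrow> K1 z w = k (fst z) (cnj (fst w))"
      and "\<And>w1 z. \<lbrakk>w1 \<in> disc; z \<in> bidisc\<rbrakk>
        \<Longrightarrow> cnj (\<phi> (0, 0)) * K2 z (w1, 0) = cnj (\<phi> (w1, 0)) * K2 z (0, 0)"
      using \<open>?P2\<close> by blast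
    from product_identity_of_kernels[OF this assms(2)] show ?thesis
      by (rule 1)
  qed
  have 23: ?P3 if ?P2
  proof -
    obtain K1 K2 k where ak: "agler_kernels \<phi> K1 K2"
      and "\<And>z w. \<lbrakk>z \<in> bidisc; w \<in> bidisc\<rbrakk> \<Longrightarrow> K1 z w = k (fst z) (cnj (fst w))"
      and "\<And>w1 z. \<lbrakk>w1 \<in> disc; z \<in> bidisc\<rbrakk>
        \<Longrightarrow> cnj (\<phi> (0, 0)) * K2 z (w1, 0) = cnj (\<phi> (w1, 0)) * K2 z (0, 0)"
      using \<open>?P2\<close> by blast
    from rkhs_of_kernels[OF this] obtain H1 H2 where "is_rkhs K1 H1" "is_rkhs K2 H2"
      "\<And>f. f \<in> hcarrier H1 \<Longrightarrow> \<exists>g. \<forall>z\<in>bidisc. f z = g (fst z)"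
      "\<And>f z1. \<lbrakk>f \<in> hcarrier H2; z1 \<in> disc\<rbrakk> \<Longrightarrow> \<phi> (0, 0) * f (z1, 0) = \<phi> (z1, 0) * f (0, 0)"
      by blast
    with ak show ?thesis by blast
  qed
  have 32: ?P2 if ?P3
  proof -
    obtain K1 K2 H1 H2 where ak: "agler_kernels \<phi> K1 K2" and H: "is_rkhs K1 H1" "is_rkhs K2 H2"
      and dep: "\<And>f. f \<in> hcarrier H1 \<Longrightarrow> \<exists>g. \<forall>z\<in>bidisc. f z = g (fst z)"
      and cond: "\<And>f z1. \<lbrakk>f \<in> hcarrier H2; z1 \<in> disc\<rbrakk>
        \<Longrightarrow> \<phi> (0, 0) * f (z1, 0) = \<phi> (z1, 0) * f (0, 0)"
      using \<open>?P3\<close> by blast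
    have "\<exists>k. \<forall>z\<in>bidisc. \<forall>w\<in>bidisc. K1 z w = k (fst z) (cnj (fst w))"
      by (rule kernels_of_rkhs(1)[OF ak H dep cond])
    moreover have "\<forall>w1\<in>disc. \<forall>z\<in>bidisc.
        cnj (\<phi> (0, 0)) * K2 z (w1, 0) = cnj (\<phi> (w1, 0)) * K2 z (0, 0)"
      by (intro ballI kernels_of_rkhs(2)[OF ak H dep cond])
    ultimately show ?thesis
      using ak by blast
  qed
  have 14: ?P4 if ?P1
    using that factoring_colligation_of_product[of _ _ \<phi>] by metis
  have 41: ?P1 if ?P4
    using that by (elim exE conjE) (rule 1, rule product_identity_of_colligation, (assumption | rule assms(2))+)
  \<comment> \<open>The colligation lemma is polymorphic in both state spaces, so it yields the
    product identity here too; nothing has to be transported between types.\<close>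
  have 51: ?P1 if ?P4'
    using that by (elim exE conjE) (rule 1, rule product_identity_of_colligation, (assumption | rule assms(2))+)
  show ?thesis
  proof (intro conjI iffI impI)
    show ?P2 if ?P1 by (rule 12[OF that])
    show ?P1 if ?P2 by (rule 21[OF that])
    show ?P3 if ?P2 by (rule 23[OF that])
    show ?P2 if ?P3 by (rule 32[OF that])
    show ?P4 if ?P3 by (rule 14[OF 21[OF 32[OF that]]])
    show ?P3 if ?P4 by (rule 23[OF 12[OF 41[OF that]]])
    show ?P4 if ?P4' by (rule 14[OF 51[OF that]])
  qed
qed

end
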